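(* Let $M$ be a connected, compact Riemannian manifold of vanishing curvature and dimension $d$, let $f:M\to\mathbb{R}$ be $C^3$, and let $T:M\to T(M)$ be a $C^3$ volume-preserving diffeomorphism. Let $q:\mathbb{R}^d\to[0,\infty)$ be a nonnegative probability density with compact support, with mean the origin, and covariance matrix $c\cdot I$, where $I$ is the $d\times d$ identity matrix, and let $\mathcal{L}_\epsilon=\mathcal{D}_{T(M),\epsilon}\mathcal{P}\mathcal{D}_{M,\epsilon}$ be as defined in the context. Then $$\lim_{\epsilon\to 0} \frac{(\mathcal{L}_\epsilon^*\mathcal{L}_\epsilon-I)f(x)}{\epsilon^2}=c\cdot(\triangle+\mathcal{P}^*\triangle\mathcal{P})f(x)$$ for each $x\in \mathring{M}$ (on the left-hand side, $I$ is the identity operator).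
   Context: $M$ and $T(M)$ are compact, connected Riemannian manifolds of dimension $d$ with vanishing curvature, and $M$ is either boundaryless or has $C^\infty$ boundary; $\mathring{M}$ denotes the interior of $M$. $\ell$ is Riemannian (Lebesgue) volume and $\triangle$ is the Laplace operator on $M$ or on $T(M)$. $\mathcal{P}f=f\circ T^{-1}$ is the transfer operator of $T$, and $\mathcal{P}^*g=g\circ T$ is its $L^2$-adjoint. For $\epsilon>0$ put $q_\epsilon(x)=q(x/\epsilon)/\epsilon^d$, and define the diffusion operators $$\mathcal{D}_{M,\epsilon}f(x)=\int_M q_\epsilon(x-y)f(y)\,d\ell(y),\quad x\in\mathring{M},\qquad \mathcal{D}_{T(M),\epsilon}f(x)=\int_{T(M)} q_\epsilon(x-y)f(y)\,d\ell(y),\quad x\in\mathring{T(M)},$$ where the difference $x-y$ of nearby points is understood in flat (Euclidean) coordinates and $\epsilon=\epsilon(x)$ is taken sufficiently small that both operators preserve integrals (no mass is lost through the boundary). $\mathcal{L}_\epsilon^*$ denotes the adjoint of $\mathcal{L}_\epsilon:L^2(M)\to L^2(T(M))$. *)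

theory Defs
  imports "HOL-Analysis.Analysis" "HOL-Library.Extended_Nat"
begin

section \<open>Differentiability classes\<close>

definition pderiv_at :: "'n \<Rightarrow> (real^'n \<Rightarrow> 'b::real_normed_vector) \<Rightarrow> real^'n \<Rightarrow> 'b" where
  "pderiv_at i F z = frechet_derivative F (at z) (axis i 1)"

text \<open>Meant for open \<open>W\<close> only.\<close>

primrec cont_diff :: "nat \<Rightarrow> (real^'n \<Rightarrow> 'b::real_normed_vector) \<Rightarrow> (real^'n) set \<Rightarrow> bool" where
  "cont_diff 0 F W \<longleftrightarrow> continuous_on W F"
| "cont_diff (Suc k) F W \<longleftrightarrow> F differentiable_on W \<and> (\<forall>i. cont_diff k (pderiv_at i F) W)"

text \<open>Class \<open>C\<^sup>m\<close> (\<open>m = \<infinity>\<close> allowed) on an arbitrary set: locally there is a \<open>C\<^sup>m\<close> extension to an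
  open set. This is what differentiability up to the boundary means in a half-space.\<close>

definition C_on :: "enat \<Rightarrow> (real^'n \<Rightarrow> 'b::real_normed_vector) \<Rightarrow> (real^'n) set \<Rightarrow> bool" where
  "C_on m F S \<longleftrightarrow> (\<forall>z\<in>S. \<exists>W G. open W \<and> z \<in> W \<and> (\<forall>k. enat k \<le> m \<longrightarrow> cont_diff k G W)
     \<and> (\<forall>w\<in>W \<inter> S. G w = F w))"

definition jacobian :: "(real^'n \<Rightarrow> real^'m) \<Rightarrow> real^'n \<Rightarrow> real^'n^'m" where
  "jacobian F z = matrix (frechet_derivative F (at z))"

section \<open>Riemannian manifolds with (possibly empty) smooth boundary\<close>

type_synonym ('a, 'n) chart = "'a set \<times> ('a \<Rightarrow> real^'n)"

text \<open>\<open>metric c z\<close> is the Gram matrix of the metric tensor in the chart \<open>c\<close>, at the point with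
  coordinates \<open>z\<close>. The topology of the manifold is the subspace topology of \<open>points\<close>.\<close>

record ('a, 'n::finite) riem =
  points :: "'a set"
  charts :: "('a, 'n) chart set"
  metric :: "('a, 'n) chart \<Rightarrow> real^'n \<Rightarrow> real^'n^'n"

abbreviation cinv :: "('a, 'n::finite) chart \<Rightarrow> real^'n \<Rightarrow> 'a" where
  "cinv c \<equiv> inv_into (fst c) (snd c)"

text \<open>Local models: the whole space and closed half-spaces.\<close>

definition model_space :: "(real^'n) set \<Rightarrow> bool" where
  "model_space H \<longleftrightarrow> H = UNIV \<or> (\<exists>a b. a \<noteq> 0 \<and> H = {z. a \<bullet> z \<le> b})"

definition top_chart :: "'a::t2_space set \<Rightarrow> ('a, 'n::finite) chart \<Rightarrow> bool" where
  "top_chart P = (\<lambda>(U, \<phi>). openin (top_of_set P) U \<and> homeomorphism U (\<phi> ` U) \<phi> (cinv (U, \<phi>)))"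

definition smooth_manifold :: "('a::t2_space, 'n::finite) riem \<Rightarrow> bool" where
  "smooth_manifold M \<longleftrightarrow>
     (\<forall>(U, \<phi>)\<in>charts M. top_chart (points M) (U, \<phi>)
        \<and> (\<exists>H. model_space H \<and> openin (top_of_set H) (\<phi> ` U)))
   \<and> (\<Union>(U, \<phi>)\<in>charts M. U) = points M
   \<and> (\<forall>c\<in>charts M. \<forall>c'\<in>charts M. C_on \<infinity> (snd c' \<circ> cinv c) (snd c ` (fst c \<inter> fst c')))"

text \<open>The transformation law is imposed at coordinates interior to the model; at boundary points
  it follows by continuity.\<close>

definition riemannian_manifold :: "('a::t2_space, 'n::finite) riem \<Rightarrow> bool" where
  "riemannian_manifold M \<longleftrightarrow> smooth_manifold M
   \<and> (\<forall>c\<in>charts M. C_on \<infinity> (metric M c) (snd c ` fst c)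
        \<and> (\<forall>z\<in>snd c ` fst c. transpose (metric M c z) = metric M c z
             \<and> (\<forall>v. v \<noteq> 0 \<longrightarrow> 0 < v \<bullet> (metric M c z *v v))))
   \<and> (\<forall>c\<in>charts M. \<forall>c'\<in>charts M. \<forall>z\<in>interior (snd c ` (fst c \<inter> fst c')).
        let J = jacobian (snd c' \<circ> cinv c) z
        in metric M c z = transpose J ** metric M c' (snd c' (cinv c z)) ** J)"

definition manifold_interior :: "('a::t2_space, 'n::finite) riem \<Rightarrow> 'a set" where
  "manifold_interior M = {p. \<exists>(U, \<phi>)\<in>charts M. p \<in> U \<and> \<phi> p \<in> interior (\<phi> ` U)}"

text \<open>\<open>christoffel g z k i j\<close> is \<open>\<Gamma>\<^sup>k\<^sub>i\<^sub>j\<close>, and \<open>riemann_tensor g z l k i j\<close> is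
  \<open>R\<^sup>l\<^sub>k\<^sub>i\<^sub>j\<close>, the \<open>l\<close>-th component of \<open>R(\<partial>\<^sub>i, \<partial>\<^sub>j)\<partial>\<^sub>k\<close>.\<close>

definition christoffel :: "(real^'n \<Rightarrow> real^'n^'n) \<Rightarrow> real^'n \<Rightarrow> 'n \<Rightarrow> 'n \<Rightarrow> 'n \<Rightarrow> real" where
  "christoffel g z k i j = (\<Sum>l\<in>UNIV. matrix_inv (g z) $ k $ l *
     (pderiv_at i (\<lambda>w. g w $ j $ l) z + pderiv_at j (\<lambda>w. g w $ i $ l) z
        - pderiv_at l (\<lambda>w. g w $ i $ j) z)) / 2"

definition riemann_tensor ::
    "(real^'n \<Rightarrow> real^'n^'n) \<Rightarrow> real^'n \<Rightarrow> 'n \<Rightarrow> 'n \<Rightarrow> 'n \<Rightarrow> 'n \<Rightarrow> real" where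
  "riemann_tensor g z l k i j =
     pderiv_at i (\<lambda>w. christoffel g w l j k) z - pderiv_at j (\<lambda>w. christoffel g w l i k) z
     + (\<Sum>m\<in>UNIV. christoffel g z l i m * christoffel g z m j k
                 - christoffel g z l j m * christoffel g z m i k)"

text \<open>By continuity it is enough to ask for vanishing curvature at interior points.\<close>

definition vanishing_curvature :: "('a::t2_space, 'n::finite) riem \<Rightarrow> bool" where
  "vanishing_curvature M \<longleftrightarrow> (\<forall>c\<in>charts M. \<forall>z\<in>interior (snd c ` fst c). \<forall>l k i j.
     riemann_tensor (metric M c) z l k i j = 0)"

definition flat_compact_manifold :: "('a::t2_space, 'n::finite) riem \<Rightarrow> bool" where
  "flat_compact_manifold M \<longleftrightarrow> riemannian_manifold M \<and> compact (points M) \<and> connected (points M)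
     \<and> vanishing_curvature M"

text \<open>The volume is a Borel measure on \<open>points M\<close>; it is determined by its values inside charts.\<close>

definition riemannian_volume :: "('a::t2_space, 'n::finite) riem \<Rightarrow> 'a measure \<Rightarrow> bool" where
  "riemannian_volume M \<mu> \<longleftrightarrow> sets \<mu> = sets (restrict_space borel (points M))
   \<and> (\<forall>c\<in>charts M. \<forall>A\<in>sets \<mu>. A \<subseteq> fst c \<longrightarrow>
        emeasure \<mu> A = (\<integral>\<^sup>+z\<in>snd c ` A. ennreal (sqrt (det (metric M c z))) \<partial>lborel))"

text \<open>Laplace operator at interior points: the metric trace of the covariant Hessian,
  \<open>g\<^sup>i\<^sup>j (\<partial>\<^sub>i\<partial>\<^sub>j f - \<Gamma>\<^sup>k\<^sub>i\<^sub>j \<partial>\<^sub>k f)\<close>, computed in any chart around the point.\<close>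

definition laplacian :: "('a::t2_space, 'n::finite) riem \<Rightarrow> ('a \<Rightarrow> real) \<Rightarrow> 'a \<Rightarrow> real" where
  "laplacian M f p =
     (let c = (SOME c. c \<in> charts M \<and> p \<in> fst c \<and> snd c p \<in> interior (snd c ` fst c));
          F = f \<circ> cinv c; z = snd c p
      in \<Sum>i\<in>UNIV. \<Sum>j\<in>UNIV. matrix_inv (metric M c z) $ i $ j *
           (pderiv_at i (pderiv_at j F) z
              - (\<Sum>k\<in>UNIV. christoffel (metric M c) z k i j * pderiv_at k F z)))"

definition C_fun :: "enat \<Rightarrow> ('a::t2_space, 'n::finite) riem \<Rightarrow> ('a \<Rightarrow> real) \<Rightarrow> bool" where
  "C_fun m M f \<longleftrightarrow> (\<forall>c\<in>charts M. C_on m (f \<circ> cinv c) (snd c ` fst c))"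

definition C_map ::
    "enat \<Rightarrow> ('a::t2_space, 'n::finite) riem \<Rightarrow> ('b::t2_space, 'm::finite) riem \<Rightarrow> ('a \<Rightarrow> 'b) \<Rightarrow> bool" where
  "C_map m M N T \<longleftrightarrow> T ` points M \<subseteq> points N \<and> continuous_on (points M) T
   \<and> (\<forall>c\<in>charts M. \<forall>c'\<in>charts N.
        C_on m (snd c' \<circ> T \<circ> cinv c) (snd c ` {p \<in> fst c. T p \<in> fst c'}))"

definition C_diffeo ::
    "enat \<Rightarrow> ('a::t2_space, 'n::finite) riem \<Rightarrow> ('b::t2_space, 'n) riem \<Rightarrow> ('a \<Rightarrow> 'b) \<Rightarrow> bool" where
  "C_diffeo m M N T \<longleftrightarrow> bij_betw T (points M) (points N) \<and> C_map m M N T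
     \<and> C_map m N M (inv_into (points M) T)"

definition volume_preserving :: "'a measure \<Rightarrow> 'b measure \<Rightarrow> ('a \<Rightarrow> 'b) \<Rightarrow> bool" where
  "volume_preserving \<mu> \<nu> T \<longleftrightarrow> (\<forall>A\<in>sets \<mu>. T ` A \<in> sets \<nu> \<and> emeasure \<nu> (T ` A) = emeasure \<mu> A)"

section \<open>Flat coordinates and differences of nearby points\<close>

text \<open>Flat coordinates: smooth coordinates (up to the boundary) in which the metric is Euclidean.
  Near the boundary their image is a piece of a smooth domain rather than of a half-space, so they
  are not required to be charts of the atlas.\<close>

definition flat_coordinates :: "('a::t2_space, 'n::finite) riem \<Rightarrow> ('a, 'n) chart \<Rightarrow> bool" where
  "flat_coordinates M = (\<lambda>(U, \<phi>). top_chart (points M) (U, \<phi>)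
   \<and> (\<forall>c\<in>charts M. C_on \<infinity> (\<phi> \<circ> cinv c) (snd c ` (U \<inter> fst c))
        \<and> (\<forall>z\<in>interior (snd c ` (U \<inter> fst c)).
             let J = jacobian (\<phi> \<circ> cinv c) z in transpose J ** J = metric M c z)))"

text \<open>A rule for reading differences: \<open>\<kappa> p\<close> are the flat coordinates in which \<open>p - y\<close> is taken for
  \<open>y\<close> near \<open>p\<close>. Finitely many coordinate systems are used, each one for base points whose closure
  stays inside its domain, so that for small \<open>\<epsilon>\<close> the support of the kernel below is seen by it.\<close>

definition difference_rule :: "('a::t2_space, 'n::finite) riem \<Rightarrow> ('a \<Rightarrow> ('a, 'n) chart) \<Rightarrow> bool" where
  "difference_rule M \<kappa> \<longleftrightarrow> finite (\<kappa> ` points M)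
   \<and> (\<forall>c\<in>\<kappa> ` points M. flat_coordinates M c
        \<and> {p \<in> points M. \<kappa> p = c} \<in> sets (restrict_space borel (points M))
        \<and> closure {p \<in> points M. \<kappa> p = c} \<subseteq> fst c)"

text \<open>Near \<open>x\<close> the differences are those of one flat coordinate system. Flat coordinates are only
  unique up to Euclidean isometries, and \<open>q\<close> need not be rotation invariant. A rule with this
  property at all points at once requires trivial holonomy (it fails for the flat Klein bottle),
  but at any prescribed interior point it can always be achieved.\<close>

definition consistent_near ::
    "('a::t2_space, 'n::finite) riem \<Rightarrow> ('a \<Rightarrow> ('a, 'n) chart) \<Rightarrow> 'a \<Rightarrow> bool" where
  "consistent_near M \<kappa> x \<longleftrightarrow> (\<exists>W \<psi>. x \<in> W \<and> flat_coordinates M (W, \<psi>)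
     \<and> (\<forall>p\<in>W. W \<subseteq> fst (\<kappa> p) \<and> (\<forall>y\<in>W. snd (\<kappa> p) p - snd (\<kappa> p) y = \<psi> p - \<psi> y)))"

section \<open>The operators\<close>

definition scaled_density :: "(real^'n \<Rightarrow> real) \<Rightarrow> real \<Rightarrow> real^'n \<Rightarrow> real" where
  "scaled_density q \<epsilon> z = q (z /\<^sub>R \<epsilon>) / \<epsilon> ^ CARD('n)"

text \<open>\<open>q\<^sub>\<epsilon>(p - y)\<close>; points \<open>y\<close> outside the coordinate domain are not near \<open>p\<close> and contribute nothing.\<close>

definition diffusion_kernel ::
    "('a \<Rightarrow> ('a, 'n::finite) chart) \<Rightarrow> (real^'n \<Rightarrow> real) \<Rightarrow> real \<Rightarrow> 'a \<Rightarrow> 'a \<Rightarrow> real" where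
  "diffusion_kernel \<kappa> q \<epsilon> p y =
     (if y \<in> fst (\<kappa> p) then scaled_density q \<epsilon> (snd (\<kappa> p) p - snd (\<kappa> p) y) else 0)"

text \<open>The same formula is used at boundary points, which form a null set.\<close>

definition diffusion ::
    "'a measure \<Rightarrow> ('a \<Rightarrow> ('a, 'n::finite) chart) \<Rightarrow> (real^'n \<Rightarrow> real) \<Rightarrow> real \<Rightarrow> ('a \<Rightarrow> real) \<Rightarrow> 'a \<Rightarrow> real" where
  "diffusion \<mu> \<kappa> q \<epsilon> f p = (LINT y|\<mu>. diffusion_kernel \<kappa> q \<epsilon> p y * f y)"

definition transfer :: "'a set \<Rightarrow> ('a \<Rightarrow> 'b) \<Rightarrow> ('a \<Rightarrow> real) \<Rightarrow> 'b \<Rightarrow> real" where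
  "transfer P T f = f \<circ> inv_into P T"

definition transfer_adj :: "('a \<Rightarrow> 'b) \<Rightarrow> ('b \<Rightarrow> real) \<Rightarrow> 'a \<Rightarrow> real" where
  "transfer_adj T g = g \<circ> T"

text \<open>\<open>\<L>\<^sub>\<epsilon> = \<D>\<^bsub>T(M),\<epsilon>\<^esub> \<P> \<D>\<^bsub>M,\<epsilon>\<^esub>\<close>, where \<open>P\<close> is the set of points of \<open>M\<close>.\<close>

definition smoothed_transfer ::
    "'a set \<Rightarrow> ('a \<Rightarrow> 'b) \<Rightarrow> 'a measure \<Rightarrow> 'b measure \<Rightarrow> ('a \<Rightarrow> ('a, 'n::finite) chart)
     \<Rightarrow> ('b \<Rightarrow> ('b, 'n) chart) \<Rightarrow> (real^'n \<Rightarrow> real) \<Rightarrow> real \<Rightarrow> ('a \<Rightarrow> real) \<Rightarrow> 'b \<Rightarrow> real" where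
  "smoothed_transfer P T \<mu> \<nu> \<kappa> \<kappa>' q \<epsilon> f =
     diffusion \<nu> \<kappa>' q \<epsilon> (transfer P T (diffusion \<mu> \<kappa> q \<epsilon> f))"

definition L2 :: "'a measure \<Rightarrow> ('a \<Rightarrow> real) set" where
  "L2 \<mu> = {u \<in> borel_measurable \<mu>. integrable \<mu> (\<lambda>y. (u y)\<^sup>2)}"

definition is_L2_adjoint ::
    "'a measure \<Rightarrow> 'b measure \<Rightarrow> (('a \<Rightarrow> real) \<Rightarrow> 'b \<Rightarrow> real) \<Rightarrow> (('b \<Rightarrow> real) \<Rightarrow> 'a \<Rightarrow> real) \<Rightarrow> bool" where
  "is_L2_adjoint \<mu> \<nu> A B \<longleftrightarrow> (\<forall>u\<in>L2 \<mu>. A u \<in> L2 \<nu>) \<and> (\<forall>v\<in>L2 \<nu>. B v \<in> L2 \<mu>)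
     \<and> (\<forall>u\<in>L2 \<mu>. \<forall>v\<in>L2 \<nu>. (LINT y|\<nu>. A u y * v y) = (LINT x|\<mu>. u x * B v x))"

text \<open>An adjoint is unique up to null sets only. Its values are evaluated at a point through
  \<open>point_value\<close>, which does not depend on the version.\<close>

definition L2_adjoint ::
    "'a measure \<Rightarrow> 'b measure \<Rightarrow> (('a \<Rightarrow> real) \<Rightarrow> 'b \<Rightarrow> real) \<Rightarrow> ('b \<Rightarrow> real) \<Rightarrow> 'a \<Rightarrow> real" where
  "L2_adjoint \<mu> \<nu> A = (SOME B. is_L2_adjoint \<mu> \<nu> A B)"

text \<open>The value at \<open>x\<close> of a class of functions modulo null sets: the value of its version that is
  continuous in a neighbourhood of \<open>x\<close>.\<close>

definition has_point_value :: "'a::t2_space measure \<Rightarrow> ('a \<Rightarrow> real) \<Rightarrow> 'a \<Rightarrow> real \<Rightarrow> bool" where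
  "has_point_value \<mu> g x v \<longleftrightarrow> (\<exists>U h. openin (top_of_set (space \<mu>)) U \<and> x \<in> U \<and> continuous_on U h
     \<and> (AE y in \<mu>. y \<in> U \<longrightarrow> g y = h y) \<and> h x = v)"

definition point_value :: "'a::t2_space measure \<Rightarrow> ('a \<Rightarrow> real) \<Rightarrow> 'a \<Rightarrow> real" where
  "point_value \<mu> g x = (THE v. has_point_value \<mu> g x v)"

end

theory Submission
  imports Defs
begin

text \<open>Near an interior point, in flat coordinates, the diffusion operator is the average
  \<open>w \<mapsto> \<integral> q v * w (z - \<epsilon> v) dv\<close>, and its adjoint is the same average for the reflected density.
  By Taylor expansion either of them turns a family \<open>u + \<epsilon>\<^sup>2 h + o(\<epsilon>\<^sup>2)\<close> with \<open>u\<close> of class \<open>C\<^sup>2\<close> and \<open>h\<close>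
  continuous into \<open>u + \<epsilon>\<^sup>2 (h + c/2 * \<Delta>u) + o(\<epsilon>\<^sup>2)\<close>, locally uniformly. Since \<open>T\<close> preserves volume,
  \<open>\<L>\<^sup>*\<L> = \<D>\<^sub>M\<^sup>* \<P>\<^sup>* \<D>\<^sub>N\<^sup>* \<D>\<^sub>N \<P> \<D>\<^sub>M\<close> almost everywhere, so \<open>\<Delta>f\<close> and \<open>\<P>\<^sup>*\<Delta>\<P>f\<close> are each collected twice with the
  factor \<open>c/2\<close>. The right-hand side is continuous near the point, and nonempty open sets have
  positive volume, so it gives the point value.\<close>

section \<open>Calculus of finitely often differentiable functions\<close>

text \<open>Each operator receives the output of the previous one, which depends on \<epsilon> and
  is known only to be continuous. Taylor expansion is therefore applied to the fixed leading term
  alone, while the \<epsilon>-dependent part is carried along as a correction with a uniform error;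
  this makes the expansion stable under repeated averaging.

  Three obstacles shape the rest. Flat coordinates need not be charts of the atlas, whereas
  smoothness, volume and the Laplacian are defined by charts; all three have to be carried over, and
  invertibility of the transition maps is drawn from the metric. The coordinates in which a
  difference is read vary with the base point, so the adjoint kernel involves base points with other
  coordinate systems, and compactness has to exclude distant ones. Finally, the adjoint is selected
  by choice, so a concrete adjoint on all of \<open>L2\<close> must be exhibited before uniqueness
  almost everywhere applies; for the nonsymmetric kernel this is a Schur test.\<close>

lemma pderiv_at_eq:
  assumes "(F has_derivative F') (at z)"
  shows "pderiv_at i F z = F' (axis i 1)"
  using frechet_derivative_at[OF assms] by (simp add: pderiv_at_def)

lemma has_derivative_cong_open:
  assumes "open X" "z \<in> X" "\<And>w. w \<in> X \<Longrightarrow> F w = G w"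
  shows "(F has_derivative D) (at z) \<longleftrightarrow> (G has_derivative D) (at z)"
  using has_derivative_transform_within_open[of _ _ _ _ X] assms by metis

lemma pderiv_at_cong:
  assumes "open X" "z \<in> X" "\<And>w. w \<in> X \<Longrightarrow> F w = G w"
  shows "pderiv_at i F z = pderiv_at i G z"
  using has_derivative_cong_open[OF assms]
  by (simp add: pderiv_at_def frechet_derivative_def)

lemma frechet_derivative_eq_sum_pderiv_at:
  fixes u :: "real^'n \<Rightarrow> real"
  assumes "u differentiable at z"
  shows "frechet_derivative u (at z) h = (\<Sum>a\<in>UNIV. h $ a * pderiv_at a u z)"
proof -
  interpret linear "frechet_derivative u (at z)"
    by (rule linear_frechet_derivative[OF assms])
  have "frechet_derivative u (at z) h = frechet_derivative u (at z) (\<Sum>a\<in>UNIV. h $ a *s axis a 1)"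
    by (simp add: basis_expansion)
  then show ?thesis
    by (simp add: sum scale scalar_mult_eq_scaleR pderiv_at_def)
qed

lemma has_derivative_sum_pderiv_at:
  fixes u :: "real^'n \<Rightarrow> real"
  assumes "u differentiable at z"
  shows "(u has_derivative (\<lambda>h. \<Sum>a\<in>UNIV. h $ a * pderiv_at a u z)) (at z)"
proof -
  have "frechet_derivative u (at z) = (\<lambda>h. \<Sum>a\<in>UNIV. h $ a * pderiv_at a u z)"
    by (rule ext) (rule frechet_derivative_eq_sum_pderiv_at[OF assms])
  then show ?thesis
    using assms by (simp add: frechet_derivative_works)
qed

lemma has_derivative_vec:
  fixes \<Psi> :: "'a::real_normed_vector \<Rightarrow> real^'m"
  assumes "\<And>a. ((\<lambda>z. \<Psi> z $ a) has_derivative (\<lambda>h. D h $ a)) (at z)"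
  shows "(\<Psi> has_derivative D) (at z)"
  unfolding has_derivative_componentwise_within[of \<Psi>]
  using assms by (auto simp: Basis_vec_def inner_axis)

lemma has_derivative_nth:
  fixes \<Psi> :: "'a::real_normed_vector \<Rightarrow> real^'m"
  assumes "(\<Psi> has_derivative D) (at z)"
  shows "((\<lambda>z. \<Psi> z $ a) has_derivative (\<lambda>h. D h $ a)) (at z)"
  by (rule bounded_linear.has_derivative[OF bounded_linear_vec_nth assms])

lemma pderiv_at_nth:
  fixes \<Psi> :: "real^'n \<Rightarrow> real^'m"
  assumes "\<Psi> differentiable at z"
  shows "pderiv_at i (\<lambda>z. \<Psi> z $ a) z = pderiv_at i \<Psi> z $ a"
proof -
  obtain D where "(\<Psi> has_derivative D) (at z)"
    using assms by (auto simp: differentiable_def)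
  from pderiv_at_eq[OF this] pderiv_at_eq[OF has_derivative_nth[OF this]] show ?thesis
    by simp
qed

lemma differentiable_vec:
  fixes \<Psi> :: "real^'n \<Rightarrow> real^'m"
  assumes "\<And>a. (\<lambda>z. \<Psi> z $ a) differentiable at z"
  shows "\<Psi> differentiable at z"
proof -
  have "((\<lambda>z. \<Psi> z $ a) has_derivative (\<lambda>h. (\<chi> a. \<Sum>i\<in>UNIV. h $ i * pderiv_at i (\<lambda>z. \<Psi> z $ a) z) $ a)) (at z)" for a
    using has_derivative_sum_pderiv_at[OF assms[of a]] by simp
  from has_derivative_vec[OF this] show ?thesis
    by (auto simp: differentiable_def)
qed

lemma jacobian_nth:
  fixes \<Psi> :: "real^'n \<Rightarrow> real^'m"
  assumes "\<Psi> differentiable at z"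
  shows "Defs.jacobian \<Psi> z $ a $ i = pderiv_at i (\<lambda>z. \<Psi> z $ a) z"
  using pderiv_at_nth[OF assms] by (simp add: Defs.jacobian_def matrix_def pderiv_at_def)

lemma has_derivative_jacobian:
  fixes \<Psi> :: "real^'n \<Rightarrow> real^'m"
  assumes "\<Psi> differentiable at z"
  shows "(\<Psi> has_derivative (\<lambda>h. Defs.jacobian \<Psi> z *v h)) (at z)"
proof -
  have "(*v) (Defs.jacobian \<Psi> z) = frechet_derivative \<Psi> (at z)"
    unfolding Defs.jacobian_def
    by (intro ext) (simp add: matrix_works linear_frechet_derivative[OF assms])
  then show ?thesis
    using assms by (simp add: frechet_derivative_works)
qed

section \<open>Closure properties of the classes \<open>cont_diff\<close>\<close>

lemma cont_diff_cong:
  assumes "open W" "\<And>z. z \<in> W \<Longrightarrow> F z = G z"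
  shows "cont_diff k F W \<longleftrightarrow> cont_diff k G W"
  using assms(2)
proof (induction k arbitrary: F G)
  case 0
  then show ?case using continuous_on_cong[of W W F G] by simp
next
  case (Suc k)
  have "F differentiable_on W \<longleftrightarrow> G differentiable_on W"
    using has_derivative_cong_open[OF assms(1) _ Suc.prems]
    by (simp add: differentiable_on_eq_differentiable_at[OF assms(1)] differentiable_def)
  moreover have "cont_diff k (pderiv_at i F) W \<longleftrightarrow> cont_diff k (pderiv_at i G) W" for i
    by (rule Suc.IH) (rule pderiv_at_cong[OF assms(1) _ Suc.prems])
  ultimately show ?case by simp
qed

lemma cont_diff_subset:
  assumes "cont_diff k F W" "V \<subseteq> W"
  shows "cont_diff k F V"
  using assms
  by (induction k arbitrary: F) (auto intro: continuous_on_subset differentiable_on_subset)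

lemma cont_diff_SucD: "cont_diff (Suc k) F W \<Longrightarrow> cont_diff k F W"
  by (induction k arbitrary: F) (auto intro: differentiable_imp_continuous_on)

lemma cont_diff_le: "cont_diff k F W \<Longrightarrow> j \<le> k \<Longrightarrow> cont_diff j F W"
  by (induction k) (auto simp: le_Suc_eq simp del: cont_diff.simps(2) dest: cont_diff_SucD)

lemma cont_diff_Suc_differentiable:
  assumes "cont_diff (Suc k) F W" "open W" "z \<in> W"
  shows "F differentiable at z"
  using assms by (auto simp: differentiable_on_eq_differentiable_at)

lemma cont_diff_SucI:
  assumes "open W" "\<And>z. z \<in> W \<Longrightarrow> F differentiable at z"
    and "\<And>i z. z \<in> W \<Longrightarrow> pderiv_at i F z = D i z" "\<And>i. cont_diff k (D i) W"
  shows "cont_diff (Suc k) F W"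
  using assms cont_diff_cong[OF assms(1), of "pderiv_at i F" "D i" k for i]
  by (simp add: differentiable_on_eq_differentiable_at)

lemma cont_diff_const: "open W \<Longrightarrow> cont_diff k (\<lambda>_. c) W"
proof (induction k arbitrary: c)
  case (Suc k)
  show ?case
    by (rule cont_diff_SucI[where D="\<lambda>i z. 0"]) (use Suc in \<open>auto intro: pderiv_at_eq\<close>)
qed simp

lemma cont_diff_nth:
  fixes F :: "real^'n \<Rightarrow> real^'m"
  assumes "open W" "cont_diff k F W"
  shows "cont_diff k (\<lambda>z. F z $ a) W"
  using assms(2)
proof (induction k arbitrary: F)
  case (Suc k)
  note diff = cont_diff_Suc_differentiable[OF Suc.prems assms(1)]
  show ?case
  proof (rule cont_diff_SucI[where D="\<lambda>i z. pderiv_at i F z $ a"])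
    show "(\<lambda>z. F z $ a) differentiable at z" if "z \<in> W" for z
      using diff[OF that] has_derivative_nth[of F] by (metis differentiable_def)
    show "cont_diff k (\<lambda>z. pderiv_at i F z $ a) W" for i
      using Suc by simp
    show "pderiv_at i (\<lambda>z. F z $ a) z = pderiv_at i F z $ a" if "z \<in> W" for i z
      by (rule pderiv_at_nth[OF diff[OF that]])
  qed (rule assms)
qed (simp add: continuous_on_component)

lemma cont_diff_add:
  fixes u v :: "real^'n \<Rightarrow> real"
  assumes "open W" "cont_diff k u W" "cont_diff k v W"
  shows "cont_diff k (\<lambda>z. u z + v z) W"
  using assms(2,3)
proof (induction k arbitrary: u v)
  case (Suc k)
  note diff = cont_diff_Suc_differentiable[OF Suc.prems(1) assms(1)]
    cont_diff_Suc_differentiable[OF Suc.prems(2) assms(1)]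
  show ?case
  proof (rule cont_diff_SucI[where D="\<lambda>i z. pderiv_at i u z + pderiv_at i v z"])
    show "pderiv_at i (\<lambda>z. u z + v z) z = pderiv_at i u z + pderiv_at i v z" if "z \<in> W" for i z
      using diff[OF that] unfolding pderiv_at_def
      by (subst frechet_derivative_at[symmetric, OF has_derivative_add])
        (auto simp: frechet_derivative_works[symmetric])
    show "(\<lambda>z. u z + v z) differentiable at z" if "z \<in> W" for z
      using diff[OF that] by (rule differentiable_add)
    show "cont_diff k (\<lambda>z. pderiv_at i u z + pderiv_at i v z) W" for i
      by (rule Suc.IH) (use Suc.prems in simp_all)
  qed (rule assms)
qed (simp add: continuous_on_add)

lemma cont_diff_mult:
  fixes u v :: "real^'n \<Rightarrow> real"
  assumes "open W" "cont_diff k u W" "cont_diff k v W"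
  shows "cont_diff k (\<lambda>z. u z * v z) W"
  using assms(2,3)
proof (induction k arbitrary: u v)
  case (Suc k)
  note diff = cont_diff_Suc_differentiable[OF Suc.prems(1) assms(1)]
    cont_diff_Suc_differentiable[OF Suc.prems(2) assms(1)]
  show ?case
  proof (rule cont_diff_SucI[where D="\<lambda>i z. u z * pderiv_at i v z + pderiv_at i u z * v z"])
    show "pderiv_at i (\<lambda>z. u z * v z) z = u z * pderiv_at i v z + pderiv_at i u z * v z"
      if "z \<in> W" for i z
      using diff[OF that] unfolding pderiv_at_def
      by (subst frechet_derivative_at[symmetric, OF has_derivative_mult])
        (auto simp: frechet_derivative_works[symmetric])
    show "cont_diff k (\<lambda>z. u z * pderiv_at i v z + pderiv_at i u z * v z) W" for i
      using Suc.prems by (intro cont_diff_add Suc.IH assms cont_diff_SucD[OF Suc.prems(1)] cont_diff_SucD[OF Suc.prems(2)]) simp_all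
    show "(\<lambda>z. u z * v z) differentiable at z" if "z \<in> W" for z
      using diff[OF that] by (rule differentiable_mult)
  qed (rule assms)
qed (simp add: continuous_on_mult)

lemma cont_diff_sum:
  fixes u :: "'i \<Rightarrow> real^'n \<Rightarrow> real"
  assumes "open W" "\<And>i. i \<in> I \<Longrightarrow> cont_diff k (u i) W"
  shows "cont_diff k (\<lambda>z. \<Sum>i\<in>I. u i z) W"
  using assms(2)
  by (induction I rule: infinite_finite_induct)
    (simp_all add: cont_diff_const[OF assms(1)] cont_diff_add[OF assms(1)])

lemma cont_diff_prod:
  fixes u :: "'i \<Rightarrow> real^'n \<Rightarrow> real"
  assumes "open W" "\<And>i. i \<in> I \<Longrightarrow> cont_diff k (u i) W"
  shows "cont_diff k (\<lambda>z. \<Prod>i\<in>I. u i z) W"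
  using assms(2)
  by (induction I rule: infinite_finite_induct)
    (simp_all add: cont_diff_const[OF assms(1)] cont_diff_mult[OF assms(1)])

lemma cont_diff_inverse:
  fixes u :: "real^'n \<Rightarrow> real"
  assumes "open W" "cont_diff k u W" "\<And>z. z \<in> W \<Longrightarrow> u z \<noteq> 0"
  shows "cont_diff k (\<lambda>z. inverse (u z)) W"
  using assms(2)
proof (induction k)
  case (Suc k)
  note diff = cont_diff_Suc_differentiable[OF Suc.prems(1) assms(1)]
  have IH: "cont_diff k (\<lambda>z. inverse (u z)) W"
    using Suc cont_diff_SucD by blast
  show ?case
  proof (rule cont_diff_SucI[where D="\<lambda>i z. (-1) * (pderiv_at i u z * (inverse (u z) * inverse (u z)))"])
    show "pderiv_at i (\<lambda>z. inverse (u z)) z = (-1) * (pderiv_at i u z * (inverse (u z) * inverse (u z)))"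
      if "z \<in> W" for i z
      using diff[OF that] unfolding pderiv_at_def
      by (subst frechet_derivative_at[symmetric, OF Deriv.has_derivative_inverse])
        (auto simp: frechet_derivative_works[symmetric] assms that)
    show "cont_diff k (\<lambda>z. (-1) * (pderiv_at i u z * (inverse (u z) * inverse (u z)))) W" for i
      using Suc.prems by (intro cont_diff_mult IH assms cont_diff_const) simp_all
    show "(\<lambda>z. inverse (u z)) differentiable at z" if "z \<in> W" for z
      using diff[OF that] assms(3)[OF that] by (rule differentiable_inverse)
  qed (rule assms)
qed (use assms in \<open>simp add: continuous_on_inverse\<close>)

lemma continuous_on_vec:
  fixes \<Psi> :: "'a::topological_space \<Rightarrow> real^'m"
  assumes "\<And>a. continuous_on W (\<lambda>z. \<Psi> z $ a)"
  shows "continuous_on W \<Psi>"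
  using continuous_on_vec_lambda[of W "\<lambda>i z. \<Psi> z $ i"] assms by simp

lemma pderiv_at_compose:
  fixes u :: "real^'m \<Rightarrow> real" and \<Psi> :: "real^'n \<Rightarrow> real^'m"
  assumes "\<Psi> differentiable at z" "u differentiable at (\<Psi> z)"
  shows "(u \<circ> \<Psi>) differentiable at z"
    and "pderiv_at i (u \<circ> \<Psi>) z = (\<Sum>a\<in>UNIV. pderiv_at a u (\<Psi> z) * pderiv_at i (\<lambda>z. \<Psi> z $ a) z)"
proof -
  have "((u \<circ> \<Psi>) has_derivative (\<lambda>h. \<Sum>a\<in>UNIV. h $ a * pderiv_at a u (\<Psi> z)) \<circ> frechet_derivative \<Psi> (at z)) (at z)"
    using assms has_derivative_sum_pderiv_at[OF assms(2)]
    by (intro diff_chain_at) (auto simp: frechet_derivative_works[symmetric])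
  note * = this
  show "(u \<circ> \<Psi>) differentiable at z"
    using * by (auto simp: differentiable_def)
  show "pderiv_at i (u \<circ> \<Psi>) z = (\<Sum>a\<in>UNIV. pderiv_at a u (\<Psi> z) * pderiv_at i (\<lambda>z. \<Psi> z $ a) z)"
    unfolding pderiv_at_eq[OF *] pderiv_at_nth[OF assms(1)] by (simp add: pderiv_at_def mult.commute)
qed

text \<open>The induction varies \<open>u\<close> but keeps \<open>\<Psi>\<close>: the chain rule
  produces \<open>pderiv_at a u \<circ> \<Psi>\<close>, again a composition with the same inner map,
  times partial derivatives of \<open>\<Psi>\<close> of one order less.\<close>

lemma cont_diff_compose:
  fixes u :: "real^'m \<Rightarrow> real" and \<Psi> :: "real^'n \<Rightarrow> real^'m"
  assumes "open W" "open V" "\<Psi> ` W \<subseteq> V" "cont_diff k u V" "\<And>a. cont_diff k (\<lambda>z. \<Psi> z $ a) W"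
  shows "cont_diff k (u \<circ> \<Psi>) W"
  using assms(4,5)
proof (induction k arbitrary: u)
  case 0
  have "continuous_on W \<Psi>"
    using 0 by (auto intro: continuous_on_vec)
  then show ?case
    using 0 assms(3) continuous_on_compose2[of V u W \<Psi>] by (simp add: o_def)
next
  case (Suc k)
  have diff\<Psi>: "\<Psi> differentiable at z" if "z \<in> W" for z
    by (intro differentiable_vec cont_diff_Suc_differentiable[OF Suc.prems(2) assms(1) that])
  have diffu: "u differentiable at (\<Psi> z)" if "z \<in> W" for z
    using cont_diff_Suc_differentiable[OF Suc.prems(1) assms(2)] that assms by auto
  have "cont_diff k (pderiv_at a u \<circ> \<Psi>) W" for a
    using Suc.prems(1) cont_diff_SucD[OF Suc.prems(2)] by (intro Suc.IH) simp_all
  then have "cont_diff k (\<lambda>z. \<Sum>a\<in>UNIV. (pderiv_at a u \<circ> \<Psi>) z * pderiv_at i (\<lambda>z. \<Psi> z $ a) z) W" for i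
    using Suc.prems by (intro cont_diff_sum cont_diff_mult assms) (simp_all add: o_def)
  then have "cont_diff k (\<lambda>z. \<Sum>a\<in>UNIV. pderiv_at a u (\<Psi> z) * pderiv_at i (\<lambda>z. \<Psi> z $ a) z) W" for i
    by simp
  then show ?case
    by (rule cont_diff_SucI[OF assms(1) pderiv_at_compose(1)[OF diff\<Psi> diffu],
          where D="\<lambda>i z. \<Sum>a\<in>UNIV. pderiv_at a u (\<Psi> z) * pderiv_at i (\<lambda>z. \<Psi> z $ a) z", rotated -1])
      (auto intro: pderiv_at_compose(2)[OF diff\<Psi> diffu])
qed

lemma cont_diff_det:
  fixes A :: "real^'n \<Rightarrow> real^'m^'m"
  assumes "open W" "\<And>i j. cont_diff k (\<lambda>z. A z $ i $ j) W"
  shows "cont_diff k (\<lambda>z. det (A z)) W"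
  unfolding det_def by (intro cont_diff_sum cont_diff_mult cont_diff_prod cont_diff_const assms)

text \<open>Cramer's rule for the \<open>j\<close>-th column of the inverse. The right-hand side
  consists of determinants and one reciprocal, so smooth dependence on the matrix reduces to sums,
  products and \<open>cont_diff_inverse\<close>.\<close>

lemma matrix_inv_nth:
  fixes A :: "real^'m^'m"
  assumes "det A \<noteq> 0"
  shows "matrix_inv A $ a $ j = det (\<chi> i l. if l = a then axis j 1 $ i else A $ i $ l) * inverse (det A)"
proof -
  have "invertible A"
    using assms by (simp add: invertible_det_nz)
  then have "A ** matrix_inv A = mat 1"
    unfolding invertible_def matrix_inv_def by (rule someI2_ex) auto
  then have "A *v (matrix_inv A *v axis j 1) = axis j 1"
    by (metis matrix_vector_mul_assoc matrix_vector_mul_lid)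
  then have "matrix_inv A *v axis j 1 = (\<chi> k. det (\<chi> i l. if l = k then axis j 1 $ i else A $ i $ l) / det A)"
    using cramer[OF assms] by blast
  then have "(matrix_inv A *v axis j 1) $ a = det (\<chi> i l. if l = a then axis j 1 $ i else A $ i $ l) / det A"
    by simp
  then show ?thesis
    by (simp add: matrix_vector_mult_basis column_def divide_inverse)
qed

lemma cont_diff_matrix_inv:
  fixes A :: "real^'n \<Rightarrow> real^'m^'m"
  assumes "open W" "\<And>i j. cont_diff k (\<lambda>z. A z $ i $ j) W" "\<And>z. z \<in> W \<Longrightarrow> det (A z) \<noteq> 0"
  shows "cont_diff k (\<lambda>z. matrix_inv (A z) $ a $ j) W"
proof -
  have "cont_diff k (\<lambda>z. det (\<chi> i l. if l = a then axis j 1 $ i else A z $ i $ l) * inverse (det (A z))) W"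
  proof (intro cont_diff_mult cont_diff_det cont_diff_inverse assms)
    show "cont_diff k (\<lambda>z. (\<chi> i l. if l = a then axis j 1 $ i else A z $ i $ l) $ i $ l) W" for i l
      using assms by (cases "l = a") (auto intro: cont_diff_const)
  qed
  then show ?thesis
    by (subst cont_diff_cong[OF assms(1)]) (auto simp: matrix_inv_nth assms)
qed

text \<open>A bootstrap: the derivative of \<open>g\<close> at \<open>w\<close> is the inverse of
  the Jacobian of \<open>\<Phi>\<close> at \<open>g w\<close>, so order \<open>k\<close> of
  \<open>g\<close> gives order \<open>k\<close> of its derivative and order \<open>k + 1\<close> of
  \<open>g\<close>. Continuity of \<open>g\<close> starts the induction; the Jacobian, of order
  \<open>m\<close>, ends it at \<open>Suc m\<close>.\<close>

lemma cont_diff_inverse_map: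
  fixes \<Phi> :: "real^'n \<Rightarrow> real^'n"
  assumes "open V" "open W" "\<And>a. cont_diff (Suc m) (\<lambda>z. \<Phi> z $ a) V"
    and g: "g ` W \<subseteq> V" "\<And>w. w \<in> W \<Longrightarrow> \<Phi> (g w) = w" "continuous_on W g"
    and nz: "\<And>z. z \<in> V \<Longrightarrow> det (Defs.jacobian \<Phi> z) \<noteq> 0"
  shows "cont_diff (Suc m) (\<lambda>w. g w $ a) W"
proof -
  let ?J = "\<lambda>z. Defs.jacobian \<Phi> z"
  have diff: "\<Phi> differentiable at z" if "z \<in> V" for z
    by (intro differentiable_vec cont_diff_Suc_differentiable[OF assms(3) assms(1) that])
  have gder: "(g has_derivative (\<lambda>h. matrix_inv (?J (g w)) *v h)) (at w)" if w: "w \<in> W" for w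
  proof (rule has_derivative_inverse_basic[where T=W])
    have gw: "g w \<in> V" using g w by auto
    show "(\<Phi> has_derivative (\<lambda>h. ?J (g w) *v h)) (at (g w))"
      by (rule has_derivative_jacobian[OF diff[OF gw]])
    show "bounded_linear ((*v) (matrix_inv (?J (g w))))"
      by (rule matrix_vector_mul_bounded_linear)
    have "invertible (?J (g w))"
      using nz[OF gw] by (simp add: invertible_det_nz)
    then have "matrix_inv (?J (g w)) ** ?J (g w) = mat 1"
      unfolding invertible_def matrix_inv_def by (rule someI2_ex) auto
    then show "(*v) (matrix_inv (?J (g w))) \<circ> (*v) (?J (g w)) = id"
      by (auto simp: fun_eq_iff matrix_vector_mul_assoc)
    show "continuous (at w) g"
      using g(3) w assms(2) by (simp add: continuous_on_eq_continuous_at)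
  qed (use assms w in auto)
  have pg: "pderiv_at i (\<lambda>w. g w $ a) w = matrix_inv (?J (g w)) $ a $ i" if "w \<in> W" for i a w
    using pderiv_at_eq[OF has_derivative_nth[OF gder[OF that]]]
    by (simp add: matrix_vector_mult_basis column_def)
  have J: "cont_diff m (\<lambda>z. ?J z $ a $ i) V" for a i
    using assms(1,3) diff cont_diff_cong[OF assms(1), of "\<lambda>z. ?J z $ a $ i" "pderiv_at i (\<lambda>z. \<Phi> z $ a)"]
    by (auto simp: jacobian_nth)
  have *: "cont_diff k (\<lambda>w. g w $ a) W" if "k \<le> Suc m" for k a
    using that
  proof (induction k arbitrary: a)
    case 0
    then show ?case using g(3) by (simp add: continuous_on_component)
  next
    case (Suc k)
    show ?case
    proof (rule cont_diff_SucI[OF assms(2)])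
      show "(\<lambda>w. g w $ a) differentiable at z" if "z \<in> W" for z
        using has_derivative_nth[OF gder[OF that]] by (auto simp: differentiable_def)
      show "pderiv_at i (\<lambda>w. g w $ a) z = ((\<lambda>z. matrix_inv (?J z) $ a $ i) \<circ> g) z" if "z \<in> W" for i z
        using pg[OF that] by simp
      have "cont_diff k (\<lambda>z. ?J z $ a $ i) V" for a i
        using J Suc.prems by (auto intro: cont_diff_le)
      then show "cont_diff k ((\<lambda>z. matrix_inv (?J z) $ a $ i) \<circ> g) W" for i
        using Suc by (intro cont_diff_compose[OF assms(2,1) g(1)] cont_diff_matrix_inv assms(1) nz) auto
    qed
  qed
  show ?thesis by (rule *) simp
qed

section \<open>Symmetry of second partial derivatives\<close>

lemma has_real_derivative_along_axis:
  fixes u :: "real^'n \<Rightarrow> real"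
  assumes "u differentiable at (z + t *\<^sub>R axis i 1)"
  shows "((\<lambda>t. u (z + t *\<^sub>R axis i 1)) has_real_derivative pderiv_at i u (z + t *\<^sub>R axis i 1)) (at t)"
proof -
  have "((\<lambda>t. z + t *\<^sub>R axis i 1) has_derivative (\<lambda>s. s *\<^sub>R axis i 1)) (at t)"
    by (auto intro!: derivative_eq_intros)
  from diff_chain_at[OF this has_derivative_sum_pderiv_at[OF assms]]
  have "((\<lambda>t. u (z + t *\<^sub>R axis i 1)) has_derivative
      (\<lambda>s. \<Sum>a\<in>UNIV. (s *\<^sub>R axis i 1) $ a * pderiv_at a u (z + t *\<^sub>R axis i 1))) (at t)"
    by (simp add: o_def)
  moreover have "(\<Sum>a\<in>UNIV. (s *\<^sub>R axis i (1::real)) $ a * pderiv_at a u (z + t *\<^sub>R axis i 1))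
      = pderiv_at i u (z + t *\<^sub>R axis i 1) * s" for s
    by (subst sum.remove[of _ i]) (auto simp: axis_def)
  ultimately show ?thesis
    by (simp add: has_field_derivative_def)
qed

text \<open>The second difference of \<open>u\<close> over a square of side \<open>h\<close> is \<open>h\<^sup>2\<close> times a mixed partial derivative;
  which one depends on the order in which the mean value theorem is applied to the two sides.\<close>

lemma second_difference:
  fixes u :: "real^'n \<Rightarrow> real"
  assumes "cont_diff 2 u (ball z r)" "0 < h" "2 * h < r"
  obtains s t where "0 < s" "s < h" "0 < t" "t < h"
    "u (z + h *\<^sub>R axis i 1 + h *\<^sub>R axis j 1) - u (z + h *\<^sub>R axis i 1) - u (z + h *\<^sub>R axis j 1) + u z
      = h\<^sup>2 * pderiv_at j (pderiv_at i u) (z + s *\<^sub>R axis i 1 + t *\<^sub>R axis j 1)"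
proof -
  have in_ball: "z + s *\<^sub>R axis i 1 + t *\<^sub>R axis j 1 \<in> ball z r"
    if "0 \<le> s" "s \<le> h" "0 \<le> t" "t \<le> h" for s t
    using that assms norm_triangle_ineq[of "s *\<^sub>R axis i (1::real)" "t *\<^sub>R axis j 1"]
      norm_minus_cancel[of "s *\<^sub>R axis i (1::real) + t *\<^sub>R axis j 1"]
    by (simp add: dist_norm add.assoc)
  have diff1: "u differentiable at w" if "w \<in> ball z r" for w
    using cont_diff_Suc_differentiable[of 1 u] assms(1) that by (simp add: numeral_2_eq_2)
  have diff2: "pderiv_at i u differentiable at w" if "w \<in> ball z r" for w
    using cont_diff_Suc_differentiable[of 0 "pderiv_at i u" "ball z r"] assms(1) that by (simp add: numeral_2_eq_2)
  let ?p = "\<lambda>s t. z + s *\<^sub>R axis i 1 + t *\<^sub>R axis j 1"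
  have swap: "?p s t = (z + t *\<^sub>R axis j 1) + s *\<^sub>R axis i 1" for s t
    by (simp add: algebra_simps)
  have d1: "((\<lambda>s. u (?p s h) - u (?p s 0)) has_real_derivative
      pderiv_at i u (?p s h) - pderiv_at i u (?p s 0)) (at s)" if "0 \<le> s" "s \<le> h" for s
    unfolding swap using that in_ball assms(2)
    using in_ball[of s h] in_ball[of s 0]
    by (intro derivative_intros has_real_derivative_along_axis diff1) (simp_all add: add_ac)
  obtain s where s: "0 < s" "s < h"
    "(u (?p h h) - u (?p h 0)) - (u (?p 0 h) - u (?p 0 0)) = (h - 0) * (pderiv_at i u (?p s h) - pderiv_at i u (?p s 0))"
    using MVT2[OF assms(2) d1] by blast
  have d2: "((\<lambda>t. pderiv_at i u (?p s t)) has_real_derivative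
      pderiv_at j (pderiv_at i u) (?p s t)) (at t)" if "0 \<le> t" "t \<le> h" for t
    using that s in_ball by (intro has_real_derivative_along_axis diff2) auto
  obtain t where t: "0 < t" "t < h"
    "pderiv_at i u (?p s h) - pderiv_at i u (?p s 0) = (h - 0) * pderiv_at j (pderiv_at i u) (?p s t)"
    using MVT2[OF assms(2) d2] by blast
  show ?thesis
  proof (rule that[OF s(1,2) t(1,2)])
    show "u (z + h *\<^sub>R axis i 1 + h *\<^sub>R axis j 1) - u (z + h *\<^sub>R axis i 1) - u (z + h *\<^sub>R axis j 1) + u z
      = h\<^sup>2 * pderiv_at j (pderiv_at i u) (?p s t)"
      using s(3) t(3) by (simp add: power2_eq_square)
  qed
qed

text \<open>The second difference over a square does not change when its two sides are exchanged.
  Hence one mixed derivative at some point equals the other mixed derivative at another point, both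
  within \<open>2 * h\<close> of \<open>z\<close>, and continuity identifies the values at
  \<open>z\<close> as \<open>h\<close> shrinks.\<close>

lemma pderiv_at_commute:
  fixes u :: "real^'n \<Rightarrow> real"
  assumes "cont_diff 2 u W" "open W" "z \<in> W"
  shows "pderiv_at i (pderiv_at j u) z = pderiv_at j (pderiv_at i u) z"
proof -
  obtain r where r: "0 < r" "ball z r \<subseteq> W"
    using assms(2,3) open_contains_ball by blast
  have cd: "cont_diff 2 u (ball z r)"
    by (rule cont_diff_subset[OF assms(1) r(2)])
  have *: "\<exists>\<xi> \<eta>. dist z \<xi> \<le> 2 * h \<and> dist z \<eta> \<le> 2 * h \<and>
      pderiv_at i (pderiv_at j u) \<xi> = pderiv_at j (pderiv_at i u) \<eta>" if h: "0 < h" "2 * h < r" for h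
  proof -
    have near: "dist z (z + s *\<^sub>R axis i 1 + t *\<^sub>R axis j 1) \<le> 2 * h" if "0 < s" "s < h" "0 < t" "t < h" for s t i j
    proof -
      have "dist z (z + s *\<^sub>R axis i 1 + t *\<^sub>R axis j 1) = norm (s *\<^sub>R axis i 1 + t *\<^sub>R axis j (1::real))"
        by (metis add.assoc add_diff_cancel_left' dist_commute dist_norm)
      also have "\<dots> \<le> s + t"
        using norm_triangle_ineq[of "s *\<^sub>R axis i (1::real)" "t *\<^sub>R axis j 1"] that by simp
      finally show ?thesis using that by simp
    qed
    obtain s t where 1: "0 < s" "s < h" "0 < t" "t < h"
      "u (z + h *\<^sub>R axis i 1 + h *\<^sub>R axis j 1) - u (z + h *\<^sub>R axis i 1) - u (z + h *\<^sub>R axis j 1) + u z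
        = h\<^sup>2 * pderiv_at j (pderiv_at i u) (z + s *\<^sub>R axis i 1 + t *\<^sub>R axis j 1)"
      using second_difference[OF cd h] by blast
    obtain s' t' where 2: "0 < s'" "s' < h" "0 < t'" "t' < h"
      "u (z + h *\<^sub>R axis j 1 + h *\<^sub>R axis i 1) - u (z + h *\<^sub>R axis j 1) - u (z + h *\<^sub>R axis i 1) + u z
        = h\<^sup>2 * pderiv_at i (pderiv_at j u) (z + s' *\<^sub>R axis j 1 + t' *\<^sub>R axis i 1)"
      using second_difference[OF cd h] by blast
    have "z + h *\<^sub>R axis j 1 + h *\<^sub>R axis i 1 = z + h *\<^sub>R axis i 1 + h *\<^sub>R axis j 1"
      by (simp add: algebra_simps)
    with 2(5) have "u (z + h *\<^sub>R axis i 1 + h *\<^sub>R axis j 1) - u (z + h *\<^sub>R axis j 1) - u (z + h *\<^sub>R axis i 1) + u z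
        = h\<^sup>2 * pderiv_at i (pderiv_at j u) (z + s' *\<^sub>R axis j 1 + t' *\<^sub>R axis i 1)"
      by simp
    with 1(5) have "h\<^sup>2 * pderiv_at i (pderiv_at j u) (z + s' *\<^sub>R axis j 1 + t' *\<^sub>R axis i 1)
        = h\<^sup>2 * pderiv_at j (pderiv_at i u) (z + s *\<^sub>R axis i 1 + t *\<^sub>R axis j 1)"
      by linarith
    then show ?thesis
      using h near[OF 1(1-4)] near[OF 2(1-4)] by (metis mult_cancel_left power_not_zero less_irrefl)
  qed
  have cont: "isCont (pderiv_at a (pderiv_at b u)) z" for a b
    using cd r(1) by (auto simp: numeral_2_eq_2 continuous_on_eq_continuous_at)
  show ?thesis
  proof (rule ccontr)
    assume ne: "pderiv_at i (pderiv_at j u) z \<noteq> pderiv_at j (pderiv_at i u) z"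
    define e where "e = \<bar>pderiv_at i (pderiv_at j u) z - pderiv_at j (pderiv_at i u) z\<bar> / 2"
    have e: "0 < e" using ne by (simp add: e_def)
    obtain d1 where d1: "0 < d1" "\<And>w. dist w z < d1 \<Longrightarrow> \<bar>pderiv_at i (pderiv_at j u) w - pderiv_at i (pderiv_at j u) z\<bar> < e"
      using cont[of i j] e unfolding continuous_at_eps_delta dist_real_def by blast
    obtain d2 where d2: "0 < d2" "\<And>w. dist w z < d2 \<Longrightarrow> \<bar>pderiv_at j (pderiv_at i u) w - pderiv_at j (pderiv_at i u) z\<bar> < e"
      using cont[of j i] e unfolding continuous_at_eps_delta dist_real_def by blast
    \<comment> \<open>Dividing by 3 makes \<open>2 * h\<close> strictly smaller than each of the
      three radii.\<close>
    define h where "h = Min {d1, d2, r} / 3"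
    have h: "0 < h" "2 * h < r" "2 * h < d1" "2 * h < d2"
      using d1 d2 r by (auto simp: h_def)
    obtain \<xi> \<eta> where "dist z \<xi> \<le> 2 * h" "dist z \<eta> \<le> 2 * h"
      "pderiv_at i (pderiv_at j u) \<xi> = pderiv_at j (pderiv_at i u) \<eta>"
      using *[OF h(1,2)] by blast
    then show False
      using d1(2)[of \<xi>] d2(2)[of \<eta>] h unfolding e_def by (simp add: dist_commute) argo
  qed
qed

section \<open>Second-order expansion of averages\<close>

text \<open>With two continuous derivatives the remainder is the change of the second derivatives
  along the segment, so the bound is expressed by their oscillation \<open>e\<close>. The square of
  the dimension counts the index pairs, each estimated by
  \<open>norm h * norm h * e\<close>.\<close>

lemma taylor_second_order:
  fixes u :: "real^'n \<Rightarrow> real"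
  assumes u: "cont_diff 2 u W" "open W" and seg: "\<And>t. 0 \<le> t \<Longrightarrow> t \<le> 1 \<Longrightarrow> z + t *\<^sub>R h \<in> W"
    and osc: "\<And>t i j. 0 \<le> t \<Longrightarrow> t \<le> 1 \<Longrightarrow>
      \<bar>pderiv_at j (pderiv_at i u) (z + t *\<^sub>R h) - pderiv_at j (pderiv_at i u) z\<bar> \<le> e"
  shows "\<bar>u (z + h) - u z - (\<Sum>i\<in>UNIV. h $ i * pderiv_at i u z)
      - (\<Sum>i\<in>UNIV. \<Sum>j\<in>UNIV. h $ i * h $ j * pderiv_at j (pderiv_at i u) z) / 2\<bar>
    \<le> e * (real CARD('n))\<^sup>2 * (norm h)\<^sup>2 / 2"
proof -
  have diff1: "u differentiable at w" if "w \<in> W" for w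
    using cont_diff_Suc_differentiable[of 1 u] u that by (simp add: numeral_2_eq_2)
  have diff2: "pderiv_at i u differentiable at w" if "w \<in> W" for w i
    using cont_diff_Suc_differentiable[of 0 "pderiv_at i u" W] u that by (simp add: numeral_2_eq_2)
  have line: "((\<lambda>t. v (z + t *\<^sub>R h)) has_real_derivative (\<Sum>i\<in>UNIV. h $ i * pderiv_at i v (z + t *\<^sub>R h))) (at t)"
    if "v differentiable at (z + t *\<^sub>R h)" for v t
  proof -
    have "((\<lambda>t. z + t *\<^sub>R h) has_derivative (\<lambda>s. s *\<^sub>R h)) (at t)"
      by (auto intro!: derivative_eq_intros)
    from diff_chain_at[OF this has_derivative_sum_pderiv_at[OF that], unfolded o_def] show ?thesis
      unfolding has_field_derivative_def
      by (rule has_derivative_eq_rhs) (simp add: fun_eq_iff sum_distrib_left sum_distrib_right ac_simps)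
  qed
  \<comment> \<open>\<open>D 0\<close>, \<open>D 1\<close>, \<open>D 2\<close> are \<open>u\<close>
    along the segment and its first two derivatives in \<open>t\<close>, the second in the nested
    form that differentiating the first one yields.\<close>
  define D where "D m t = (if m = 0 then u (z + t *\<^sub>R h)
    else if m = 1 then \<Sum>i\<in>UNIV. h $ i * pderiv_at i u (z + t *\<^sub>R h)
    else \<Sum>i\<in>UNIV. h $ i * (\<Sum>j\<in>UNIV. h $ j * pderiv_at j (pderiv_at i u) (z + t *\<^sub>R h)))" for m :: nat and t
  have der: "\<forall>m t. m < 2 \<and> 0 \<le> t \<and> t \<le> 1 \<longrightarrow> DERIV (D m) t :> D (Suc m) t"
  proof (intro allI impI)
    fix m :: nat and t :: real
    assume mt: "m < 2 \<and> 0 \<le> t \<and> t \<le> 1"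
    have tW: "z + t *\<^sub>R h \<in> W" using seg mt by auto
    consider "m = 0" | "m = 1" using mt by linarith
    then show "DERIV (D m) t :> D (Suc m) t"
    proof cases
      case 1
      then show ?thesis
        using line[OF diff1[OF tW]] by (simp add: D_def[abs_def])
    next
      case 2
      then show ?thesis
        using line[OF diff2[OF tW]] by (auto simp: D_def[abs_def] intro!: DERIV_sum DERIV_cmult)
    qed
  qed
  obtain t where t: "0 < t" "t < 1"
    "u (z + h) = (\<Sum>m<2. D m 0 / fact m * 1 ^ m) + D 2 t / fact 2 * 1 ^ 2"
    using Maclaurin[OF _ _ _ der, of "\<lambda>t. u (z + t *\<^sub>R h)"] by (auto simp: D_def[abs_def])
  \<comment> \<open>The Lagrange form evaluates the quadratic term at an intermediate point; the
    oscillation bound moves it back to \<open>z\<close>.\<close>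
  have *: "\<bar>(\<Sum>i\<in>UNIV. h $ i * (\<Sum>j\<in>UNIV. h $ j * pderiv_at j (pderiv_at i u) (z + t *\<^sub>R h)))
      - (\<Sum>i\<in>UNIV. \<Sum>j\<in>UNIV. h $ i * h $ j * pderiv_at j (pderiv_at i u) z)\<bar>
    \<le> (\<Sum>i\<in>(UNIV::'n set). \<Sum>j\<in>(UNIV::'n set). norm h * norm h * e)"
    unfolding sum_distrib_left sum_subtractf[symmetric]
  proof (intro order_trans[OF sum_abs] sum_mono)
    fix i j :: 'n
    have "\<bar>h $ i * (h $ j * pderiv_at j (pderiv_at i u) (z + t *\<^sub>R h)) - h $ i * h $ j * pderiv_at j (pderiv_at i u) z\<bar>
      = \<bar>h $ i\<bar> * \<bar>h $ j\<bar> * \<bar>pderiv_at j (pderiv_at i u) (z + t *\<^sub>R h) - pderiv_at j (pderiv_at i u) z\<bar>"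
      unfolding abs_mult[symmetric] by (simp add: algebra_simps)
    also have "\<dots> \<le> norm h * norm h * e"
      using t osc[of t j i] by (intro mult_mono component_le_norm_cart) auto
    finally show "\<bar>h $ i * (h $ j * pderiv_at j (pderiv_at i u) (z + t *\<^sub>R h)) - h $ i * h $ j * pderiv_at j (pderiv_at i u) z\<bar>
      \<le> norm h * norm h * e" .
  qed
  have "u (z + h) - u z - (\<Sum>i\<in>UNIV. h $ i * pderiv_at i u z) =
      (\<Sum>i\<in>UNIV. h $ i * (\<Sum>j\<in>UNIV. h $ j * pderiv_at j (pderiv_at i u) (z + t *\<^sub>R h))) / 2"
    using t(3) by (simp add: D_def numeral_2_eq_2)
  moreover have "(\<Sum>i\<in>(UNIV::'n set). \<Sum>j\<in>(UNIV::'n set). norm h * norm h * e) = e * (real CARD('n))\<^sup>2 * (norm h)\<^sup>2"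
    by (simp add: power2_eq_square)
  ultimately show ?thesis
    using * by linarith
qed

definition flat_laplacian :: "(real^'n \<Rightarrow> real) \<Rightarrow> real^'n \<Rightarrow> real" where
  "flat_laplacian u z = (\<Sum>i\<in>UNIV. pderiv_at i (pderiv_at i u) z)"

lemma continuous_on_flat_laplacian:
  fixes u :: "real^'n \<Rightarrow> real"
  assumes "cont_diff 2 u W"
  shows "continuous_on W (flat_laplacian u)"
  using assms unfolding flat_laplacian_def[abs_def]
  by (intro continuous_on_sum) (simp add: numeral_2_eq_2)

text \<open>That is, \<open>U \<epsilon> = u + \<epsilon>\<^sup>2 * h +
  o(\<epsilon>\<^sup>2)\<close> uniformly on \<open>V\<close>. Uniformity is what survives averaging
  over neighbouring points, and continuity of \<open>U \<epsilon>\<close> makes these averages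
  integrable.\<close>

definition expands :: "'a::topological_space set \<Rightarrow> (real \<Rightarrow> 'a \<Rightarrow> real) \<Rightarrow> ('a \<Rightarrow> real) \<Rightarrow> ('a \<Rightarrow> real) \<Rightarrow> bool" where
  "expands V U u h \<longleftrightarrow> (\<forall>\<^sub>F \<epsilon> in at_right 0. continuous_on V (U \<epsilon>))
    \<and> (\<forall>e>0. \<forall>\<^sub>F \<epsilon> in at_right 0. \<forall>z\<in>V. \<bar>U \<epsilon> z - u z - \<epsilon>\<^sup>2 * h z\<bar> \<le> e * \<epsilon>\<^sup>2)"

lemma expandsD:
  assumes "expands V U u h"
  shows "\<forall>\<^sub>F \<epsilon> in at_right 0. continuous_on V (U \<epsilon>)"
    and "0 < e \<Longrightarrow> \<forall>\<^sub>F \<epsilon> in at_right 0. \<forall>z\<in>V. \<bar>U \<epsilon> z - u z - \<epsilon>\<^sup>2 * h z\<bar> \<le> e * \<epsilon>\<^sup>2"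
  using assms by (auto simp: expands_def)

lemma expands_cong:
  assumes "\<forall>\<^sub>F \<epsilon> in at_right 0. \<forall>z\<in>V. U \<epsilon> z = U' \<epsilon> z"
    and "\<And>z. z \<in> V \<Longrightarrow> u z = u' z" "\<And>z. z \<in> V \<Longrightarrow> h z = h' z"
    and "expands V U u h"
  shows "expands V U' u' h'"
  unfolding expands_def
proof (intro conjI allI impI)
  show "\<forall>\<^sub>F \<epsilon> in at_right 0. continuous_on V (U' \<epsilon>)"
    using expandsD(1)[OF assms(4)] assms(1)
    by eventually_elim (metis (no_types, lifting) continuous_on_cong)
next
  fix e :: real assume "0 < e"
  from expandsD(2)[OF assms(4) this] assms(1)
  show "\<forall>\<^sub>F \<epsilon> in at_right 0. \<forall>z\<in>V. \<bar>U' \<epsilon> z - u' z - \<epsilon>\<^sup>2 * h' z\<bar> \<le> e * \<epsilon>\<^sup>2"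
    by eventually_elim (use assms(2,3) in auto)
qed

lemma expands_compose:
  assumes "expands V U u h" "continuous_on W g" "g ` W \<subseteq> V"
  shows "expands W (\<lambda>\<epsilon>. U \<epsilon> \<circ> g) (u \<circ> g) (h \<circ> g)"
  unfolding expands_def
proof (intro conjI allI impI)
  show "\<forall>\<^sub>F \<epsilon> in at_right 0. continuous_on W (U \<epsilon> \<circ> g)"
    using expandsD(1)[OF assms(1)]
    by eventually_elim (rule continuous_on_compose[OF assms(2) continuous_on_subset[OF _ assms(3)]])
next
  fix e :: real assume "0 < e"
  from expandsD(2)[OF assms(1) this]
  show "\<forall>\<^sub>F \<epsilon> in at_right 0. \<forall>z\<in>W. \<bar>(U \<epsilon> \<circ> g) z - (u \<circ> g) z - \<epsilon>\<^sup>2 * (h \<circ> g) z\<bar> \<le> e * \<epsilon>\<^sup>2"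
    by eventually_elim (use assms(3) in auto)
qed

lemma expands_const:
  assumes "continuous_on V u"
  shows "expands V (\<lambda>_. u) u (\<lambda>_. 0)"
  using assms by (simp add: expands_def)

section \<open>Affine substitutions in Lebesgue integrals\<close>

lemma lborel_distr_affine:
  assumes "a \<noteq> 0"
  shows "lborel = density (distr lborel borel (\<lambda>x::real^'n. t + a *\<^sub>R x)) (\<lambda>_. ennreal (\<bar>a\<bar> ^ CARD('n)))"
  using lborel_affine[OF assms, of t] by simp

lemma lborel_integral_affine:
  fixes F :: "real^'n \<Rightarrow> real"
  assumes [measurable]: "F \<in> borel_measurable borel" and "a \<noteq> 0"
  shows "(LINT x|lborel. F x) = \<bar>a\<bar> ^ CARD('n) * (LINT x|lborel. F (t + a *\<^sub>R x))"
  by (subst lborel_distr_affine[OF assms(2), of t])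
    (simp add: integral_density integral_distr)

lemma lborel_integrable_affine:
  fixes F :: "real^'n \<Rightarrow> real"
  assumes [measurable]: "F \<in> borel_measurable borel" and "a \<noteq> 0" and "integrable lborel F"
  shows "integrable lborel (\<lambda>x. F (t + a *\<^sub>R x))"
proof -
  have "integrable (density (distr lborel borel (\<lambda>x::real^'n. t + a *\<^sub>R x)) (\<lambda>_. ennreal (\<bar>a\<bar> ^ CARD('n)))) F"
    using assms(3) lborel_distr_affine[OF assms(2), of t] by metis
  then show ?thesis
    using assms(2) by (simp add: integrable_density integrable_distr_eq)
qed

lemma lborel_nn_integral_affine:
  fixes F :: "real^'n \<Rightarrow> ennreal"
  assumes [measurable]: "F \<in> borel_measurable borel" and "a \<noteq> 0"
  shows "(\<integral>\<^sup>+x. F x \<partial>lborel) = ennreal (\<bar>a\<bar> ^ CARD('n)) * (\<integral>\<^sup>+x. F (t + a *\<^sub>R x) \<partial>lborel)"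
  by (subst lborel_distr_affine[OF assms(2), of t])
    (simp add: nn_integral_density nn_integral_distr nn_integral_cmult)

text \<open>Convolution with \<open>scaled_density q \<epsilon>\<close> after the substitution
  \<open>y = z - \<epsilon> *\<^sub>R v\<close>: the power of \<epsilon> cancels against the
  Jacobian, and \<epsilon> remains only in the argument of \<open>w\<close>, where Taylor expansion
  acts.\<close>

definition avg :: "(real^'n \<Rightarrow> real) \<Rightarrow> real \<Rightarrow> (real^'n \<Rightarrow> real) \<Rightarrow> real^'n \<Rightarrow> real" where
  "avg q \<epsilon> w z = (LINT v|lborel. q v * w (z - \<epsilon> *\<^sub>R v))"

lemma eventually_at_right_small:
  assumes "0 < (\<rho>::real)" "0 < d"
  shows "\<forall>\<^sub>F \<epsilon> in at_right 0. 0 < \<epsilon> \<and> \<epsilon> * \<rho> < d"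
proof -
  have "\<forall>\<^sub>F \<epsilon> in at_right 0. \<epsilon> \<in> {0<..<d / \<rho>}"
    using assms by (intro eventually_at_right_field[THEN iffD2] exI[of _ "d / \<rho>"]) auto
  then show ?thesis
    by eventually_elim (use assms in \<open>auto simp: field_simps\<close>)
qed

locale isotropic_density =
  fixes q :: "real^'n \<Rightarrow> real" and \<rho> c :: real
  assumes q_measurable [measurable]: "q \<in> borel_measurable borel"
    and q_nonneg: "0 \<le> q v"
    and q_total: "has_bochner_integral lborel q 1"
    and q_support: "q v \<noteq> 0 \<Longrightarrow> norm v \<le> \<rho>"
    and radius_pos: "0 < \<rho>"
    and q_mean: "(LINT v|lborel. q v * v $ i) = 0"
    and q_cov: "(LINT v|lborel. q v * (v $ i * v $ j)) = (if i = j then c else 0)"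
begin

text \<open>The functions to be averaged are controlled only near the base point, so
  \<open>g\<close> is continuous on the support ball alone. Since \<open>q\<close> vanishes outside,
  \<open>g\<close> may be replaced by its product with the indicator; this gives measurability, and
  compactness gives a bound.\<close>

lemma integrable_weight:
  assumes "continuous_on (cball 0 \<rho>) g"
  shows "integrable lborel (\<lambda>v. q v * g v)"
proof -
  obtain B where "\<forall>y\<in>g ` cball 0 \<rho>. norm y \<le> B"
    using compact_imp_bounded[OF compact_continuous_image[OF assms compact_cball]]
    unfolding bounded_iff by blast
  then have B: "norm (g v) \<le> B" if "v \<in> cball 0 \<rho>" for v
    using that by blast
  have eq: "q v * g v = q v * (indicator (cball 0 \<rho>) v *\<^sub>R g v)" for v
    using q_support[of v] by (cases "q v = 0") auto
  have [measurable]: "(\<lambda>v. indicator (cball 0 \<rho>) v *\<^sub>R g v) \<in> borel_measurable borel"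
    using assms by (intro borel_measurable_continuous_on_indicator) auto
  show ?thesis
  proof (rule Bochner_Integration.integrable_bound)
    show "integrable lborel (\<lambda>v. q v * B)"
      using q_total by (auto simp: has_bochner_integral_iff)
    show "(\<lambda>v. q v * g v) \<in> borel_measurable lborel"
      unfolding eq by measurable
    show "AE v in lborel. norm (q v * g v) \<le> norm (q v * B)"
    proof (intro AE_I2)
      fix v show "norm (q v * g v) \<le> norm (q v * B)"
        using q_support[of v] B[of v] q_nonneg[of v]
        by (cases "q v = 0") (auto simp: abs_mult intro!: mult_left_mono)
    qed
  qed
qed

lemma weight_bound:
  assumes "continuous_on (cball 0 \<rho>) g" "\<And>v. norm v \<le> \<rho> \<Longrightarrow> \<bar>g v\<bar> \<le> B"
  shows "\<bar>LINT v|lborel. q v * g v\<bar> \<le> B"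
proof -
  have "norm (LINT v|lborel. q v * g v) \<le> (LINT v|lborel. norm (q v * g v))"
    by (rule integral_norm_bound)
  also have "\<dots> \<le> (LINT v|lborel. q v * B)"
  proof (rule integral_mono)
    show "norm (q v * g v) \<le> q v * B" for v
      using q_support[of v] assms(2)[of v] q_nonneg[of v]
      by (cases "q v = 0") (auto simp: abs_mult intro!: mult_left_mono)
  qed (use q_total integrable_weight[OF assms(1)] in \<open>auto simp: has_bochner_integral_iff\<close>)
  also have "\<dots> = B"
    using q_total by (simp add: has_bochner_integral_iff)
  finally show ?thesis by simp
qed

text \<open>The adjoint diffusion averages with the reflected density. Reflection changes the sign
  of first moments and keeps second moments, so the whole locale is available for it.\<close>

lemma reflect: "isotropic_density (\<lambda>v. q (- v)) \<rho> c"
proof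
  have refl: "(LINT v|lborel. q (- v) * g (- v)) = (LINT v|lborel. q v * g v)"
    if [measurable]: "g \<in> borel_measurable borel" for g :: "real^'n \<Rightarrow> real"
    using lborel_integral_affine[of "\<lambda>v. q v * g v" "-1" 0] by simp
  have "integrable lborel (\<lambda>v. q (- v))"
    using lborel_integrable_affine[of "q" "-1" 0] q_total by (simp add: has_bochner_integral_iff)
  then show "has_bochner_integral lborel (\<lambda>v. q (- v)) 1"
    using refl[of "\<lambda>_. 1"] q_total by (simp add: has_bochner_integral_iff)
  show "(LINT v|lborel. q (- v) * v $ i) = 0" for i
    using refl[of "\<lambda>v. - v $ i"] q_mean[of i] by simp
  show "(LINT v|lborel. q (- v) * (v $ i * v $ j)) = (if i = j then c else 0)" for i j
    using refl[of "\<lambda>v. v $ i * v $ j"] q_cov[of i j] by simp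
  show "q (- v) \<noteq> 0 \<Longrightarrow> norm v \<le> \<rho>" for v
    using q_support[of "- v"] by simp
qed (use q_nonneg radius_pos in auto)

text \<open>Integrated against the density, the linear Taylor term vanishes by the mean, and half of
  the quadratic form becomes \<open>c / 2\<close> times the Laplacian by the covariance. The radius
  drops from \<open>R\<close> to \<open>r\<close> because the average at \<open>z\<close> looks at
  points at distance up to \<open>\<epsilon> * \<rho>\<close>.\<close>

lemma avg_expands:
  assumes u: "cont_diff 2 u (ball z0 R)" and h: "continuous_on (ball z0 R) h"
    and ex: "expands (ball z0 R) U u h" and r: "0 < r" "r < R"
  shows "expands (ball z0 r) (\<lambda>\<epsilon>. avg q \<epsilon> (U \<epsilon>)) u (\<lambda>z. h z + c / 2 * flat_laplacian u z)"
proof -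
  \<comment> \<open>Half of the gap between the radii: for
    \<open>\<epsilon> * \<rho> \<le> s\<close> all shifted points stay in \<open>?K\<close>, a
    compact subset of the larger ball on which uniform continuity is available.\<close>
  define s where "s = (R - r) / 2"
  have s: "0 < s" using r by (simp add: s_def)
  let ?K = "cball z0 (r + s)"
  have "r + s < R"
    using r by (simp add: s_def field_simps)
  then have K: "?K \<subseteq> ball z0 R"
    by auto
  have inK: "z - \<epsilon> *\<^sub>R v \<in> ?K" if "z \<in> ball z0 r" "norm v \<le> \<rho>" "0 < \<epsilon>" "\<epsilon> * \<rho> \<le> s" for z v \<epsilon>
  proof -
    have "dist z0 (z - \<epsilon> *\<^sub>R v) \<le> dist z0 z + dist z (z - \<epsilon> *\<^sub>R v)"
      by (rule dist_triangle)
    also have "dist z (z - \<epsilon> *\<^sub>R v) = \<epsilon> * norm v"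
      using that by (simp add: dist_norm)
    also have "\<dots> \<le> s"
      using that mult_left_mono[of "norm v" \<rho> \<epsilon>] by linarith
    finally show ?thesis using that by simp
  qed
  have small: "\<forall>\<^sub>F \<epsilon> in at_right 0. 0 < \<epsilon> \<and> \<epsilon> * \<rho> \<le> d" if "0 < d" for d
    using eventually_at_right_small[OF radius_pos that] by eventually_elim simp
  have shift: "continuous_on (cball 0 \<rho>) (\<lambda>v. g (z - \<epsilon> *\<^sub>R v))"
    if "continuous_on (ball z0 R) g" "z \<in> ball z0 r" "0 < \<epsilon>" "\<epsilon> * \<rho> \<le> s" for g :: "real^'n \<Rightarrow> real" and z \<epsilon>
    using inK[OF that(2) _ that(3,4)] K
    by (intro continuous_on_compose2[OF that(1)] continuous_intros) auto
  show ?thesis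
    unfolding expands_def
  proof (intro conjI allI impI)
    show "\<forall>\<^sub>F \<epsilon> in at_right 0. continuous_on (ball z0 r) (avg q \<epsilon> (U \<epsilon>))"
      using expandsD(1)[OF ex] small[OF s]
    proof eventually_elim
      case (elim \<epsilon>)
      have uc: "uniformly_continuous_on ?K (U \<epsilon>)"
        using elim K by (intro compact_uniformly_continuous continuous_on_subset[OF elim(1)]) auto
      show ?case
        unfolding continuous_on_iff
      proof (intro ballI allI impI)
        fix z and e :: real assume z: "z \<in> ball z0 r" and e: "0 < e"
        obtain d where d: "0 < d" "\<And>a b. a \<in> ?K \<Longrightarrow> b \<in> ?K \<Longrightarrow> dist b a < d \<Longrightarrow> dist (U \<epsilon> b) (U \<epsilon> a) < e / 2"
          using uc e unfolding uniformly_continuous_on_def by (metis half_gt_zero)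
        show "\<exists>d>0. \<forall>z'\<in>ball z0 r. dist z' z < d \<longrightarrow> dist (avg q \<epsilon> (U \<epsilon>) z') (avg q \<epsilon> (U \<epsilon>) z) < e"
        proof (intro exI[of _ d] conjI ballI impI)
          fix z' assume z': "z' \<in> ball z0 r" "dist z' z < d"
          have "avg q \<epsilon> (U \<epsilon>) z' - avg q \<epsilon> (U \<epsilon>) z = (LINT v|lborel. q v * (U \<epsilon> (z' - \<epsilon> *\<^sub>R v) - U \<epsilon> (z - \<epsilon> *\<^sub>R v)))"
            unfolding avg_def right_diff_distrib
            using elim z z' by (intro Bochner_Integration.integral_diff[symmetric] integrable_weight shift) auto
          also have "\<bar>\<dots>\<bar> \<le> e / 2"
          proof (intro weight_bound continuous_on_diff shift elim z z')
            fix v :: "real^'n" assume v: "norm v \<le> \<rho>"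
            have "dist (U \<epsilon> (z' - \<epsilon> *\<^sub>R v)) (U \<epsilon> (z - \<epsilon> *\<^sub>R v)) < e / 2"
              using z z' v elim by (intro d(2) inK) (auto simp: dist_norm)
            then show "\<bar>U \<epsilon> (z' - \<epsilon> *\<^sub>R v) - U \<epsilon> (z - \<epsilon> *\<^sub>R v)\<bar> \<le> e / 2"
              by (simp add: dist_real_def)
          qed (use elim in auto)
          finally show "dist (avg q \<epsilon> (U \<epsilon>) z') (avg q \<epsilon> (U \<epsilon>) z) < e"
            using e by (simp add: dist_real_def)
        qed (rule d)
      qed
    qed
  next
    fix e :: real assume e: "0 < e"
    \<comment> \<open>The error is split in three: the uniform error of \<open>U \<epsilon>\<close>,
      the oscillation of \<open>h\<close>, and the Taylor remainder of \<open>u\<close>.\<close>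
    have e3: "0 < e / 3" using e by simp
    let ?n2 = "(real CARD('n))\<^sup>2"
    \<comment> \<open>All second derivatives form one matrix-valued function, so that a single
      modulus of continuity serves every pair of indices.\<close>
    define H where "H z = (\<chi> i j. pderiv_at j (pderiv_at i u) z)" for z
    have cH: "continuous_on (ball z0 R) H"
      unfolding H_def[abs_def] using u by (intro continuous_on_vec_lambda) (simp add: numeral_2_eq_2)
    have uH: "uniformly_continuous_on ?K H"
      by (intro compact_uniformly_continuous continuous_on_subset[OF cH K] compact_cball)
    \<comment> \<open>Makes the Taylor bound \<open>e' * ?n2 * \<rho>\<^sup>2 / 2\<close> equal to
      \<open>e / 6\<close>.\<close>
    define e' where "e' = e / (3 * ?n2 * \<rho>\<^sup>2)"
    have e': "0 < e'" using e radius_pos by (simp add: e'_def)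
    obtain d1 where d1: "0 < d1" "\<And>a b. a \<in> ?K \<Longrightarrow> b \<in> ?K \<Longrightarrow> dist b a < d1 \<Longrightarrow> dist (H b) (H a) < e'"
      using uniformly_continuous_onE[OF uH e'] by blast
    have uh: "uniformly_continuous_on ?K h"
      using K by (intro compact_uniformly_continuous continuous_on_subset[OF h]) auto
    obtain d2 where d2: "0 < d2" "\<And>a b. a \<in> ?K \<Longrightarrow> b \<in> ?K \<Longrightarrow> dist b a < d2 \<Longrightarrow> dist (h b) (h a) < e / 3"
      using uniformly_continuous_onE[OF uh e3] by blast
    show "\<forall>\<^sub>F \<epsilon> in at_right 0. \<forall>z\<in>ball z0 r.
        \<bar>avg q \<epsilon> (U \<epsilon>) z - u z - \<epsilon>\<^sup>2 * (h z + c / 2 * flat_laplacian u z)\<bar> \<le> e * \<epsilon>\<^sup>2"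
      using expandsD(1)[OF ex] expandsD(2)[OF ex e3] small[OF s] small[OF half_gt_zero[OF d1(1)]]
        small[OF half_gt_zero[OF d2(1)]]
    proof eventually_elim
      case (elim \<epsilon>)
      then have \<epsilon>: "0 < \<epsilon>" by simp
      show ?case
      proof
        fix z assume z: "z \<in> ball z0 r"
        have zK: "z \<in> ?K" using z s by auto
        let ?lin = "\<lambda>v. \<Sum>i\<in>UNIV. v $ i * pderiv_at i u z"
        let ?quad = "\<lambda>v. \<Sum>i\<in>UNIV. \<Sum>j\<in>UNIV. v $ i * v $ j * pderiv_at j (pderiv_at i u) z"
        \<comment> \<open>The shifted \<open>U \<epsilon>\<close> minus its quadratic model in
          \<open>v\<close>. The model has an explicit integral against \<open>q\<close>, so the
          error of the average is the integral of \<open>q v * g v\<close>, and a pointwise bound on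
          \<open>g\<close> is enough.\<close>
        define g where "g v = U \<epsilon> (z - \<epsilon> *\<^sub>R v) - ((u z + \<epsilon>\<^sup>2 * h z) + (- \<epsilon>) * ?lin v + \<epsilon>\<^sup>2 / 2 * ?quad v)" for v
        have cU: "continuous_on (cball 0 \<rho>) (\<lambda>v. U \<epsilon> (z - \<epsilon> *\<^sub>R v))"
          using elim z by (intro shift) auto
        have cg: "continuous_on (cball 0 \<rho>) g"
          unfolding g_def[abs_def] by (intro continuous_intros cU)
        have lin: "(LINT v|lborel. q v * ?lin v) = 0"
        proof -
          have "(LINT v|lborel. q v * ?lin v) = (LINT v|lborel. (\<Sum>i\<in>UNIV. (q v * v $ i) * pderiv_at i u z))"
            by (simp add: sum_distrib_left ac_simps)
          also have "\<dots> = (\<Sum>i\<in>UNIV. (LINT v|lborel. (q v * v $ i) * pderiv_at i u z))"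
            by (intro Bochner_Integration.integral_sum integrable_mult_left integrable_weight continuous_intros)
          finally show ?thesis by (simp add: q_mean)
        qed
        have quad: "(LINT v|lborel. q v * ?quad v) = c * flat_laplacian u z"
        proof -
          have "(LINT v|lborel. q v * ?quad v) =
              (LINT v|lborel. (\<Sum>i\<in>UNIV. \<Sum>j\<in>UNIV. (q v * (v $ i * v $ j)) * pderiv_at j (pderiv_at i u) z))"
            by (simp add: sum_distrib_left ac_simps)
          also have "\<dots> = (\<Sum>i\<in>UNIV. \<Sum>j\<in>UNIV. (LINT v|lborel. (q v * (v $ i * v $ j)) * pderiv_at j (pderiv_at i u) z))"
            by (subst Bochner_Integration.integral_sum;
                intro sum.cong refl Bochner_Integration.integral_sum Bochner_Integration.integrable_sum
                  integrable_mult_left integrable_weight continuous_intros)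
          also have "\<dots> = (\<Sum>i\<in>UNIV. \<Sum>j\<in>UNIV. if i = j then c * pderiv_at j (pderiv_at i u) z else 0)"
            by (intro sum.cong refl) (simp add: q_cov)
          finally show ?thesis
            by (simp add: flat_laplacian_def sum_distrib_left)
        qed
        have "(LINT v|lborel. q v * g v) = (LINT v|lborel. q v * U \<epsilon> (z - \<epsilon> *\<^sub>R v) -
            (q v * (u z + \<epsilon>\<^sup>2 * h z) + (- \<epsilon>) * (q v * ?lin v) + \<epsilon>\<^sup>2 / 2 * (q v * ?quad v)))"
          by (simp add: g_def algebra_simps)
        also have "\<dots> = (LINT v|lborel. q v * U \<epsilon> (z - \<epsilon> *\<^sub>R v)) -
            ((LINT v|lborel. q v * (u z + \<epsilon>\<^sup>2 * h z)) + (LINT v|lborel. (- \<epsilon>) * (q v * ?lin v))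
              + (LINT v|lborel. \<epsilon>\<^sup>2 / 2 * (q v * ?quad v)))"
        proof -
          have i: "integrable lborel (\<lambda>v. q v * U \<epsilon> (z - \<epsilon> *\<^sub>R v))" "integrable lborel (\<lambda>v. q v * (u z + \<epsilon>\<^sup>2 * h z))"
            "integrable lborel (\<lambda>v. (- \<epsilon>) * (q v * ?lin v))" "integrable lborel (\<lambda>v. \<epsilon>\<^sup>2 / 2 * (q v * ?quad v))"
            by (intro integrable_weight integrable_mult_right cU continuous_intros)+
          show ?thesis
            by (simp only: Bochner_Integration.integral_diff[OF i(1)] Bochner_Integration.integral_add
                Bochner_Integration.integrable_add i)
        qed
        also have "\<dots> = avg q \<epsilon> (U \<epsilon>) z - u z - \<epsilon>\<^sup>2 * (h z + c / 2 * flat_laplacian u z)"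
          using q_total unfolding integral_mult_right_zero lin quad
          by (simp add: has_bochner_integral_iff avg_def algebra_simps)
        finally have eq: "avg q \<epsilon> (U \<epsilon>) z - u z - \<epsilon>\<^sup>2 * (h z + c / 2 * flat_laplacian u z) = (LINT v|lborel. q v * g v)" ..
        show "\<bar>avg q \<epsilon> (U \<epsilon>) z - u z - \<epsilon>\<^sup>2 * (h z + c / 2 * flat_laplacian u z)\<bar> \<le> e * \<epsilon>\<^sup>2"
          unfolding eq
        proof (rule weight_bound[OF cg])
          fix v :: "real^'n" assume v: "norm v \<le> \<rho>"
          have zv: "z - \<epsilon> *\<^sub>R v \<in> ?K"
            using elim z v by (intro inK) auto
          have seg: "z + t *\<^sub>R (- \<epsilon> *\<^sub>R v) \<in> ?K" if "0 \<le> t" "t \<le> 1" for t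
          proof -
            have "norm (t *\<^sub>R v) \<le> \<rho>"
              using that v mult_mono[of t 1 "norm v" \<rho>] by simp
            from inK[OF z this] elim show ?thesis
              by (simp add: mult.commute)
          qed
          have near: "dist (z + t *\<^sub>R (- \<epsilon> *\<^sub>R v)) z \<le> \<epsilon> * \<rho>" if "0 \<le> t" "t \<le> 1" for t
            using mult_mono[of t 1 "\<epsilon> * norm v" "\<epsilon> * \<rho>"] that v \<epsilon> by (simp add: dist_norm mult_left_mono)
          have 1: "\<bar>U \<epsilon> (z - \<epsilon> *\<^sub>R v) - u (z - \<epsilon> *\<^sub>R v) - \<epsilon>\<^sup>2 * h (z - \<epsilon> *\<^sub>R v)\<bar> \<le> e / 3 * \<epsilon>\<^sup>2"
            using elim zv K by blast
          have "dist (z - \<epsilon> *\<^sub>R v) z \<le> \<epsilon> * \<rho>"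
            using v \<epsilon> by (simp add: dist_norm)
          also have "\<dots> < d2"
            using elim d2(1) by linarith
          finally have "\<bar>h (z - \<epsilon> *\<^sub>R v) - h z\<bar> \<le> e / 3"
            using d2(2)[OF zK zv] by (simp add: dist_real_def)
          then have "\<epsilon>\<^sup>2 * \<bar>h (z - \<epsilon> *\<^sub>R v) - h z\<bar> \<le> \<epsilon>\<^sup>2 * (e / 3)"
            by (rule mult_left_mono) simp
          also have "\<epsilon>\<^sup>2 * \<bar>h (z - \<epsilon> *\<^sub>R v) - h z\<bar> = \<bar>\<epsilon>\<^sup>2 * h (z - \<epsilon> *\<^sub>R v) - \<epsilon>\<^sup>2 * h z\<bar>"
            by (simp add: abs_mult flip: right_diff_distrib)
          finally have 2: "\<bar>\<epsilon>\<^sup>2 * h (z - \<epsilon> *\<^sub>R v) - \<epsilon>\<^sup>2 * h z\<bar> \<le> e / 3 * \<epsilon>\<^sup>2"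
            by (simp only: mult.commute)
          have osc: "\<bar>pderiv_at j (pderiv_at i u) (z + t *\<^sub>R (- \<epsilon> *\<^sub>R v)) - pderiv_at j (pderiv_at i u) z\<bar> \<le> e'"
            if "0 \<le> t" "t \<le> 1" for t i j
          proof -
            have "dist (H (z + t *\<^sub>R (- \<epsilon> *\<^sub>R v))) (H z) < e'"
              using elim near[OF that] d1(1) by (intro d1(2) zK seg that) auto
            then have "norm ((H (z + t *\<^sub>R (- \<epsilon> *\<^sub>R v)) - H z) $ i $ j) \<le> e'"
              unfolding dist_norm
              using Finite_Cartesian_Product.norm_nth_le[where x="H (z + t *\<^sub>R (- \<epsilon> *\<^sub>R v)) - H z" and i=i]
                Finite_Cartesian_Product.norm_nth_le[where x="(H (z + t *\<^sub>R (- \<epsilon> *\<^sub>R v)) - H z) $ i" and i=j] by linarith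
            then show ?thesis by (simp add: H_def)
          qed
          have "\<bar>u (z + (- \<epsilon> *\<^sub>R v)) - u z - (\<Sum>i\<in>UNIV. (- \<epsilon> *\<^sub>R v) $ i * pderiv_at i u z)
              - (\<Sum>i\<in>UNIV. \<Sum>j\<in>UNIV. (- \<epsilon> *\<^sub>R v) $ i * (- \<epsilon> *\<^sub>R v) $ j * pderiv_at j (pderiv_at i u) z) / 2\<bar>
            \<le> e' * ?n2 * (norm (- \<epsilon> *\<^sub>R v))\<^sup>2 / 2"
            by (intro taylor_second_order[OF u open_ball] osc subsetD[OF K seg])
          also have "\<dots> = e' * ?n2 * (norm v)\<^sup>2 / 2 * \<epsilon>\<^sup>2"
            by (simp add: power_mult_distrib)
          also have "\<dots> \<le> e' * ?n2 * \<rho>\<^sup>2 / 2 * \<epsilon>\<^sup>2"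
            using e' v by (intro mult_right_mono divide_right_mono mult_left_mono power_mono) auto
          also have "\<dots> \<le> e / 3 * \<epsilon>\<^sup>2"
            using e radius_pos by (intro mult_right_mono) (auto simp: e'_def field_simps)
          also have "(\<Sum>i\<in>UNIV. (- \<epsilon> *\<^sub>R v) $ i * pderiv_at i u z) = (- \<epsilon>) * ?lin v"
            by (simp add: sum_distrib_left ac_simps sum_negf)
          also have "(\<Sum>i\<in>UNIV. \<Sum>j\<in>UNIV. (- \<epsilon> *\<^sub>R v) $ i * (- \<epsilon> *\<^sub>R v) $ j * pderiv_at j (pderiv_at i u) z) = \<epsilon>\<^sup>2 * ?quad v"
            by (simp add: sum_distrib_left ac_simps power2_eq_square)
          finally have 3: "\<bar>u (z - \<epsilon> *\<^sub>R v) - u z - (- \<epsilon>) * ?lin v - \<epsilon>\<^sup>2 / 2 * ?quad v\<bar> \<le> e / 3 * \<epsilon>\<^sup>2"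
            by simp
          have "g v = (U \<epsilon> (z - \<epsilon> *\<^sub>R v) - u (z - \<epsilon> *\<^sub>R v) - \<epsilon>\<^sup>2 * h (z - \<epsilon> *\<^sub>R v))
             + (\<epsilon>\<^sup>2 * h (z - \<epsilon> *\<^sub>R v) - \<epsilon>\<^sup>2 * h z) + (u (z - \<epsilon> *\<^sub>R v) - u z - (- \<epsilon>) * ?lin v - \<epsilon>\<^sup>2 / 2 * ?quad v)"
            by (simp add: g_def)
          then show "\<bar>g v\<bar> \<le> e * \<epsilon>\<^sup>2"
            using 1 2 3 by linarith
        qed
      qed
    qed
  qed
qed

end

section \<open>The Laplace operator in flat coordinates\<close>

lemma pderiv_at_mult:
  fixes u v :: "real^'n \<Rightarrow> real"
  assumes "u differentiable at z" "v differentiable at z"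
  shows "pderiv_at i (\<lambda>z. u z * v z) z = u z * pderiv_at i v z + pderiv_at i u z * v z"
  unfolding pderiv_at_def
  by (subst frechet_derivative_at[symmetric, OF has_derivative_mult])
    (use assms in \<open>auto simp: frechet_derivative_works[symmetric]\<close>)

lemma pderiv_at_sum:
  fixes u :: "'i \<Rightarrow> real^'n \<Rightarrow> real"
  assumes "\<And>a. a \<in> I \<Longrightarrow> u a differentiable at z"
  shows "pderiv_at i (\<lambda>z. \<Sum>a\<in>I. u a z) z = (\<Sum>a\<in>I. pderiv_at i (u a) z)"
  unfolding pderiv_at_def
  by (subst frechet_derivative_at[symmetric, OF has_derivative_sum])
    (use assms in \<open>auto simp: frechet_derivative_works[symmetric]\<close>)

text \<open>For the Jacobian \<open>J\<close> of flat coordinates the Gram matrix is the metric, and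
  the identity says that the inverse metric becomes Euclidean. Multiplying the product by
  \<open>transpose J\<close> on the left returns \<open>transpose J\<close>, which its left inverse
  \<open>transpose B\<close> then cancels.\<close>

lemma mult_matrix_inv_gram:
  fixes J :: "real^'n^'n"
  assumes "det J \<noteq> 0"
  shows "J ** matrix_inv (transpose J ** J) ** transpose J = mat 1"
proof -
  let ?A = "transpose J ** J"
  have "invertible ?A"
    using assms by (simp add: invertible_det_nz det_mul)
  then have A: "?A ** matrix_inv ?A = mat 1"
    unfolding invertible_def matrix_inv_def by (rule someI2_ex) auto
  obtain B where B: "J ** B = mat 1"
    using assms unfolding invertible_det_nz[symmetric] invertible_def by blast
  have BJ: "transpose B ** transpose J = mat 1"
    using B by (metis matrix_transpose_mul transpose_mat)
  let ?X = "J ** matrix_inv ?A ** transpose J"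
  have "?X = transpose B ** (transpose J ** ?X)"
    using BJ by (simp add: matrix_mul_assoc)
  also have "transpose J ** ?X = transpose J"
    using A by (simp add: matrix_mul_assoc)
  finally show ?thesis using BJ by simp
qed

lemma sum_inverse_gram:
  fixes J :: "real^'n^'n"
  assumes "det J \<noteq> 0"
  shows "(\<Sum>i\<in>UNIV. \<Sum>j\<in>UNIV. matrix_inv (transpose J ** J) $ i $ j * (J $ a $ i * J $ b $ j)) = (if a = b then 1 else 0)"
proof -
  let ?G = "matrix_inv (transpose J ** J)"
  have "(J ** ?G ** transpose J) $ a $ b = (\<Sum>j\<in>UNIV. (\<Sum>i\<in>UNIV. J $ a $ i * ?G $ i $ j) * J $ b $ j)"
    by (simp add: matrix_matrix_mult_def transpose_def)
  also have "\<dots> = (\<Sum>j\<in>UNIV. \<Sum>i\<in>UNIV. ?G $ i $ j * (J $ a $ i * J $ b $ j))"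
    by (simp add: sum_distrib_left sum_distrib_right ac_simps)
  also have "\<dots> = (\<Sum>i\<in>UNIV. \<Sum>j\<in>UNIV. ?G $ i $ j * (J $ a $ i * J $ b $ j))"
    by (rule sum.swap)
  finally show ?thesis
    unfolding mult_matrix_inv_gram[OF assms] by (simp add: mat_def)
qed

text \<open>An entry of \<open>g\<close> is the inner product of two partial derivatives of
  \<open>\<Phi>\<close>. In the combination of three derivatives of \<open>g\<close>, symmetry of
  second derivatives cancels everything but two equal terms, and these absorb the factor
  1/2.\<close>

lemma christoffel_gram:
  fixes \<Phi> :: "real^'n \<Rightarrow> real^'n"
  assumes W: "open W" "z \<in> W" and \<Phi>: "\<And>a. cont_diff 2 (\<lambda>z. \<Phi> z $ a) W"
    and g: "\<And>w. w \<in> W \<Longrightarrow> g w = transpose (Defs.jacobian \<Phi> w) ** Defs.jacobian \<Phi> w"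
  shows "christoffel g z k i j = (\<Sum>l\<in>UNIV. matrix_inv (g z) $ k $ l *
    (\<Sum>a\<in>UNIV. pderiv_at l (\<lambda>z. \<Phi> z $ a) z * pderiv_at i (pderiv_at j (\<lambda>z. \<Phi> z $ a)) z))"
proof -
  let ?P = "\<lambda>a i. pderiv_at i (\<lambda>z. \<Phi> z $ a)"
  let ?P2 = "\<lambda>a i j. pderiv_at i (?P a j) z"
  have diff: "(\<lambda>z. \<Phi> z $ a) differentiable at w" if "w \<in> W" for w a
    using cont_diff_Suc_differentiable[of 1 "\<lambda>z. \<Phi> z $ a" W] \<Phi>[of a] W that by (simp add: numeral_2_eq_2)
  have diff2: "?P a j differentiable at w" if "w \<in> W" for w a j
    using cont_diff_Suc_differentiable[of 0 "?P a j" W] \<Phi>[of a] W that by (simp add: numeral_2_eq_2)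
  have gP: "g w $ j $ l = (\<Sum>a\<in>UNIV. ?P a j w * ?P a l w)" if "w \<in> W" for w j l
    using that by (simp add: g matrix_matrix_mult_def transpose_def jacobian_nth differentiable_vec diff)
  have dg: "pderiv_at i (\<lambda>w. g w $ j $ l) z = (\<Sum>a\<in>UNIV. ?P a j z * ?P2 a i l + ?P2 a i j * ?P a l z)" for i j l
  proof -
    have "pderiv_at i (\<lambda>w. g w $ j $ l) z = pderiv_at i (\<lambda>w. \<Sum>a\<in>UNIV. ?P a j w * ?P a l w) z"
      by (rule pderiv_at_cong[OF W]) (rule gP)
    also have "\<dots> = (\<Sum>a\<in>UNIV. pderiv_at i (\<lambda>w. ?P a j w * ?P a l w) z)"
      using diff2[OF W(2)] by (intro pderiv_at_sum differentiable_mult)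
    finally show ?thesis
      using diff2[OF W(2)] by (simp add: pderiv_at_mult)
  qed
  have sym: "?P2 a i j = ?P2 a j i" for a i j
    by (rule pderiv_at_commute[OF \<Phi> W])
  have "pderiv_at i (\<lambda>w. g w $ j $ l) z + pderiv_at j (\<lambda>w. g w $ i $ l) z - pderiv_at l (\<lambda>w. g w $ i $ j) z
      = 2 * (\<Sum>a\<in>UNIV. ?P a l z * ?P2 a i j)" for l
    unfolding dg sum.distrib[symmetric] sum_subtractf[symmetric] sum_distrib_left
    by (intro sum.cong refl) (simp add: sym algebra_simps)
  then show ?thesis
    unfolding christoffel_def by (simp add: sum_divide_distrib)
qed

lemma sum_swap_pairs:
  "(\<Sum>k\<in>A. \<Sum>l\<in>B. \<Sum>a\<in>C. \<Sum>b\<in>D. f k l a b) = (\<Sum>a\<in>C. \<Sum>b\<in>D. \<Sum>k\<in>A. \<Sum>l\<in>B. f k l a b)"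
proof -
  have "(\<Sum>k\<in>A. \<Sum>l\<in>B. \<Sum>a\<in>C. \<Sum>b\<in>D. f k l a b) = (\<Sum>k\<in>A. \<Sum>a\<in>C. \<Sum>b\<in>D. \<Sum>l\<in>B. f k l a b)"
    by (intro sum.cong refl trans[OF sum.swap] sum.swap)
  also have "\<dots> = (\<Sum>a\<in>C. \<Sum>b\<in>D. \<Sum>k\<in>A. \<Sum>l\<in>B. f k l a b)"
    by (rule trans[OF sum.swap]) (intro sum.cong refl sum.swap)
  finally show ?thesis .
qed

text \<open>The first-order terms created by the chain rule are exactly the Christoffel terms.\<close>

lemma laplacian_change_coordinates:
  fixes \<Phi> :: "real^'n \<Rightarrow> real^'n" and u :: "real^'n \<Rightarrow> real"
  assumes W: "open W" "z \<in> W" and \<Phi>: "\<And>a. cont_diff 2 (\<lambda>z. \<Phi> z $ a) W"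
    and V: "open V" "\<Phi> ` W \<subseteq> V" and u: "cont_diff 2 u V"
    and F: "\<And>w. w \<in> W \<Longrightarrow> F w = u (\<Phi> w)"
    and g: "\<And>w. w \<in> W \<Longrightarrow> g w = transpose (Defs.jacobian \<Phi> w) ** Defs.jacobian \<Phi> w"
    and nz: "det (Defs.jacobian \<Phi> z) \<noteq> 0"
  shows "(\<Sum>i\<in>UNIV. \<Sum>j\<in>UNIV. matrix_inv (g z) $ i $ j * (pderiv_at i (pderiv_at j F) z
      - (\<Sum>k\<in>UNIV. christoffel g z k i j * pderiv_at k F z))) = flat_laplacian u (\<Phi> z)"
proof -
  let ?P = "\<lambda>a i. pderiv_at i (\<lambda>z. \<Phi> z $ a)"
  let ?P2 = "\<lambda>a i j. pderiv_at i (?P a j) z"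
  let ?D = "\<lambda>b. pderiv_at b u"
  let ?U = "\<lambda>a b. pderiv_at a (?D b) (\<Phi> z)"
  let ?G = "matrix_inv (g z)"
  have diffa: "(\<lambda>z. \<Phi> z $ a) differentiable at w" if "w \<in> W" for w a
    using cont_diff_Suc_differentiable[of 1 "\<lambda>z. \<Phi> z $ a" W] \<Phi>[of a] W that by (simp add: numeral_2_eq_2)
  then have diff: "\<Phi> differentiable at w" if "w \<in> W" for w
    using that differentiable_vec by blast
  have diff2: "?P a j differentiable at w" if "w \<in> W" for w a j
    using cont_diff_Suc_differentiable[of 0 "?P a j" W] \<Phi>[of a] W that by (simp add: numeral_2_eq_2)
  have diffu: "u differentiable at (\<Phi> w)" if "w \<in> W" for w
    using cont_diff_Suc_differentiable[of 1 u V] u V that by (auto simp: numeral_2_eq_2)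
  have diffD: "?D b differentiable at (\<Phi> w)" if "w \<in> W" for w b
    using cont_diff_Suc_differentiable[of 0 "?D b" V] u V that by (auto simp: numeral_2_eq_2)
  have dF: "pderiv_at j F w = (\<Sum>b\<in>UNIV. (?D b \<circ> \<Phi>) w * ?P b j w)" if w: "w \<in> W" for w j
  proof -
    have "pderiv_at j F w = pderiv_at j (u \<circ> \<Phi>) w"
      by (rule pderiv_at_cong[OF W(1) w]) (simp add: F)
    then show ?thesis
      using pderiv_at_compose(2)[OF diff[OF w] diffu[OF w]] by simp
  qed
  have ddF: "pderiv_at i (pderiv_at j F) z = (\<Sum>b\<in>UNIV. \<Sum>a\<in>UNIV. ?U a b * (?P a i z * ?P b j z))
      + (\<Sum>b\<in>UNIV. ?D b (\<Phi> z) * ?P2 b i j)" for i j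
  proof -
    note dDc = pderiv_at_compose[OF diff[OF W(2)] diffD[OF W(2)]]
    have "pderiv_at i (pderiv_at j F) z = pderiv_at i (\<lambda>w. \<Sum>b\<in>UNIV. (?D b \<circ> \<Phi>) w * ?P b j w) z"
      by (rule pderiv_at_cong[OF W]) (rule dF)
    also have "\<dots> = (\<Sum>b\<in>UNIV. pderiv_at i (\<lambda>w. (?D b \<circ> \<Phi>) w * ?P b j w) z)"
      by (intro pderiv_at_sum differentiable_mult diff2[OF W(2)] dDc(1)[unfolded o_def]) (simp add: dDc(1)[unfolded o_def])
    also have "\<dots> = (\<Sum>b\<in>UNIV. (?D b \<circ> \<Phi>) z * ?P2 b i j + pderiv_at i (?D b \<circ> \<Phi>) z * ?P b j z)"
      by (intro sum.cong refl pderiv_at_mult diff2[OF W(2)] dDc(1))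
    finally show ?thesis
      unfolding dDc(2) sum.distrib by (simp add: sum_distrib_left sum_distrib_right ac_simps)
  qed
  have E: "(\<Sum>i\<in>UNIV. \<Sum>j\<in>UNIV. ?G $ i $ j * (?P a i z * ?P b j z)) = (if a = b then 1 else 0)" for a b
    using sum_inverse_gram[OF nz, of a b] W by (simp add: g jacobian_nth diff)
  have CG: "christoffel g z k i j = (\<Sum>l\<in>UNIV. ?G $ k $ l * (\<Sum>a\<in>UNIV. ?P a l z * ?P2 a i j))" for k i j
    by (rule christoffel_gram[OF W \<Phi> g])
  \<comment> \<open>Summing over \<open>k\<close> and \<open>l\<close> first pairs the gradients of
    two components of \<open>\<Phi>\<close> through the inverse metric, which by \<open>E\<close> is
    a Kronecker delta; what remains is the first-order part of \<open>ddF\<close>.\<close>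
  have C: "(\<Sum>k\<in>UNIV. christoffel g z k i j * pderiv_at k F z) = (\<Sum>b\<in>UNIV. ?D b (\<Phi> z) * ?P2 b i j)" for i j
  proof -
    have "(\<Sum>k\<in>UNIV. christoffel g z k i j * pderiv_at k F z) =
        (\<Sum>k\<in>UNIV. \<Sum>l\<in>UNIV. \<Sum>a\<in>UNIV. \<Sum>b\<in>UNIV. (?D b (\<Phi> z) * ?P2 a i j) * (?G $ k $ l * (?P b k z * ?P a l z)))"
      unfolding CG dF[OF W(2)]
      by (simp add: sum_distrib_left sum_distrib_right ac_simps)
    also have "\<dots> = (\<Sum>a\<in>UNIV. \<Sum>b\<in>UNIV. \<Sum>k\<in>UNIV. \<Sum>l\<in>UNIV. (?D b (\<Phi> z) * ?P2 a i j) * (?G $ k $ l * (?P b k z * ?P a l z)))"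
      by (rule sum_swap_pairs)
    also have "\<dots> = (\<Sum>a\<in>UNIV. \<Sum>b\<in>UNIV. (?D b (\<Phi> z) * ?P2 a i j) * (if b = a then 1 else 0))"
      unfolding sum_distrib_left[symmetric] E ..
    also have "\<dots> = (\<Sum>a\<in>UNIV. ?D a (\<Phi> z) * ?P2 a i j)"
      by (simp add: if_distrib cong: if_cong)
    finally show ?thesis .
  qed
  have "(\<Sum>i\<in>UNIV. \<Sum>j\<in>UNIV. ?G $ i $ j * (pderiv_at i (pderiv_at j F) z
      - (\<Sum>k\<in>UNIV. christoffel g z k i j * pderiv_at k F z)))
    = (\<Sum>i\<in>UNIV. \<Sum>j\<in>UNIV. \<Sum>b\<in>UNIV. \<Sum>a\<in>UNIV. ?U a b * (?G $ i $ j * (?P a i z * ?P b j z)))"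
    unfolding C ddF by (simp add: sum_distrib_left ac_simps)
  also have "\<dots> = (\<Sum>b\<in>UNIV. \<Sum>a\<in>UNIV. \<Sum>i\<in>UNIV. \<Sum>j\<in>UNIV. ?U a b * (?G $ i $ j * (?P a i z * ?P b j z)))"
    by (rule sum_swap_pairs)
  also have "\<dots> = (\<Sum>b\<in>UNIV. \<Sum>a\<in>UNIV. ?U a b * (if a = b then 1 else 0))"
    unfolding sum_distrib_left[symmetric] E ..
  also have "\<dots> = flat_laplacian u (\<Phi> z)"
    unfolding flat_laplacian_def by (simp add: if_distrib cong: if_cong)
  finally show ?thesis .
qed

section \<open>Charts and flat coordinates\<close>

lemma cont_diff_local:
  assumes "open W" "\<And>z. z \<in> W \<Longrightarrow> \<exists>V. open V \<and> z \<in> V \<and> cont_diff k F V"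
  shows "cont_diff k F W"
  using assms(2)
proof (induction k arbitrary: F)
  case 0
  then have "isCont F z" if "z \<in> W" for z
    using that by (metis cont_diff.simps(1) continuous_on_eq_continuous_at)
  then show ?case by (simp add: continuous_at_imp_continuous_on)
next
  case (Suc k)
  have "F differentiable at z" if "z \<in> W" for z
    using Suc.prems[OF that] cont_diff_Suc_differentiable by blast
  moreover have "cont_diff k (pderiv_at i F) W" for i
    by (rule Suc.IH) (metis Suc.prems cont_diff.simps(2))
  ultimately show ?case
    using assms(1) by (simp add: differentiable_on_eq_differentiable_at)
qed

lemma C_onE:
  assumes "C_on m F S" "z \<in> S"
  obtains W G where "open W" "z \<in> W" "\<And>k. enat k \<le> m \<Longrightarrow> cont_diff k G W" "\<And>w. w \<in> W \<inter> S \<Longrightarrow> G w = F w"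
  using assms(1)[unfolded C_on_def, rule_format, OF assms(2)] that by metis

text \<open>\<open>C_on\<close> supplies a separate extension near each point. On an open piece of
  the interior the extension agrees with \<open>F\<close>, hence so do the derivatives, and
  smoothness is local.\<close>

lemma C_on_imp_cont_diff:
  assumes "C_on m F S" "enat k \<le> m"
  shows "cont_diff k F (interior S)"
proof (rule cont_diff_local)
  fix z assume z: "z \<in> interior S"
  then have "z \<in> S" using interior_subset by auto
  with assms(1) obtain W G where W: "open W" "z \<in> W" "\<And>k. enat k \<le> m \<Longrightarrow> cont_diff k G W"
      "\<And>w. w \<in> W \<inter> S \<Longrightarrow> G w = F w"
    by (rule C_onE) blast
  have "cont_diff k G (W \<inter> interior S)"
    by (rule cont_diff_subset[OF W(3)[OF assms(2)]]) simp
  moreover have "cont_diff k G (W \<inter> interior S) \<longleftrightarrow> cont_diff k F (W \<inter> interior S)"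
    using W(1,4) interior_subset[of S] by (intro cont_diff_cong) auto
  ultimately show "\<exists>V. open V \<and> z \<in> V \<and> cont_diff k F V"
    using W(1,2) z by (intro exI[of _ "W \<inter> interior S"]) auto
qed simp

lemma C_on_imp_continuous_on:
  assumes "C_on m F S"
  shows "continuous_on S F"
  unfolding continuous_on_eq_continuous_within
proof
  fix z assume z: "z \<in> S"
  from assms z obtain W G where W: "open W" "z \<in> W" "\<And>k. enat k \<le> m \<Longrightarrow> cont_diff k G W"
      "\<And>w. w \<in> W \<inter> S \<Longrightarrow> G w = F w"
    by (rule C_onE) blast
  have "continuous_on W G"
    using W(3)[of 0] by (simp flip: zero_enat_def)
  then have "continuous_on (W \<inter> S) G"
    by (rule continuous_on_subset) simp
  then have "continuous_on (W \<inter> S) F"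
    using W(4) by (metis (no_types, lifting) continuous_on_cong)
  then have "continuous (at z within (W \<inter> S)) F"
    using W(2) z by (simp add: continuous_on_eq_continuous_within)
  moreover have "at z within (W \<inter> S) = at z within S"
    using W(2) by (intro at_within_nhd[OF _ W(1)]) auto
  ultimately show "continuous (at z within S) F" by simp
qed

lemma top_chartD:
  assumes "top_chart P c"
  shows "openin (top_of_set P) (fst c)" "homeomorphism (fst c) (snd c ` fst c) (snd c) (cinv c)"
    "fst c \<subseteq> P" "continuous_on (fst c) (snd c)" "continuous_on (snd c ` fst c) (cinv c)"
    "inj_on (snd c) (fst c)"
proof -
  show op: "openin (top_of_set P) (fst c)" and h: "homeomorphism (fst c) (snd c ` fst c) (snd c) (cinv c)"
    using assms by (auto simp: top_chart_def split_beta)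
  show "fst c \<subseteq> P"
    by (rule openin_imp_subset[OF op])
  show "continuous_on (fst c) (snd c)" "continuous_on (snd c ` fst c) (cinv c)"
    using h by (auto simp: homeomorphism_def)
  show "inj_on (snd c) (fst c)"
    using h unfolding homeomorphism_def by (metis inj_on_inverseI)
qed

lemma cinv_chart [simp]:
  assumes "top_chart P c" "p \<in> fst c"
  shows "cinv c (snd c p) = p"
  by (rule inv_into_f_f[OF top_chartD(6)[OF assms(1)] assms(2)])

text \<open>The part of a chart whose coordinates fill an open set, so that derivatives, invariance
  of domain and the change of variables apply there.\<close>

definition chart_interior :: "('a, 'n::finite) chart \<Rightarrow> 'a set" where
  "chart_interior c = {p \<in> fst c. snd c p \<in> interior (snd c ` fst c)}"

lemma chart_image_openin:
  assumes "top_chart P c" "openin (top_of_set P) V"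
  shows "openin (top_of_set (snd c ` fst c)) (snd c ` (V \<inter> fst c))"
proof -
  have "openin (top_of_set (fst c)) (V \<inter> fst c)"
    using assms(2) top_chartD(3)[OF assms(1)] openin_subset_trans openin_Int top_chartD(1)[OF assms(1)]
    by (metis inf_le2)
  then show ?thesis
    using homeomorphism_imp_open_map[OF top_chartD(2)[OF assms(1)]] by blast
qed

lemma interior_chart_image:
  assumes "top_chart P c" "openin (top_of_set P) V"
  shows "interior (snd c ` (V \<inter> fst c)) = snd c ` (V \<inter> chart_interior c)"
proof -
  obtain X where X: "open X" "snd c ` (V \<inter> fst c) = X \<inter> snd c ` fst c"
    using chart_image_openin[OF assms] by (auto simp: openin_open)
  have "interior (snd c ` (V \<inter> fst c)) = X \<inter> interior (snd c ` fst c)"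
    using X by (simp add: interior_open)
  also have "\<dots> = snd c ` (V \<inter> chart_interior c)"
  proof (intro equalityI subsetI)
    fix z assume z: "z \<in> X \<inter> interior (snd c ` fst c)"
    then have "z \<in> snd c ` (V \<inter> fst c)"
      using X(2) subsetD[OF interior_subset, of z "snd c ` fst c"] by auto
    then show "z \<in> snd c ` (V \<inter> chart_interior c)"
      using z by (auto simp: chart_interior_def)
  next
    fix z assume "z \<in> snd c ` (V \<inter> chart_interior c)"
    then show "z \<in> X \<inter> interior (snd c ` fst c)"
      using X(2) by (auto simp: chart_interior_def)
  qed
  finally show ?thesis .
qed

lemma openin_chart_interior:
  assumes "top_chart P c"
  shows "openin (top_of_set P) (chart_interior c)"
proof -
  have "chart_interior c = fst c \<inter> snd c -` interior (snd c ` fst c)"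
    by (auto simp: chart_interior_def)
  then have "openin (top_of_set (fst c)) (chart_interior c)"
    using top_chartD(4)[OF assms] by (simp add: continuous_openin_preimage_gen)
  then show ?thesis
    using top_chartD(1)[OF assms] openin_trans by blast
qed


lemma chart_interior_subset: "chart_interior c \<subseteq> fst c"
  by (auto simp: chart_interior_def)

lemma open_chart_image:
  assumes "top_chart P c" "openin (top_of_set P) V" "V \<subseteq> chart_interior c"
  shows "open (snd c ` V)"
proof -
  have "V \<inter> chart_interior c = V"
    using assms(3) by auto
  then show ?thesis
    using interior_chart_image[OF assms(1,2)] open_interior[of "snd c ` (V \<inter> fst c)"] by simp
qed

text \<open>Composed with the inverse of the chart, \<open>g\<close> is a continuous injection of an
  open subset of Euclidean space, and invariance of domain applies. It serves for flat coordinates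
  and for \<open>T\<close> followed by a chart.\<close>

lemma open_image_chart_interior:
  fixes g :: "'a::t2_space \<Rightarrow> real^'n"
  assumes "top_chart P (c :: ('a, 'n) chart)" "openin (top_of_set P) V" "V \<subseteq> chart_interior c"
    and "continuous_on V g" "inj_on g V"
  shows "open (g ` V)"
proof -
  have V: "V \<subseteq> fst c"
    using assms(3) chart_interior_subset[of c] by (rule order_trans)
  have [simp]: "cinv c (snd c p) = p" if "p \<in> V" for p
    using V that assms(1) by auto
  have "open ((g \<circ> cinv c) ` (snd c ` V))"
  proof (rule invariance_of_domain)
    show "continuous_on (snd c ` V) (g \<circ> cinv c)"
      using assms(4) V by (intro continuous_on_compose continuous_on_subset[OF top_chartD(5)[OF assms(1)]])
        (auto simp: image_image cong: image_cong_simp)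
    show "open (snd c ` V)"
      by (rule open_chart_image[OF assms(1-3)])
    show "inj_on (g \<circ> cinv c) (snd c ` V)"
      using assms(5) by (auto simp: inj_on_def)
  qed
  also have "(g \<circ> cinv c) ` (snd c ` V) = g ` V"
    by (auto simp: image_image cong: image_cong_simp)
  finally show ?thesis .
qed

section \<open>Transition between the atlas and flat coordinates\<close>

abbreviation mopen :: "('a::t2_space, 'n::finite) riem \<Rightarrow> 'a set \<Rightarrow> bool" where
  "mopen M V \<equiv> openin (top_of_set (points M)) V"

lemma riemannian_manifoldD:
  assumes "riemannian_manifold M" "c \<in> charts M"
  shows "top_chart (points M) c" "C_on \<infinity> (metric M c) (snd c ` fst c)"
    "\<And>z v. z \<in> snd c ` fst c \<Longrightarrow> v \<noteq> 0 \<Longrightarrow> 0 < v \<bullet> (metric M c z *v v)"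
    "\<exists>H. model_space H \<and> openin (top_of_set H) (snd c ` fst c)"
  using assms by (auto simp: riemannian_manifold_def smooth_manifold_def split_beta)

lemma riemannian_manifold_cover:
  assumes "riemannian_manifold M" "p \<in> points M"
  obtains c where "c \<in> charts M" "p \<in> fst c"
proof -
  have "p \<in> (\<Union>(U, \<phi>)\<in>charts M. U)"
    using assms by (simp add: riemannian_manifold_def smooth_manifold_def)
  then show ?thesis using that by auto
qed

lemma manifold_interior_eq: "manifold_interior M = (\<Union>c\<in>charts M. chart_interior c)"
  by (auto simp: manifold_interior_def chart_interior_def)

lemma det_metric_nonzero:
  assumes "riemannian_manifold M" "c \<in> charts M" "z \<in> snd c ` fst c"
  shows "det (metric M c z) \<noteq> 0"
proof -
  have "v = 0" if "metric M c z *v v = 0" for v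
    using riemannian_manifoldD(3)[OF assms, of v] that by fastforce
  then have "\<exists>B. B ** metric M c z = mat 1"
    by (simp add: matrix_left_invertible_ker)
  then show ?thesis
    by (metis invertible_det_nz invertible_left_inverse)
qed

lemma flat_top_chart: "flat_coordinates M d \<Longrightarrow> top_chart (points M) d"
  by (auto simp: flat_coordinates_def split_beta)

text \<open>All that calculus and integration require of the transition map from a chart to flat
  coordinates on a common piece of the interior. Its Jacobian is invertible because the squared
  Jacobian determinant is the determinant of the positive definite metric.\<close>

lemma flat_transition:
  fixes M :: "('a::t2_space, 'n::finite) riem"
  assumes "riemannian_manifold M" "flat_coordinates M d" "c \<in> charts M"
    and V: "mopen M V" "V \<subseteq> fst d \<inter> chart_interior c"
  shows "open (snd c ` V)" "open (snd d ` V)"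
    and "cont_diff k (\<lambda>z. (snd d \<circ> cinv c) z $ a) (snd c ` V)"
    and "z \<in> snd c ` V \<Longrightarrow> metric M c z = transpose (Defs.jacobian (snd d \<circ> cinv c) z) ** Defs.jacobian (snd d \<circ> cinv c) z"
    and "z \<in> snd c ` V \<Longrightarrow> det (Defs.jacobian (snd d \<circ> cinv c) z) \<noteq> 0"
    and "inj_on (snd d \<circ> cinv c) (snd c ` V)"
    and "(snd d \<circ> cinv c) ` (snd c ` V) = snd d ` V"
proof -
  have c: "top_chart (points M) c"
    by (rule riemannian_manifoldD(1)[OF assms(1,3)])
  have d: "top_chart (points M) d" "C_on \<infinity> (snd d \<circ> cinv c) (snd c ` (fst d \<inter> fst c))"
    "\<And>z. z \<in> interior (snd c ` (fst d \<inter> fst c)) \<Longrightarrow>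
      transpose (Defs.jacobian (snd d \<circ> cinv c) z) ** Defs.jacobian (snd d \<circ> cinv c) z = metric M c z"
    using assms(2,3) by (auto simp: flat_coordinates_def split_beta Let_def)
  have Vi: "V \<subseteq> chart_interior c" "V \<subseteq> fst d" "V \<subseteq> fst c"
    using V(2) chart_interior_subset[of c] by auto
  have inv: "cinv c (snd c p) = p" "cinv d (snd d p) = p" if "p \<in> V" for p
    using Vi that c d(1) by auto
  show o: "open (snd c ` V)"
    by (rule open_chart_image[OF c V(1) Vi(1)])
  show "open (snd d ` V)"
    by (rule open_image_chart_interior[OF c V(1) Vi(1)])
      (use top_chartD[OF d(1)] Vi in \<open>auto intro: continuous_on_subset inj_on_subset\<close>)
  have sub: "snd c ` V \<subseteq> interior (snd c ` (fst d \<inter> fst c))"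
    using o Vi by (intro interior_maximal) auto
  have "cont_diff k (snd d \<circ> cinv c) (snd c ` V)"
    by (rule cont_diff_subset[OF C_on_imp_cont_diff[OF d(2)] sub]) simp
  then show "cont_diff k (\<lambda>z. (snd d \<circ> cinv c) z $ a) (snd c ` V)"
    by (rule cont_diff_nth[OF o])
  show g: "metric M c z = transpose (Defs.jacobian (snd d \<circ> cinv c) z) ** Defs.jacobian (snd d \<circ> cinv c) z"
    if "z \<in> snd c ` V" for z
    by (rule d(3)[OF subsetD[OF sub that], symmetric])
  show "det (Defs.jacobian (snd d \<circ> cinv c) z) \<noteq> 0" if z: "z \<in> snd c ` V"
  proof -
    have "det (metric M c z) \<noteq> 0"
      using z Vi by (intro det_metric_nonzero[OF assms(1,3)]) auto
    then show ?thesis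
      unfolding g[OF z] by (simp add: det_mul)
  qed
  show "inj_on (snd d \<circ> cinv c) (snd c ` V)"
    using inv inj_on_subset[OF top_chartD(6)[OF d(1)] Vi(2)] by (auto simp: inj_on_def)
  show "(snd d \<circ> cinv c) ` (snd c ` V) = snd d ` V"
    using inv by (auto simp: image_image cong: image_cong_simp)
qed

text \<open>Regularity is given in charts, but Taylor expansion takes place in flat coordinates.
  Passing over uses the inverse transition map, hence \<open>cont_diff_inverse_map\<close> and an
  order of the form \<open>Suc m\<close>.\<close>

lemma cont_diff_flat:
  fixes M :: "('a::t2_space, 'n::finite) riem" and u :: "'a \<Rightarrow> real"
  assumes "riemannian_manifold M" "flat_coordinates M d" "c \<in> charts M"
    and V: "mopen M V" "V \<subseteq> fst d \<inter> chart_interior c"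
    and u: "cont_diff (Suc m) (u \<circ> cinv c) (snd c ` V)"
  shows "cont_diff (Suc m) (u \<circ> cinv d) (snd d ` V)"
proof -
  note ft = flat_transition[OF assms(1-5)]
  have c: "top_chart (points M) c" and d: "top_chart (points M) d"
    using riemannian_manifoldD(1)[OF assms(1,3)] flat_top_chart[OF assms(2)] by auto
  have Vi: "V \<subseteq> fst d" "V \<subseteq> fst c"
    using V(2) chart_interior_subset[of c] by auto
  have inv: "cinv c (snd c p) = p" "cinv d (snd d p) = p" if "p \<in> V" for p
    using Vi that c d by auto
  have img: "cinv d ` snd d ` V = V"
    using inv by (auto simp: image_image cong: image_cong_simp)
  have cont: "continuous_on (snd d ` V) (snd c \<circ> cinv d)"
  proof (rule continuous_on_compose)
    show "continuous_on (snd d ` V) (cinv d)"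
      using Vi by (intro continuous_on_subset[OF top_chartD(5)[OF d]]) auto
    show "continuous_on (cinv d ` snd d ` V) (snd c)"
      unfolding img by (rule continuous_on_subset[OF top_chartD(4)[OF c] Vi(2)])
  qed
  have g: "cont_diff (Suc m) (\<lambda>w. (snd c \<circ> cinv d) w $ a) (snd d ` V)" for a
    by (rule cont_diff_inverse_map[OF ft(1,2,3) _ _ cont ft(5)]) (auto simp: inv)
  have "cont_diff (Suc m) ((u \<circ> cinv c) \<circ> (snd c \<circ> cinv d)) (snd d ` V)"
  proof (rule cont_diff_compose[OF ft(2,1) _ u])
    show "(snd c \<circ> cinv d) ` snd d ` V \<subseteq> snd c ` V"
      by (auto simp: inv)
  qed (rule g)
  moreover have "((u \<circ> cinv c) \<circ> (snd c \<circ> cinv d)) w = (u \<circ> cinv d) w" if "w \<in> snd d ` V" for w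
    using that by (auto simp: inv)
  ultimately show ?thesis
    using cont_diff_cong[OF ft(2)] by blast
qed

definition C_near :: "nat \<Rightarrow> ('a::t2_space, 'n::finite) riem \<Rightarrow> ('a \<Rightarrow> real) \<Rightarrow> 'a \<Rightarrow> bool" where
  "C_near k M u p \<longleftrightarrow> (\<forall>c\<in>charts M. p \<in> chart_interior c \<longrightarrow>
     (\<exists>V. mopen M V \<and> p \<in> V \<and> V \<subseteq> chart_interior c \<and> cont_diff k (u \<circ> cinv c) (snd c ` V)))"

lemma C_near_flat:
  fixes M :: "('a::t2_space, 'n::finite) riem"
  assumes M: "riemannian_manifold M" and d: "flat_coordinates M d" and c: "c \<in> charts M"
    and p: "p \<in> fst d" "p \<in> chart_interior c" and u: "C_near (Suc m) M u p"
  obtains V where "mopen M V" "p \<in> V" "V \<subseteq> fst d \<inter> chart_interior c"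
    "cont_diff (Suc m) (u \<circ> cinv d) (snd d ` V)"
proof -
  obtain V where V: "mopen M V" "p \<in> V" "V \<subseteq> chart_interior c"
    "cont_diff (Suc m) (u \<circ> cinv c) (snd c ` V)"
    using u c p(2) unfolding C_near_def by blast
  let ?V = "V \<inter> fst d"
  have td: "top_chart (points M) d"
    by (rule flat_top_chart[OF d])
  have V': "mopen M ?V" "?V \<subseteq> fst d \<inter> chart_interior c" "p \<in> ?V"
    using openin_Int[OF V(1) top_chartD(1)[OF td]] V p by auto
  have cd: "cont_diff (Suc m) (u \<circ> cinv c) (snd c ` ?V)"
    by (rule cont_diff_subset[OF V(4)]) auto
  show ?thesis
    by (rule that[OF V'(1,3,2) cont_diff_flat[OF M d c V'(1,2) cd]])
qed

text \<open>The change of coordinates works for whichever chart the choice in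
  \<open>laplacian\<close> delivers, so the result does not depend on that choice.\<close>

lemma laplacian_eq_flat_laplacian:
  fixes M :: "('a::t2_space, 'n::finite) riem"
  assumes M: "riemannian_manifold M" and d: "flat_coordinates M d"
    and p: "p \<in> fst d" "p \<in> manifold_interior M" and u: "C_near 2 M u p"
  shows "laplacian M u p = flat_laplacian (u \<circ> cinv d) (snd d p)"
proof -
  define c where "c = (SOME c. c \<in> charts M \<and> p \<in> fst c \<and> snd c p \<in> interior (snd c ` fst c))"
  have "\<exists>c. c \<in> charts M \<and> p \<in> fst c \<and> snd c p \<in> interior (snd c ` fst c)"
    using p(2) unfolding manifold_interior_eq chart_interior_def by blast
  then have "c \<in> charts M \<and> p \<in> fst c \<and> snd c p \<in> interior (snd c ` fst c)"
    unfolding c_def by (rule someI_ex)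
  then have c: "c \<in> charts M" "p \<in> chart_interior c" "p \<in> fst c"
    by (auto simp: chart_interior_def)
  have u': "C_near (Suc 1) M u p"
    using u by (simp add: numeral_2_eq_2)
  obtain V where V: "mopen M V" "p \<in> V" "V \<subseteq> fst d \<inter> chart_interior c"
    "cont_diff (Suc 1) (u \<circ> cinv d) (snd d ` V)"
    by (rule C_near_flat[OF M d c(1) p(1) c(2) u'])
  note ft = flat_transition[OF M d c(1) V(1,3)]
  have tc: "top_chart (points M) c" and td: "top_chart (points M) d"
    using riemannian_manifoldD(1)[OF M c(1)] flat_top_chart[OF d] by auto
  have Vi: "V \<subseteq> fst d" "V \<subseteq> fst c"
    using V(3) chart_interior_subset[of c] by auto
  have inv: "cinv c (snd c p) = p" "cinv d (snd d p) = p" if "p \<in> V" for p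
    using Vi that tc td by auto
  have "laplacian M u p = (\<Sum>i\<in>UNIV. \<Sum>j\<in>UNIV. matrix_inv (metric M c (snd c p)) $ i $ j *
       (pderiv_at i (pderiv_at j (u \<circ> cinv c)) (snd c p)
        - (\<Sum>k\<in>UNIV. christoffel (metric M c) (snd c p) k i j * pderiv_at k (u \<circ> cinv c) (snd c p))))"
    unfolding laplacian_def Let_def c_def ..
  also have "\<dots> = flat_laplacian (u \<circ> cinv d) ((snd d \<circ> cinv c) (snd c p))"
  proof (rule laplacian_change_coordinates[OF ft(1) _ ft(3) ft(2)])
    show "cont_diff 2 (u \<circ> cinv d) (snd d ` V)"
      using V(4) by (simp add: numeral_2_eq_2)
    show "det (Defs.jacobian (snd d \<circ> cinv c) (snd c p)) \<noteq> 0"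
      using V(2) by (intro ft(5)) auto
    show "metric M c w = transpose (Defs.jacobian (snd d \<circ> cinv c) w) ** Defs.jacobian (snd d \<circ> cinv c) w"
      if "w \<in> snd c ` V" for w
      by (rule ft(4)[OF that])
    show "(u \<circ> cinv c) w = (u \<circ> cinv d) ((snd d \<circ> cinv c) w)" if "w \<in> snd c ` V" for w
      using that inv by auto
  qed (use V(2) ft(7) in auto)
  finally show ?thesis
    using inv V(2) by simp
qed

section \<open>Change of variables for finite index types\<close>

text \<open>The change-of-variables theorem of the library requires a wellordered index type; an arbitrary
  finite index type is first replaced by an initial segment of the natural numbers.\<close>

typedef ('n::finite) widx = "{..<CARD('n)}"
  by (auto intro!: exI[of _ 0])

instantiation widx :: (finite) "{finite, wellorder}"
begin

definition less_eq_widx :: "'a widx \<Rightarrow> 'a widx \<Rightarrow> bool" where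
  "less_eq_widx x y \<longleftrightarrow> Rep_widx x \<le> Rep_widx y"

definition less_widx :: "'a widx \<Rightarrow> 'a widx \<Rightarrow> bool" where
  "less_widx x y \<longleftrightarrow> Rep_widx x < Rep_widx y"

instance
proof
  have "finite (Abs_widx ` {..<CARD('a)} :: 'a widx set)" by simp
  then show "finite (UNIV :: 'a widx set)"
    using type_definition.Abs_image[OF type_definition_widx] by metis
  show "P a" if "\<And>x. (\<And>y. y < x \<Longrightarrow> P y) \<Longrightarrow> P x" for P and a :: "'a widx"
    by (rule measure_induct_rule[where f=Rep_widx]) (rule that, simp add: less_widx_def)
qed (auto simp: less_eq_widx_def less_widx_def Rep_widx_inject)

end

lemma card_widx: "CARD('n widx) = CARD('n::finite)"
  using type_definition.card[OF type_definition_widx] by simp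

lemma ex_bij_widx: "\<exists>\<pi> :: 'n::finite widx \<Rightarrow> 'n. bij \<pi>"
  by (rule finite_same_card_bij) (simp_all add: card_widx)

lemma prod_Basis_cart:
  fixes g :: "real^'n"
  shows "(\<Prod>b\<in>Basis. g \<bullet> b) = (\<Prod>i\<in>UNIV. g $ i)"
proof -
  have eq: "(Basis :: (real^'n) set) = (\<lambda>i. axis i 1) ` UNIV"
    by (auto simp: Basis_vec_def)
  have inj: "inj (\<lambda>i::'n. axis i (1::real))"
    by (auto simp: inj_on_def axis_eq_axis)
  show ?thesis
    unfolding eq prod.reindex[OF inj] by (simp add: inner_axis)
qed

text \<open>Lebesgue measure is determined by boxes. The preimage of a box is the box with permuted
  sides, and the product of the side lengths ignores their order.\<close>

lemma lborel_distr_reindex: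
  fixes \<pi> :: "'m::finite \<Rightarrow> 'n::finite"
  assumes "bij \<pi>"
  shows "distr lborel borel (\<lambda>x::real^'n. \<chi> i. x $ \<pi> i) = (lborel :: (real^'m) measure)"
proof (rule lborel_eqI[symmetric])
  let ?P = "\<lambda>x::real^'n. (\<chi> i. x $ \<pi> i) :: real^'m"
  let ?Q = "\<lambda>y::real^'m. (\<chi> j. y $ inv \<pi> j) :: real^'n"
  have [measurable]: "?P \<in> borel \<rightarrow>\<^sub>M borel"
    by (intro borel_measurable_continuous_onI continuous_intros)
  fix l u :: "real^'m" assume le: "\<And>b. b \<in> Basis \<Longrightarrow> l \<bullet> b \<le> u \<bullet> b"
  have lu: "l $ i \<le> u $ i" for i
    using le[of "axis i 1"] by (simp add: inner_axis axis_in_Basis_iff)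
  have "?P -` box l u = box (?Q l) (?Q u)"
    using assms by (auto simp: mem_box_cart bij_is_surj surj_f_inv_f bij_is_inj inv_f_f)
      (metis bij_inv_eq_iff)+
  then have "emeasure (distr lborel borel ?P) (box l u) = emeasure lborel (box (?Q l) (?Q u))"
    by (simp add: emeasure_distr)
  also have "\<dots> = (\<Prod>b\<in>Basis. (?Q u - ?Q l) \<bullet> b)"
    using lu by (intro emeasure_lborel_box) (auto simp: Basis_vec_def inner_axis)
  also have "(\<Prod>b\<in>Basis. (?Q u - ?Q l) \<bullet> b) = (\<Prod>j\<in>UNIV. u $ inv \<pi> j - l $ inv \<pi> j)"
    by (simp add: prod_Basis_cart)
  also have "\<dots> = (\<Prod>i\<in>UNIV. u $ i - l $ i)"
    using prod.reindex_bij_betw[OF bij_imp_bij_inv[OF assms], of "\<lambda>i. u $ i - l $ i"] by simp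
  also have "\<dots> = (\<Prod>b\<in>Basis. (u - l) \<bullet> b)"
    by (simp add: prod_Basis_cart)
  finally show "emeasure (distr lborel borel ?P) (box l u) = (\<Prod>b\<in>Basis. (u - l) \<bullet> b)" .
qed simp

text \<open>In the Leibniz formula, conjugation by \<open>\<pi>\<close> is a sign-preserving
  bijection between the permutations of the two index types.\<close>

lemma det_reindex:
  fixes A :: "real^'n^'n" and \<pi> :: "'m::finite \<Rightarrow> 'n::finite"
  assumes \<pi>: "bij \<pi>"
  shows "det (\<chi> i j. A $ \<pi> i $ \<pi> j) = det A"
proof -
  let ?t = "\<lambda>p. map_permutation UNIV \<pi> p" and ?s = "\<lambda>q. map_permutation UNIV (inv \<pi>) q"
  have t: "?t p = \<pi> \<circ> p \<circ> inv \<pi>" for p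
    using \<pi> by (simp add: map_permutation_def restrict_id_def bij_is_surj fun_eq_iff)
  have inv_inv: "inv_into UNIV (inv \<pi>) = \<pi>"
    using \<pi> by (simp add: inv_inv_eq)
  have s: "?s q = inv \<pi> \<circ> q \<circ> \<pi>" for q
    using \<pi> bij_imp_bij_inv[OF \<pi>] inv_inv by (simp add: map_permutation_def restrict_id_def bij_is_surj fun_eq_iff)
  show ?thesis
    unfolding det_def
  proof (rule sum.reindex_bij_witness[where i="?s" and j="?t"])
    fix p :: "'m \<Rightarrow> 'm" assume p: "p \<in> {p. p permutes UNIV}"
    show "?s (?t p) = p"
      using \<pi> by (simp add: s t fun_eq_iff bij_is_inj)
    show "?t p \<in> {p. p permutes UNIV}"
      using p map_permutation_permutes[OF \<pi>] by simp
    have "sign (?t p) = sign p"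
      using p \<pi> by (intro sign_map_permutation) (auto simp: bij_is_inj)
    moreover have "(\<Prod>i\<in>UNIV. A $ i $ (\<pi> \<circ> p \<circ> inv \<pi>) i) = (\<Prod>i\<in>UNIV. A $ \<pi> i $ \<pi> (p i))"
      using prod.reindex_bij_betw[OF \<pi>, of "\<lambda>i. A $ i $ (\<pi> \<circ> p \<circ> inv \<pi>) i"] \<pi>
      by (simp add: bij_is_inj)
    ultimately show "of_int (sign (?t p)) * (\<Prod>i\<in>UNIV. A $ i $ ?t p i)
        = of_int (sign p) * (\<Prod>i\<in>UNIV. (\<chi> i j. A $ \<pi> i $ \<pi> j) $ i $ p i)"
      by (simp add: t)
  next
    fix q :: "'n \<Rightarrow> 'n" assume q: "q \<in> {p. p permutes UNIV}"
    show "?t (?s q) = q"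
      using \<pi> by (simp add: s t fun_eq_iff bij_is_surj surj_f_inv_f)
    show "?s q \<in> {p. p permutes UNIV}"
      using q map_permutation_permutes[OF bij_imp_bij_inv[OF \<pi>]] by simp
  qed
qed

text \<open>Measurability and finiteness make the Jacobian factor Lebesgue integrable, hence
  integrable over \<open>S\<close> in the gauge sense, the setting of the change-of-variables
  formula; the result is then read back as a nonnegative integral.\<close>

lemma emeasure_differentiable_image_wellorder:
  fixes f :: "real^'m::{finite,wellorder} \<Rightarrow> real^'m::_"
  assumes S: "S \<in> sets borel" and f: "\<And>x. x \<in> S \<Longrightarrow> (f has_derivative f' x) (at x within S)" "inj_on f S"
    and img: "f ` S \<in> sets borel"
    and meas [measurable]: "(\<lambda>x. indicator S x * \<bar>det (matrix (f' x))\<bar>) \<in> borel_measurable borel"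
    and fin: "(\<integral>\<^sup>+x. ennreal (indicator S x * \<bar>det (matrix (f' x))\<bar>) \<partial>lborel) < \<infinity>"
  shows "emeasure lborel (f ` S) = (\<integral>\<^sup>+x. ennreal (indicator S x * \<bar>det (matrix (f' x))\<bar>) \<partial>lborel)"
proof -
  let ?h = "\<lambda>x. indicator S x * \<bar>det (matrix (f' x))\<bar>"
  have int: "integrable lborel ?h"
    using fin by (intro integrableI_nonneg) auto
  have si: "set_integrable lborel S (\<lambda>x. \<bar>det (matrix (f' x))\<bar>)"
    using int by (simp add: set_integrable_def)
  have S': "S \<in> sets lebesgue" and img': "f ` S \<in> sets lebesgue"
    using S img by auto
  note hi = set_borel_integral_eq_integral[OF si]
  have lm: "f ` S \<in> lmeasurable"
    using measurable_differentiable_image_eq[OF S' f] hi(1) by simp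
  have "emeasure lborel (f ` S) = emeasure lebesgue (f ` S)"
    using img by simp
  also have "\<dots> = ennreal (measure lebesgue (f ` S))"
    by (rule emeasure_eq_ennreal_measure[OF fmeasurableD2[OF lm]])
  also have "measure lebesgue (f ` S) = integral S (\<lambda>x. \<bar>det (matrix (f' x))\<bar>)"
    by (rule measure_differentiable_image_eq[OF S' f hi(1)])
  also have "\<dots> = integral\<^sup>L lborel ?h"
    using hi(2) by (simp add: set_lebesgue_integral_def)
  also have "ennreal \<dots> = (\<integral>\<^sup>+x. ennreal (?h x) \<partial>lborel)"
    using int by (intro nn_integral_eq_integral[symmetric]) auto
  finally show ?thesis .
qed

text \<open>Conjugating \<open>f\<close> by the renaming \<open>P\<close> of coordinates changes
  neither Lebesgue measure nor the Jacobian determinant.\<close>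

lemma emeasure_differentiable_image:
  fixes f :: "real^'n::finite \<Rightarrow> real^'n"
  assumes S: "S \<in> sets borel" and f: "\<And>x. x \<in> S \<Longrightarrow> (f has_derivative f' x) (at x within S)" "inj_on f S"
    and img: "f ` S \<in> sets borel"
    and meas [measurable]: "(\<lambda>x. indicator S x * \<bar>det (matrix (f' x))\<bar>) \<in> borel_measurable borel"
    and fin: "(\<integral>\<^sup>+x. ennreal (indicator S x * \<bar>det (matrix (f' x))\<bar>) \<partial>lborel) < \<infinity>"
  shows "emeasure lborel (f ` S) = (\<integral>\<^sup>+x. ennreal (indicator S x * \<bar>det (matrix (f' x))\<bar>) \<partial>lborel)"
proof -
  obtain \<pi> :: "'n widx \<Rightarrow> 'n" where \<pi>: "bij \<pi>"
    using ex_bij_widx by blast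
  define P where "P x = (\<chi> i. x $ \<pi> i)" for x :: "real^'n"
  define Q where "Q y = (\<chi> j. y $ inv \<pi> j)" for y :: "real^'n widx"
  have PQ [simp]: "P (Q y) = y" "Q (P x) = x" for x y
    using \<pi> by (auto simp: P_def Q_def vec_eq_iff bij_is_inj bij_is_surj surj_f_inv_f)
  have lin: "linear P" "linear Q"
    by (auto intro!: linearI simp: P_def Q_def vec_eq_iff)
  have bl: "bounded_linear P" "bounded_linear Q"
    using lin by (auto simp: linear_conv_bounded_linear)
  have [measurable]: "P \<in> borel \<rightarrow>\<^sub>M borel" "Q \<in> borel \<rightarrow>\<^sub>M borel"
    using bl by (auto intro!: borel_measurable_continuous_onI linear_continuous_on)
  have dP: "distr lborel borel P = lborel" and dQ: "distr lborel borel Q = lborel"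
    using lborel_distr_reindex[OF \<pi>] lborel_distr_reindex[OF bij_imp_bij_inv[OF \<pi>]]
    by (simp_all add: P_def[abs_def] Q_def[abs_def])
  have PS: "P ` A = Q -` A" for A
    by (auto simp: image_iff) (metis PQ(1))
  have PA: "P ` A \<in> sets borel" "emeasure lborel (P ` A) = emeasure lborel A" if "A \<in> sets borel" for A
  proof -
    show "P ` A \<in> sets borel"
      using measurable_sets[of Q borel borel A] that unfolding PS by simp
    have "emeasure lborel A = emeasure (distr lborel borel Q) A"
      by (simp add: dQ)
    also have "\<dots> = emeasure lborel (Q -` A)"
      using that by (simp add: emeasure_distr)
    finally show "emeasure lborel (P ` A) = emeasure lborel A"
      by (simp add: PS)
  qed
  have indS: "indicator (P ` S) y = (indicator S (Q y) :: real)" for y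
    by (auto simp: PS indicator_def)
  let ?F = "P \<circ> f \<circ> Q"
  let ?F' = "\<lambda>y. P \<circ> f' (Q y) \<circ> Q"
  have Fimg: "?F ` (P ` S) = P ` (f ` S)"
    by (auto simp: image_image)
  have mat: "matrix (?F' y) = (\<chi> i j. matrix (f' (Q y)) $ \<pi> i $ \<pi> j)" for y
  proof -
    have Q_axis: "Q (axis j 1) = axis (\<pi> j) 1" for j
      using \<pi> by (auto simp: Q_def axis_def vec_eq_iff bij_is_inj bij_is_surj surj_f_inv_f)
    show ?thesis
      by (simp add: matrix_def P_def vec_eq_iff Q_axis)
  qed
  have det: "det (matrix (?F' y)) = det (matrix (f' (Q y)))" for y
    unfolding mat by (rule det_reindex[OF \<pi>])
  have nn: "(\<integral>\<^sup>+y. ennreal (indicator (P ` S) y * \<bar>det (matrix (?F' y))\<bar>) \<partial>lborel)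
      = (\<integral>\<^sup>+x. ennreal (indicator S x * \<bar>det (matrix (f' x))\<bar>) \<partial>lborel)"
  proof -
    have "(\<integral>\<^sup>+x. ennreal (indicator S x * \<bar>det (matrix (f' x))\<bar>) \<partial>lborel)
        = (\<integral>\<^sup>+x. ennreal (indicator S x * \<bar>det (matrix (f' x))\<bar>) \<partial>distr lborel borel Q)"
      by (simp add: dQ)
    also have "\<dots> = (\<integral>\<^sup>+y. ennreal (indicator S (Q y) * \<bar>det (matrix (f' (Q y)))\<bar>) \<partial>lborel)"
      by (subst nn_integral_distr) auto
    finally show ?thesis
      by (simp add: indS det)
  qed
  have "emeasure lborel (?F ` (P ` S)) = (\<integral>\<^sup>+y. ennreal (indicator (P ` S) y * \<bar>det (matrix (?F' y))\<bar>) \<partial>lborel)"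
  proof (rule emeasure_differentiable_image_wellorder)
    show "P ` S \<in> sets borel"
      by (rule PA(1)[OF S])
    show "?F ` P ` S \<in> sets borel"
      unfolding Fimg by (rule PA(1)[OF img])
    show "inj_on ?F (P ` S)"
      using f(2) by (auto simp: inj_on_def) (metis PQ(2))
    show "(?F has_derivative ?F' y) (at y within P ` S)" if "y \<in> P ` S" for y
    proof -
      have "(f has_derivative f' (Q y)) (at (Q y) within Q ` (P ` S))"
        using f(1)[of "Q y"] that by (auto simp: image_image)
      from has_derivative_in_compose[OF bounded_linear_imp_has_derivative[OF bl(2)] this]
      have "((\<lambda>y. f (Q y)) has_derivative (\<lambda>h. f' (Q y) (Q h))) (at y within P ` S)" .
      from bounded_linear.has_derivative[OF bl(1) this] show ?thesis
        by (simp add: o_def)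
    qed
    have "(\<lambda>y. (\<lambda>x. indicator S x * \<bar>det (matrix (f' x))\<bar>) (Q y)) \<in> borel_measurable borel"
      by measurable
    then show "(\<lambda>y. indicator (P ` S) y * \<bar>det (matrix (?F' y))\<bar>) \<in> borel_measurable borel"
      by (simp add: indS det)
    show "(\<integral>\<^sup>+y. ennreal (indicator (P ` S) y * \<bar>det (matrix (?F' y))\<bar>) \<partial>lborel) < \<infinity>"
      unfolding nn by (rule fin)
  qed
  then show ?thesis
    unfolding Fimg nn PA(2)[OF img] .
qed

section \<open>Riemannian volume in flat coordinates\<close>

text \<open>The direct image is also a preimage under the continuous inverse, taken within an open
  set.\<close>

lemma sets_image_chart:
  fixes d :: "('a::t2_space, 'n::finite) chart"
  assumes d: "top_chart P d" and op: "open (snd d ` V)" and V: "V \<subseteq> fst d"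
    and E: "E \<in> sets (restrict_space borel P)" "E \<subseteq> V"
  shows "snd d ` E \<in> sets borel"
proof -
  obtain B where B: "B \<in> sets borel" "E = P \<inter> B"
    using E(1) by (auto simp: sets_restrict_space)
  have VP: "V \<subseteq> P"
    using V top_chartD(3)[OF d] by (rule order_trans)
  have "cinv d \<in> borel_measurable (restrict_space borel (snd d ` V))"
    using V by (intro borel_measurable_continuous_on_restrict continuous_on_subset[OF top_chartD(5)[OF d]]) auto
  then have "cinv d -` B \<inter> space (restrict_space borel (snd d ` V)) \<in> sets (restrict_space borel (snd d ` V))"
    using B(1) by (rule measurable_sets)
  then have "cinv d -` B \<inter> snd d ` V \<in> sets borel"
    using op by (simp add: space_restrict_space sets_restrict_space_iff)
  moreover have "cinv d (snd d p) = p" if "p \<in> V" for p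
    using V that d by auto
  then have "cinv d -` B \<inter> snd d ` V = snd d ` E"
    using B(2) E(2) VP by auto
  ultimately show ?thesis by simp
qed

locale riemannian_volume_space =
  fixes M :: "('a::t2_space, 'n::finite) riem" and \<mu> :: "'a measure"
  assumes manifold: "riemannian_manifold M" and compact_points: "compact (points M)"
    and volume: "riemannian_volume M \<mu>"
begin

lemma sets_\<mu>: "sets \<mu> = sets (restrict_space borel (points M))"
  using volume by (simp add: riemannian_volume_def)

lemma space_\<mu> [simp]: "space \<mu> = points M"
  using sets_eq_imp_space_eq[OF sets_\<mu>] by (simp add: space_restrict_space)

lemma emeasure_chart:
  assumes "c \<in> charts M" "A \<in> sets \<mu>" "A \<subseteq> fst c"
  shows "emeasure \<mu> A = (\<integral>\<^sup>+z\<in>snd c ` A. ennreal (sqrt (det (metric M c z))) \<partial>lborel)"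
  using assms volume by (simp add: riemannian_volume_def)

lemma openin_sets:
  assumes "mopen M V"
  shows "V \<in> sets \<mu>"
proof -
  obtain X where "open X" "V = points M \<inter> X"
    using assms unfolding openin_open by blast
  then show ?thesis
    unfolding sets_\<mu> sets_restrict_space by simp
qed

lemma charts_top_chart: "c \<in> charts M \<Longrightarrow> top_chart (points M) c"
  by (rule riemannian_manifoldD(1)[OF manifold])

lemma measurable_continuous_on:
  assumes "V \<in> sets \<mu>" "continuous_on V g"
  shows "g \<in> borel_measurable (restrict_space \<mu> V)"
proof -
  have V: "V \<subseteq> points M"
    using sets.sets_into_space[OF assms(1)] by simp
  have "sets (restrict_space \<mu> V) = sets (restrict_space borel V)"
    using V by (auto simp: sets_restrict_space sets_\<mu> image_image Int_assoc[symmetric] Int_absorb2)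
  then show ?thesis
    using borel_measurable_continuous_on_restrict[OF assms(2)] measurable_cong_sets by blast
qed

lemma vimage_sets:
  assumes "V \<in> sets \<mu>" "continuous_on V g" "A \<in> sets borel"
  shows "V \<inter> g -` A \<in> sets \<mu>"
proof -
  have V: "V \<subseteq> points M"
    using sets.sets_into_space[OF assms(1)] by simp
  have "g -` A \<inter> space (restrict_space \<mu> V) \<in> sets (restrict_space \<mu> V)"
    by (rule measurable_sets[OF measurable_continuous_on[OF assms(1,2)] assms(3)])
  then show ?thesis
    using V assms(1) by (simp add: space_restrict_space sets_restrict_space_iff Int_absorb2 Int_commute)
qed

lemma continuous_on_det_metric:
  assumes "c \<in> charts M"
  shows "continuous_on (snd c ` fst c) (\<lambda>z. det (metric M c z))"
  unfolding det_def
  using C_on_imp_continuous_on[OF riemannian_manifoldD(2)[OF manifold assms]]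
  by (intro continuous_intros continuous_on_component)

text \<open>Volume is prescribed only inside charts. Continuity bounds its density on a small
  coordinate ball, and compactness leaves finitely many such pieces. Finiteness is used for Fubini
  and puts continuous functions into \<open>L2\<close>.\<close>

lemma finite_volume: "emeasure \<mu> (points M) < \<infinity>"
proof -
  have loc: "\<exists>E. mopen M E \<and> emeasure \<mu> E < \<infinity> \<and> p \<in> E" if p: "p \<in> points M" for p
  proof -
    obtain c where c: "c \<in> charts M" "p \<in> fst c"
      using riemannian_manifold_cover[OF manifold p] .
    let ?D = "\<lambda>z. sqrt (det (metric M c z))"
    let ?z = "snd c p"
    have "continuous_on (snd c ` fst c) ?D"
      by (intro continuous_intros continuous_on_det_metric c)
    from this[unfolded continuous_on_iff, rule_format, OF imageI[OF c(2)] zero_less_one] obtain r where r: "0 < r" "\<And>w. w \<in> snd c ` fst c \<Longrightarrow> dist w ?z < r \<Longrightarrow> dist (?D w) (?D ?z) < 1"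
      by blast
    let ?E = "fst c \<inter> snd c -` ball ?z r"
    have t: "top_chart (points M) c" by (rule charts_top_chart[OF c(1)])
    have "openin (top_of_set (fst c)) ?E"
      by (intro continuous_openin_preimage_gen top_chartD(4)[OF t]) simp
    then have op: "mopen M ?E"
      using top_chartD(1)[OF t] by (rule openin_trans)
    have "emeasure \<mu> ?E = (\<integral>\<^sup>+z\<in>snd c ` ?E. ennreal (?D z) \<partial>lborel)"
      by (intro emeasure_chart c openin_sets op) auto
    also have "\<dots> \<le> (\<integral>\<^sup>+z. ennreal (\<bar>?D ?z\<bar> + 1) * indicator (ball ?z r) z \<partial>lborel)"
    proof (intro nn_integral_mono)
      fix z
      show "ennreal (?D z) * indicator (snd c ` ?E) z \<le> ennreal (\<bar>?D ?z\<bar> + 1) * indicator (ball ?z r) z"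
      proof (cases "z \<in> snd c ` ?E")
        case True
        then have "?D z \<le> \<bar>?D ?z\<bar> + 1" and z: "z \<in> ball ?z r"
          using r(2)[of z] by (auto simp: dist_real_def dist_commute)
        then have "ennreal (?D z) \<le> ennreal (\<bar>?D ?z\<bar> + 1)"
          by (intro ennreal_leI)
        then show ?thesis
          using True z by (simp add: indicator_def del: ennreal_plus)
      qed simp
    qed
    also have "\<dots> = ennreal (\<bar>?D ?z\<bar> + 1) * emeasure lborel (ball ?z r)"
      by (simp add: nn_integral_cmult_indicator)
    also have "\<dots> < \<infinity>"
      using emeasure_lborel_ball_finite[of ?z r] by (simp add: ennreal_mult_less_top)
    finally show ?thesis
      using op c(2) r(1) by (intro exI[of _ ?E]) auto
  qed
  let ?C = "{E. mopen M E \<and> emeasure \<mu> E < \<infinity>}"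
  have "points M \<subseteq> \<Union>?C"
    using loc by blast
  then obtain D where D: "D \<subseteq> ?C" "finite D" "points M \<subseteq> \<Union>D"
    using compact_points[unfolded compact_eq_openin_cover, rule_format, of ?C] by blast
  have "\<Union>D \<subseteq> points M"
    using D(1) openin_imp_subset by blast
  then have "emeasure \<mu> (points M) = emeasure \<mu> (\<Union>E\<in>D. E)"
    using D(3) by (simp add: subset_antisym)
  also have "\<dots> \<le> (\<Sum>E\<in>D. emeasure \<mu> E)"
    using D openin_sets by (intro emeasure_subadditive_finite) auto
  also have "\<dots> < \<infinity>"
    using D(1,2) by (simp add: subset_iff)
  finally show ?thesis .
qed

sublocale finite_measure \<mu>
  by (rule finite_measureI) (use finite_volume in simp)

text \<open>The coordinates of boundary points lie on the hyperplane bounding the half-space model,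
  a Lebesgue null set.\<close>

lemma emeasure_boundary:
  assumes c: "c \<in> charts M"
  shows "fst c - chart_interior c \<in> sets \<mu>" "emeasure \<mu> (fst c - chart_interior c) = 0"
proof -
  have t: "top_chart (points M) c" by (rule charts_top_chart[OF c])
  show sets: "fst c - chart_interior c \<in> sets \<mu>"
    by (intro sets.Diff openin_sets openin_chart_interior top_chartD(1) t)
  obtain H where H: "model_space H" "openin (top_of_set H) (snd c ` fst c)"
    using riemannian_manifoldD(4)[OF manifold c] by blast
  obtain X where X: "open X" "snd c ` fst c = H \<inter> X"
    using H(2) by (auto simp: openin_open)
  have "interior (snd c ` fst c) = interior H \<inter> X"
    using X by (simp add: interior_open)
  then have sub: "snd c ` (fst c - chart_interior c) \<subseteq> H - interior H"
    using X(2) by (auto simp: chart_interior_def)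
  obtain K where K: "closed K" "emeasure lborel K = 0" "H - interior H \<subseteq> K"
  proof (cases "H = UNIV")
    case True
    then show ?thesis using that[of "{}"] by simp
  next
    case False
    then obtain a b where ab: "a \<noteq> 0" "H = {z. a \<bullet> z \<le> b}"
      using H(1) by (auto simp: model_space_def)
    let ?K = "{z. a \<bullet> z = b}"
    have "?K \<in> null_sets lebesgue"
      using negligible_hyperplane[of a b] ab(1) by (simp add: negligible_iff_null_sets)
    moreover have cl: "closed ?K"
      by (rule closed_hyperplane)
    ultimately have "emeasure lborel ?K = 0"
      by (auto simp: null_sets_def)
    then show ?thesis
      using ab cl by (intro that[of ?K]) auto
  qed
  have "K \<in> null_sets lborel"
    using K by (auto simp: null_sets_def)
  then have "AE z in lborel. z \<notin> K"
    by (rule AE_not_in)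
  then have "AE z in lborel. ennreal (sqrt (det (metric M c z))) * indicator (snd c ` (fst c - chart_interior c)) z = 0"
    by eventually_elim (use sub K(3) in \<open>auto simp: indicator_def\<close>)
  then have "(\<integral>\<^sup>+z\<in>snd c ` (fst c - chart_interior c). ennreal (sqrt (det (metric M c z))) \<partial>lborel) = (\<integral>\<^sup>+z. 0 \<partial>(lborel :: (real^'n) measure))"
    by (rule nn_integral_cong_AE)
  then show "emeasure \<mu> (fst c - chart_interior c) = 0"
    by (subst emeasure_chart[OF c sets]) auto
qed

text \<open>The area formula for the transition map: the metric is the Gram matrix of its Jacobian,
  so the Riemannian density is the absolute Jacobian determinant and becomes 1 in flat
  coordinates.\<close>

lemma emeasure_flat:
  assumes d: "flat_coordinates M d" and c: "c \<in> charts M"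
    and E: "E \<in> sets \<mu>" "E \<subseteq> fst d \<inter> chart_interior c"
  shows "snd d ` E \<in> sets borel" "emeasure \<mu> E = emeasure lborel (snd d ` E)"
proof -
  let ?V = "fst d \<inter> chart_interior c" and ?\<Phi> = "snd d \<circ> cinv c"
  have tc: "top_chart (points M) c" and td: "top_chart (points M) d"
    using charts_top_chart[OF c] flat_top_chart[OF d] by auto
  have op: "mopen M ?V"
    by (intro openin_Int top_chartD(1)[OF td] openin_chart_interior[OF tc])
  note ft = flat_transition[OF manifold d c op order_refl]
  have Vc: "?V \<subseteq> fst c"
    using chart_interior_subset[of c] by auto
  have inv: "cinv c (snd c p) = p" if "p \<in> ?V" for p
    using Vc that tc by auto
  have E': "E \<in> sets (restrict_space borel (points M))"
    using E(1) by (simp add: sets_\<mu>)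
  show dE: "snd d ` E \<in> sets borel"
    by (rule sets_image_chart[OF td ft(2) _ E' E(2)]) simp
  have cE: "snd c ` E \<in> sets borel"
    by (rule sets_image_chart[OF tc ft(1) Vc E' E(2)])
  have cES: "snd c ` E \<subseteq> snd c ` ?V"
    using E(2) by auto
  let ?J = "\<lambda>z. matrix (frechet_derivative ?\<Phi> (at z))"
  have detJ: "\<bar>det (?J z)\<bar> = sqrt (det (metric M c z))" if "z \<in> snd c ` ?V" for z
    using ft(4)[OF that] by (simp add: det_mul real_sqrt_mult_self flip: Defs.jacobian_def)
  have ind: "indicator (snd c ` E) z * \<bar>det (?J z)\<bar> = indicator (snd c ` E) z * (indicator (snd c ` ?V) z *\<^sub>R sqrt (det (metric M c z)))" for z
    using detJ[of z] cES by (auto simp: indicator_def)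
  have "continuous_on (snd c ` ?V) (\<lambda>z. sqrt (det (metric M c z)))"
    using Vc by (intro continuous_intros continuous_on_subset[OF continuous_on_det_metric[OF c]]) auto
  then have [measurable]: "(\<lambda>z. indicator (snd c ` ?V) z *\<^sub>R sqrt (det (metric M c z))) \<in> borel_measurable borel"
    using ft(1) by (intro borel_measurable_continuous_on_indicator) auto
  have eq: "(\<integral>\<^sup>+z. ennreal (indicator (snd c ` E) z * \<bar>det (?J z)\<bar>) \<partial>lborel) = emeasure \<mu> E"
  proof -
    have "emeasure \<mu> E = (\<integral>\<^sup>+z\<in>snd c ` E. ennreal (sqrt (det (metric M c z))) \<partial>lborel)"
      using E Vc by (intro emeasure_chart c) auto
    also have "\<dots> = (\<integral>\<^sup>+z. ennreal (indicator (snd c ` E) z * \<bar>det (?J z)\<bar>) \<partial>lborel)"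
      using detJ cES by (intro nn_integral_cong) (auto simp: indicator_def)
    finally show ?thesis ..
  qed
  have diff: "?\<Phi> differentiable at z" if "z \<in> snd c ` ?V" for z
    by (intro differentiable_vec cont_diff_Suc_differentiable[OF ft(3) ft(1) that])
  have "emeasure lborel (?\<Phi> ` (snd c ` E)) = (\<integral>\<^sup>+z. ennreal (indicator (snd c ` E) z * \<bar>det (?J z)\<bar>) \<partial>lborel)"
  proof (rule emeasure_differentiable_image[OF cE])
    show "(?\<Phi> has_derivative frechet_derivative ?\<Phi> (at z)) (at z within snd c ` E)" if "z \<in> snd c ` E" for z
      by (rule has_derivative_at_withinI, rule frechet_derivative_works[THEN iffD1], rule diff, rule subsetD[OF cES that])
    show "inj_on ?\<Phi> (snd c ` E)"
      by (rule inj_on_subset[OF ft(6) cES])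
    have "?\<Phi> ` snd c ` E = snd d ` E"
      using inv E(2) by (auto simp: image_image subset_iff cong: image_cong)
    then show "?\<Phi> ` snd c ` E \<in> sets borel"
      using dE by simp
    show "(\<lambda>z. indicator (snd c ` E) z * \<bar>det (?J z)\<bar>) \<in> borel_measurable borel"
      unfolding ind using cE by measurable
    \<comment> \<open>The integral equals \<open>emeasure \<mu> E\<close>, which is finite because
      the total volume is.\<close>
    show "(\<integral>\<^sup>+z. ennreal (indicator (snd c ` E) z * \<bar>det (?J z)\<bar>) \<partial>lborel) < \<infinity>"
      unfolding eq by (simp add: less_top[symmetric])
  qed
  moreover have "?\<Phi> ` (snd c ` E) = snd d ` E"
    using inv E(2) by (auto simp: image_image subset_iff cong: image_cong)
  ultimately show "emeasure \<mu> E = emeasure lborel (snd d ` E)"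
    using eq by simp
qed

text \<open>A flat domain need not fit into one chart. The set is cut along finitely many chart
  interiors, and injectivity of \<open>snd d\<close> keeps the images of the pieces
  disjoint.\<close>

lemma emeasure_flat_UN:
  assumes d: "flat_coordinates M d" and C: "finite C" "C \<subseteq> charts M"
    and E: "E \<in> sets \<mu>" "E \<subseteq> fst d \<inter> (\<Union>c\<in>C. chart_interior c)"
  shows "snd d ` E \<in> sets borel \<and> emeasure \<mu> E = emeasure lborel (snd d ` E)"
  using C E
proof (induction C arbitrary: E rule: finite_induct)
  case (insert c C)
  have td: "top_chart (points M) d"
    by (rule flat_top_chart[OF d])
  have tc: "top_chart (points M) c"
    using charts_top_chart insert.prems by simp
  let ?A = "E \<inter> chart_interior c" and ?B = "E - chart_interior c"
  have AB: "?A \<in> sets \<mu>" "?B \<in> sets \<mu>"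
    using insert.prems openin_sets[OF openin_chart_interior[OF tc]] by auto
  have A: "snd d ` ?A \<in> sets borel" "emeasure \<mu> ?A = emeasure lborel (snd d ` ?A)"
    using emeasure_flat[OF d _ AB(1), of c] insert.prems by auto
  have B: "snd d ` ?B \<in> sets borel" "emeasure \<mu> ?B = emeasure lborel (snd d ` ?B)"
    using insert.IH[OF _ AB(2)] insert.prems by auto
  have E: "?A \<union> ?B = E" by auto
  have dE: "snd d ` E = snd d ` ?A \<union> snd d ` ?B" by auto
  have disj: "snd d ` ?A \<inter> snd d ` ?B = {}"
    using top_chartD(6)[OF td] insert.prems(3) by (auto dest!: inj_onD)
  have "emeasure \<mu> E = emeasure \<mu> ?A + emeasure \<mu> ?B"
  proof -
    have "?A \<inter> ?B = {}" by auto
    from plus_emeasure[OF AB this] show ?thesis unfolding E ..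
  qed
  also have "\<dots> = emeasure lborel (snd d ` E)"
    unfolding A(2) B(2) dE using A(1) B(1) disj by (intro plus_emeasure) auto
  finally show ?case
    using A(1) B(1) dE by auto
qed auto

text \<open>An inequality only, since \<open>A\<close> may extend beyond the image of
  \<open>snd d\<close>; in return it covers the whole flat domain. By compactness finitely many
  charts suffice, and the part of the domain outside their interiors is null.\<close>

lemma emeasure_flat_le:
  assumes d: "flat_coordinates M d" and A: "A \<in> sets borel"
  shows "emeasure \<mu> (fst d \<inter> snd d -` A) \<le> emeasure lborel A"
proof -
  have td: "top_chart (points M) d"
    by (rule flat_top_chart[OF d])
  have "\<forall>U\<in>fst ` charts M. mopen M U"
    using top_chartD(1)[OF charts_top_chart] by blast
  moreover have "points M \<subseteq> \<Union>(fst ` charts M)"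
    using riemannian_manifold_cover[OF manifold] by blast
  ultimately obtain D where D: "D \<subseteq> fst ` charts M" "finite D" "points M \<subseteq> \<Union>D"
    using compact_points[unfolded compact_eq_openin_cover, rule_format, of "fst ` charts M"] by blast
  obtain C where C: "finite C" "C \<subseteq> charts M" "D = fst ` C"
    using finite_subset_image[OF D(2,1)] by blast
  let ?I = "\<Union>c\<in>C. chart_interior c" and ?E = "fst d \<inter> snd d -` A"
  have I: "?I \<in> sets \<mu>"
    using C(1,2) openin_sets openin_chart_interior[OF charts_top_chart] by (intro sets.finite_UN) auto
  have E: "?E \<in> sets \<mu>"
    by (intro vimage_sets openin_sets top_chartD[OF td] A)
  have "?E - ?I \<subseteq> (\<Union>c\<in>C. fst c - chart_interior c)"
    using D(3) C(3) top_chartD(3)[OF td] by blast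
  then have "emeasure \<mu> (?E - ?I) \<le> emeasure \<mu> (\<Union>c\<in>C. fst c - chart_interior c)"
    using emeasure_boundary C by (intro emeasure_mono sets.finite_UN) auto
  also have "\<dots> \<le> (\<Sum>c\<in>C. emeasure \<mu> (fst c - chart_interior c))"
    using emeasure_boundary C by (intro emeasure_subadditive_finite) auto
  also have "\<dots> = 0"
    using emeasure_boundary C by (intro sum.neutral) auto
  finally have "emeasure \<mu> (?E - ?I) = 0" by simp
  moreover have "emeasure \<mu> ?E = emeasure \<mu> (?E \<inter> ?I) + emeasure \<mu> (?E - ?I)"
    using E I by (subst plus_emeasure) (auto intro!: arg_cong[where f="emeasure \<mu>"])
  ultimately have "emeasure \<mu> ?E = emeasure \<mu> (?E \<inter> ?I)" by simp
  also have "\<dots> = emeasure lborel (snd d ` (?E \<inter> ?I))"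
    using emeasure_flat_UN[OF d C(1,2), of "?E \<inter> ?I"] E I by auto
  also have "\<dots> \<le> emeasure lborel A"
    using A by (intro emeasure_mono) auto
  finally show ?thesis .
qed

lemma measurable_flat:
  assumes "top_chart (points M) d" "V \<in> sets \<mu>" "V \<subseteq> fst d"
  shows "snd d \<in> restrict_space \<mu> V \<rightarrow>\<^sub>M borel"
  using assms by (intro measurable_continuous_on continuous_on_subset[OF top_chartD(4)])

lemma nn_integral_flat_le:
  assumes d: "flat_coordinates M d" and F: "F \<in> borel_measurable borel"
  shows "(\<integral>\<^sup>+y. F (snd d y) * indicator (fst d) y \<partial>\<mu>) \<le> (\<integral>\<^sup>+z. F z \<partial>lborel)"
proof -
  have td: "top_chart (points M) d"
    by (rule flat_top_chart[OF d])
  have V: "fst d \<in> sets \<mu>" "fst d \<inter> space \<mu> = fst d"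
    using openin_sets[OF top_chartD(1)[OF td]] top_chartD(3)[OF td] by auto
  have m: "snd d \<in> restrict_space \<mu> (fst d) \<rightarrow>\<^sub>M borel"
    by (rule measurable_flat[OF td V(1) order_refl])
  have "(\<integral>\<^sup>+y. F (snd d y) * indicator (fst d) y \<partial>\<mu>) = (\<integral>\<^sup>+y. F (snd d y) \<partial>restrict_space \<mu> (fst d))"
    using V by (subst nn_integral_restrict_space) auto
  also have "\<dots> = (\<integral>\<^sup>+z. F z \<partial>distr (restrict_space \<mu> (fst d)) borel (snd d))"
    using m F by (subst nn_integral_distr) auto
  also have "\<dots> \<le> (\<integral>\<^sup>+z. F z \<partial>lborel)"
  proof (rule nn_integral_mono_measure)
    show "distr (restrict_space \<mu> (fst d)) borel (snd d) \<le> lborel"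
    proof (subst le_measure, simp, intro ballI)
      fix A assume "A \<in> sets (distr (restrict_space \<mu> (fst d)) borel (snd d))"
      then have A: "A \<in> sets borel" by simp
      have "emeasure (distr (restrict_space \<mu> (fst d)) borel (snd d)) A = emeasure \<mu> (fst d \<inter> snd d -` A)"
        using V m A by (simp add: emeasure_distr space_restrict_space emeasure_restrict_space Int_commute)
      then show "emeasure (distr (restrict_space \<mu> (fst d)) borel (snd d)) A \<le> emeasure lborel A"
        using emeasure_flat_le[OF d A] by simp
    qed
  qed simp
  finally show ?thesis .
qed

text \<open>Inside one chart interior the pushforward of the volume is exactly Lebesgue measure on
  the open image, so integrals can be moved to flat coordinates with equality.\<close>

lemma integral_flat:
  fixes F :: "real^'n \<Rightarrow> real"
  assumes d: "flat_coordinates M d" and c: "c \<in> charts M"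
    and V: "mopen M V" "V \<subseteq> fst d \<inter> chart_interior c"
    and F: "F \<in> borel_measurable borel"
  shows "(LINT y|\<mu>. indicator V y * F (snd d y)) = (LINT z|lborel. indicator (snd d ` V) z * F z)"
proof -
  have td: "top_chart (points M) d"
    by (rule flat_top_chart[OF d])
  have V': "V \<in> sets \<mu>" "V \<inter> space \<mu> = V" "V \<subseteq> fst d"
    using openin_sets[OF V(1)] openin_imp_subset[OF V(1)] V(2) by auto
  have m: "snd d \<in> restrict_space \<mu> V \<rightarrow>\<^sub>M borel"
    by (rule measurable_flat[OF td V'(1,3)])
  have op: "open (snd d ` V)"
    by (rule flat_transition(2)[OF manifold d c V])
  have eq: "distr (restrict_space \<mu> V) borel (snd d) = density lborel (\<lambda>z. ennreal (indicator (snd d ` V) z))"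
  proof (rule measure_eqI)
    fix A assume "A \<in> sets (distr (restrict_space \<mu> V) borel (snd d))"
    then have A: "A \<in> sets borel" by simp
    have E: "V \<inter> snd d -` A \<in> sets \<mu>"
      using V' by (intro vimage_sets continuous_on_subset[OF top_chartD(4)[OF td]] A)
    have "emeasure (distr (restrict_space \<mu> V) borel (snd d)) A = emeasure \<mu> (V \<inter> snd d -` A)"
      using V' m A by (simp add: emeasure_distr space_restrict_space emeasure_restrict_space Int_commute)
    also have "\<dots> = emeasure lborel (snd d ` (V \<inter> snd d -` A))"
      using V(2) by (intro emeasure_flat(2)[OF d c E]) auto
    also have "snd d ` (V \<inter> snd d -` A) = snd d ` V \<inter> A" by auto
    also have "emeasure lborel (snd d ` V \<inter> A) = emeasure (density lborel (\<lambda>z. ennreal (indicator (snd d ` V) z))) A"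
      using A op by (subst emeasure_density) (auto simp: nn_integral_indicator[symmetric] ennreal_indicator indicator_inter_arith[symmetric] simp del: nn_integral_indicator)
    finally show "emeasure (distr (restrict_space \<mu> V) borel (snd d)) A =
      emeasure (density lborel (\<lambda>z. ennreal (indicator (snd d ` V) z))) A" .
  qed simp
  have "(LINT y|\<mu>. indicator V y * F (snd d y)) = (LINT y|restrict_space \<mu> V. F (snd d y))"
    using V' by (subst integral_restrict_space) auto
  also have "\<dots> = (LINT z|distr (restrict_space \<mu> V) borel (snd d). F z)"
    using m F by (subst integral_distr) auto
  also have "\<dots> = (LINT z|lborel. indicator (snd d ` V) z * F z)"
    unfolding eq using op F by (subst integral_density) auto
  finally show ?thesis .
qed

lemma emeasure_open_pos:
  assumes d: "flat_coordinates M d" and c: "c \<in> charts M"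
    and V: "mopen M V" "V \<subseteq> fst d \<inter> chart_interior c" "V \<noteq> {}"
  shows "0 < emeasure \<mu> V"
proof -
  have op: "open (snd d ` V)"
    by (rule flat_transition(2)[OF manifold d c V(1,2)])
  have "emeasure \<mu> V = emeasure lborel (snd d ` V)"
    by (rule emeasure_flat(2)[OF d c openin_sets[OF V(1)] V(2)])
  moreover have "emeasure lborel (snd d ` V) \<noteq> 0"
  proof
    assume "emeasure lborel (snd d ` V) = 0"
    then have "snd d ` V \<in> null_sets lborel"
      using op by (auto simp: null_sets_def)
    then have "negligible (snd d ` V)"
      by (simp add: negligible_iff_null_sets null_sets_completionI)
    then show False
      using open_not_negligible[OF op] V(3) by simp
  qed
  ultimately show ?thesis
    by (simp add: zero_less_iff_neq_zero)
qed

end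

section \<open>Adjoints of integral operators\<close>

lemma L2D: "u \<in> L2 \<mu> \<Longrightarrow> u \<in> borel_measurable \<mu>" "u \<in> L2 \<mu> \<Longrightarrow> integrable \<mu> (\<lambda>y. (u y)\<^sup>2)"
  by (auto simp: L2_def)

lemma abs_mult_le_sum_squares: "\<bar>a * b\<bar> \<le> a\<^sup>2 + (b::real)\<^sup>2"
proof -
  have "2 * \<bar>a * b\<bar> \<le> a\<^sup>2 + b\<^sup>2"
    using sum_squares_bound[of "\<bar>a\<bar>" "\<bar>b\<bar>"] by (simp add: abs_mult mult.assoc)
  then show ?thesis by linarith
qed

lemma L2_integrable_mult:
  assumes "u \<in> L2 \<mu>" "v \<in> L2 \<mu>"
  shows "integrable \<mu> (\<lambda>y. u y * v y)"
proof (rule Bochner_Integration.integrable_bound)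
  show "integrable \<mu> (\<lambda>y. (u y)\<^sup>2 + (v y)\<^sup>2)"
    using assms by (auto simp: L2_def)
  show "(\<lambda>y. u y * v y) \<in> borel_measurable \<mu>"
    using assms by (auto simp: L2_def)
  show "AE y in \<mu>. norm (u y * v y) \<le> norm ((u y)\<^sup>2 + (v y)\<^sup>2)"
    using abs_mult_le_sum_squares[of "u _" "v _"] by simp
qed

lemma L2_diff:
  assumes "u \<in> L2 \<mu>" "v \<in> L2 \<mu>"
  shows "(\<lambda>y. u y - v y) \<in> L2 \<mu>"
proof -
  have "integrable \<mu> (\<lambda>y. (u y)\<^sup>2 + (v y)\<^sup>2 - 2 * (u y * v y))"
    using assms L2_integrable_mult[OF assms] by (auto simp: L2_def)
  then have "integrable \<mu> (\<lambda>y. (u y - v y)\<^sup>2)"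
    by (simp add: power2_diff algebra_simps)
  then show ?thesis
    using assms by (auto simp: L2_def)
qed

text \<open>Testing both adjoints against the difference \<open>w\<close> of their values shows that
  the square of \<open>w\<close> has integral 0.\<close>

lemma is_L2_adjoint_AE_unique:
  assumes "is_L2_adjoint \<mu> \<nu> A B" "is_L2_adjoint \<mu> \<nu> A B'" "v \<in> L2 \<nu>"
  shows "AE x in \<mu>. B v x = B' v x"
proof -
  have B: "B v \<in> L2 \<mu>" "B' v \<in> L2 \<mu>"
    using assms by (auto simp: is_L2_adjoint_def)
  define w where "w x = B v x - B' v x" for x
  have w: "w \<in> L2 \<mu>"
    unfolding w_def[abs_def] by (rule L2_diff[OF B])
  have "(LINT x|\<mu>. w x * B v x) = (LINT x|\<mu>. w x * B' v x)"
    using assms w by (auto simp: is_L2_adjoint_def)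
  then have "(LINT x|\<mu>. w x * B v x - w x * B' v x) = 0"
    using L2_integrable_mult[OF w B(1)] L2_integrable_mult[OF w B(2)] by simp
  then have "(LINT x|\<mu>. (w x)\<^sup>2) = 0"
    by (simp add: w_def power2_eq_square algebra_simps)
  then have "AE x in \<mu>. (w x)\<^sup>2 = 0"
    using L2D(2)[OF w] by (subst (asm) integral_nonneg_eq_0_iff_AE) auto
  then show ?thesis
    by (auto simp: w_def)
qed

lemma is_L2_adjoint_compose:
  assumes "is_L2_adjoint \<mu> \<nu> A B" "is_L2_adjoint \<nu> \<rho> A' B'"
  shows "is_L2_adjoint \<mu> \<rho> (\<lambda>u. A' (A u)) (\<lambda>v. B (B' v))"
  using assms by (auto simp: is_L2_adjoint_def)

text \<open>The setting of Schur's test. In the application the coordinates depend on the first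
  argument of the kernel, which is then not symmetric; rows and columns need separate bounds, and
  the transposed kernel is treated as another instance.\<close>

locale schur_kernel = sigma_finite_measure \<mu> for \<mu> :: "'a measure" +
  fixes K :: "'a \<Rightarrow> 'a \<Rightarrow> real" and C :: real
  assumes K_measurable [measurable]: "case_prod K \<in> borel_measurable (\<mu> \<Otimes>\<^sub>M \<mu>)"
    and K_nonneg: "0 \<le> K p y" and C_pos: "0 < C"
    and rows: "p \<in> space \<mu> \<Longrightarrow> (\<integral>\<^sup>+y. ennreal (K p y) \<partial>\<mu>) \<le> ennreal C"
    and cols: "y \<in> space \<mu> \<Longrightarrow> (\<integral>\<^sup>+p. ennreal (K p y) \<partial>\<mu>) \<le> ennreal C"
begin

sublocale pair_sigma_finite \<mu> \<mu> ..

definition K_op :: "('a \<Rightarrow> real) \<Rightarrow> 'a \<Rightarrow> real" where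
  "K_op f p = (LINT y|\<mu>. K p y * f y)"

lemma schur_transpose: "schur_kernel \<mu> (\<lambda>p y. K y p) C"
proof unfold_locales
  have "(\<lambda>x. case_prod K (snd x, fst x)) \<in> borel_measurable (\<mu> \<Otimes>\<^sub>M \<mu>)"
    by measurable
  then show "(\<lambda>(p, y). K y p) \<in> borel_measurable (\<mu> \<Otimes>\<^sub>M \<mu>)"
    by (simp add: case_prod_beta')
qed (use K_nonneg C_pos rows cols in auto)

lemma nn_integral_square_le:
  assumes [measurable]: "u \<in> borel_measurable \<mu>"
  shows "(\<integral>\<^sup>+p. \<integral>\<^sup>+y. ennreal (K p y * (u y)\<^sup>2) \<partial>\<mu> \<partial>\<mu>) \<le> ennreal C * (\<integral>\<^sup>+y. ennreal ((u y)\<^sup>2) \<partial>\<mu>)"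
proof -
  have "(\<integral>\<^sup>+p. \<integral>\<^sup>+y. ennreal (K p y * (u y)\<^sup>2) \<partial>\<mu> \<partial>\<mu>) = (\<integral>\<^sup>+y. \<integral>\<^sup>+p. ennreal (K p y * (u y)\<^sup>2) \<partial>\<mu> \<partial>\<mu>)"
    by (rule Fubini'[symmetric]) measurable
  also have "\<dots> = (\<integral>\<^sup>+y. (\<integral>\<^sup>+p. ennreal (K p y) \<partial>\<mu>) * ennreal ((u y)\<^sup>2) \<partial>\<mu>)"
    by (intro nn_integral_cong) (simp add: ennreal_mult K_nonneg nn_integral_multc)
  also have "\<dots> \<le> (\<integral>\<^sup>+y. ennreal C * ennreal ((u y)\<^sup>2) \<partial>\<mu>)"
    by (intro nn_integral_mono mult_right_mono cols) auto
  finally show ?thesis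
    by (simp add: nn_integral_cmult)
qed

text \<open>Cauchy--Schwarz for the weight \<open>K p\<close>, obtained from the nonnegativity of
  \<open>\<integral>K p (\<bar>u\<bar> - a/C)\<^sup>2\<close> with \<open>a = \<integral>K p \<bar>u\<bar>\<close>.\<close>

lemma K_op_square_le:
  assumes [measurable]: "u \<in> borel_measurable \<mu>" and p: "p \<in> space \<mu>"
  shows "ennreal ((K_op u p)\<^sup>2) \<le> ennreal C * (\<integral>\<^sup>+y. ennreal (K p y * (u y)\<^sup>2) \<partial>\<mu>)"
proof (cases "(\<integral>\<^sup>+y. ennreal (K p y * (u y)\<^sup>2) \<partial>\<mu>) = \<infinity>")
  case True
  then show ?thesis using C_pos by (simp add: ennreal_mult_top)
next
  case False
  have [measurable]: "K p \<in> borel_measurable \<mu>"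
    using measurable_compose[OF measurable_Pair1'[OF p] K_measurable] by simp
  have i2: "integrable \<mu> (\<lambda>y. K p y * (u y)\<^sup>2)"
    using False K_nonneg by (intro integrableI_nonneg) (auto simp: less_top)
  have i0: "integrable \<mu> (K p)"
    using rows[OF p] K_nonneg by (intro integrableI_nonneg) (auto intro: order_le_less_trans)
  have i1: "integrable \<mu> (\<lambda>y. K p y * \<bar>u y\<bar>)"
  proof (rule Bochner_Integration.integrable_bound)
    show "integrable \<mu> (\<lambda>y. K p y + K p y * (u y)\<^sup>2)"
      using i0 i2 by auto
    have "\<bar>a\<bar> \<le> 1 + a\<^sup>2" for a :: real
      using sum_squares_bound[of "\<bar>a\<bar>" 1] by simp
    then have "K p y * \<bar>u y\<bar> \<le> K p y * (1 + (u y)\<^sup>2)" for y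
      by (intro mult_left_mono K_nonneg)
    then show "AE y in \<mu>. norm (K p y * \<bar>u y\<bar>) \<le> norm (K p y + K p y * (u y)\<^sup>2)"
      using K_nonneg[of p] by (simp add: abs_mult algebra_simps)
  qed measurable
  have K1: "(LINT y|\<mu>. K p y) \<le> C"
  proof -
    have "ennreal (LINT y|\<mu>. K p y) \<le> ennreal C"
      using rows[OF p] nn_integral_eq_integral[OF i0] K_nonneg by simp
    then show ?thesis using C_pos by (simp add: ennreal_le_iff)
  qed
  define a where "a = (LINT y|\<mu>. K p y * \<bar>u y\<bar>)"
  have "0 \<le> (LINT y|\<mu>. K p y * (\<bar>u y\<bar> - a / C)\<^sup>2)"
    using K_nonneg by (intro Bochner_Integration.integral_nonneg) auto
  also have "(\<lambda>y. K p y * (\<bar>u y\<bar> - a / C)\<^sup>2) = (\<lambda>y. K p y * (u y)\<^sup>2 - 2 * a / C * (K p y * \<bar>u y\<bar>) + (a / C)\<^sup>2 * K p y)"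
    by (auto simp: power2_diff algebra_simps)
  also have "(LINT y|\<mu>. K p y * (u y)\<^sup>2 - 2 * a / C * (K p y * \<bar>u y\<bar>) + (a / C)\<^sup>2 * K p y)
      = (LINT y|\<mu>. K p y * (u y)\<^sup>2) - 2 * a / C * a + (a / C)\<^sup>2 * (LINT y|\<mu>. K p y)"
    using i0 i1 i2 by (simp add: a_def)
  also have "\<dots> \<le> (LINT y|\<mu>. K p y * (u y)\<^sup>2) - 2 * a / C * a + (a / C)\<^sup>2 * C"
    using K1 by (intro add_left_mono mult_left_mono) auto
  also have "\<dots> = (LINT y|\<mu>. K p y * (u y)\<^sup>2) - a\<^sup>2 / C"
    using C_pos by (simp add: power2_eq_square field_simps)
  finally have a: "a\<^sup>2 \<le> C * (LINT y|\<mu>. K p y * (u y)\<^sup>2)"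
    using C_pos by (simp add: field_simps)
  have "\<bar>K_op u p\<bar> \<le> (LINT y|\<mu>. norm (K p y * u y))"
    unfolding K_op_def using integral_norm_bound[of \<mu> "\<lambda>y. K p y * u y"] by simp
  also have "\<dots> = a"
    using K_nonneg by (simp add: a_def abs_mult)
  finally have "(K_op u p)\<^sup>2 \<le> a\<^sup>2"
    using power_mono[of "\<bar>K_op u p\<bar>" a 2] by simp
  then have "ennreal ((K_op u p)\<^sup>2) \<le> ennreal (C * (LINT y|\<mu>. K p y * (u y)\<^sup>2))"
    using a by (intro ennreal_leI) simp
  also have "\<dots> = ennreal C * (\<integral>\<^sup>+y. ennreal (K p y * (u y)\<^sup>2) \<partial>\<mu>)"
    using C_pos K_nonneg by (subst nn_integral_eq_integral[OF i2]) (auto simp: ennreal_mult intro!: Bochner_Integration.integral_nonneg)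
  finally show ?thesis .
qed

lemma K_op_measurable:
  assumes [measurable]: "u \<in> borel_measurable \<mu>"
  shows "K_op u \<in> borel_measurable \<mu>"
  unfolding K_op_def[abs_def] by measurable

lemma K_op_L2:
  assumes u: "u \<in> L2 \<mu>"
  shows "K_op u \<in> L2 \<mu>"
proof -
  note [measurable] = L2D(1)[OF u] K_op_measurable[OF L2D(1)[OF u]]
  have fin: "(\<integral>\<^sup>+y. ennreal ((u y)\<^sup>2) \<partial>\<mu>) < \<infinity>"
    using L2D(2)[OF u] by (simp add: integrable_iff_bounded)
  have "(\<integral>\<^sup>+p. ennreal ((K_op u p)\<^sup>2) \<partial>\<mu>) \<le> (\<integral>\<^sup>+p. ennreal C * (\<integral>\<^sup>+y. ennreal (K p y * (u y)\<^sup>2) \<partial>\<mu>) \<partial>\<mu>)"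
    by (intro nn_integral_mono K_op_square_le) auto
  also have "\<dots> = ennreal C * (\<integral>\<^sup>+p. \<integral>\<^sup>+y. ennreal (K p y * (u y)\<^sup>2) \<partial>\<mu> \<partial>\<mu>)"
    by (intro nn_integral_cmult) measurable
  also have "\<dots> \<le> ennreal C * (ennreal C * (\<integral>\<^sup>+y. ennreal ((u y)\<^sup>2) \<partial>\<mu>))"
    by (intro mult_left_mono nn_integral_square_le) auto
  also have "\<dots> < \<infinity>"
    using fin by (simp add: ennreal_mult_less_top)
  finally have "integrable \<mu> (\<lambda>p. (K_op u p)\<^sup>2)"
    by (intro integrableI_nonneg) auto
  then show ?thesis
    by (simp add: L2_def)
qed

text \<open>The product \<open>u y * v p\<close> is dominated by the sum of the squares. One square
  is controlled by the column bound, the other by the column bound of the transposed kernel. This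
  justifies Fubini in the adjoint identity.\<close>

lemma integrable_kernel_mult:
  assumes u: "u \<in> L2 \<mu>" and v: "v \<in> L2 \<mu>"
  shows "integrable (\<mu> \<Otimes>\<^sub>M \<mu>) (\<lambda>(p, y). K p y * u y * v p)"
proof -
  note [measurable] = L2D(1)[OF u] L2D(1)[OF v]
  interpret t: schur_kernel \<mu> "\<lambda>p y. K y p" C by (rule schur_transpose)
  have fin: "(\<integral>\<^sup>+y. ennreal ((u y)\<^sup>2) \<partial>\<mu>) < \<infinity>" "(\<integral>\<^sup>+y. ennreal ((v y)\<^sup>2) \<partial>\<mu>) < \<infinity>"
    using L2D(2)[OF u] L2D(2)[OF v] by (simp_all add: integrable_iff_bounded)
  have 1: "integrable (\<mu> \<Otimes>\<^sub>M \<mu>) (\<lambda>(p, y). K p y * (u y)\<^sup>2)"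
  proof (rule integrableI_nonneg)
    have "(\<integral>\<^sup>+x. ennreal (case x of (p, y) \<Rightarrow> K p y * (u y)\<^sup>2) \<partial>(\<mu> \<Otimes>\<^sub>M \<mu>)) = (\<integral>\<^sup>+p. \<integral>\<^sup>+y. ennreal (K p y * (u y)\<^sup>2) \<partial>\<mu> \<partial>\<mu>)"
      by (subst nn_integral_snd[symmetric]) (auto intro!: Fubini')
    also have "\<dots> < \<infinity>"
      using nn_integral_square_le[of u] fin(1) by (auto simp: ennreal_mult_less_top intro: order_le_less_trans)
    finally show "(\<integral>\<^sup>+x. ennreal (case x of (p, y) \<Rightarrow> K p y * (u y)\<^sup>2) \<partial>(\<mu> \<Otimes>\<^sub>M \<mu>)) < \<infinity>" .
  qed (use K_nonneg in auto)
  have 2: "integrable (\<mu> \<Otimes>\<^sub>M \<mu>) (\<lambda>(p, y). K p y * (v p)\<^sup>2)"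
  proof (rule integrableI_nonneg)
    have "(\<integral>\<^sup>+x. ennreal (case x of (p, y) \<Rightarrow> K p y * (v p)\<^sup>2) \<partial>(\<mu> \<Otimes>\<^sub>M \<mu>)) = (\<integral>\<^sup>+y. \<integral>\<^sup>+p. ennreal (K p y * (v p)\<^sup>2) \<partial>\<mu> \<partial>\<mu>)"
      by (subst nn_integral_snd[symmetric]) auto
    also have "\<dots> < \<infinity>"
      using t.nn_integral_square_le[of v] fin(2) by (auto simp: ennreal_mult_less_top intro: order_le_less_trans)
    finally show "(\<integral>\<^sup>+x. ennreal (case x of (p, y) \<Rightarrow> K p y * (v p)\<^sup>2) \<partial>(\<mu> \<Otimes>\<^sub>M \<mu>)) < \<infinity>" .
  qed (use K_nonneg in auto)
  show ?thesis
  proof (rule Bochner_Integration.integrable_bound[OF Bochner_Integration.integrable_add[OF 1 2]])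
    have "K p y * \<bar>u y * v p\<bar> \<le> K p y * ((u y)\<^sup>2 + (v p)\<^sup>2)" for p y
      by (intro mult_left_mono K_nonneg abs_mult_le_sum_squares)
    then show "AE x in \<mu> \<Otimes>\<^sub>M \<mu>. norm (case x of (p, y) \<Rightarrow> K p y * u y * v p)
        \<le> norm ((case x of (p, y) \<Rightarrow> K p y * (u y)\<^sup>2) + (case x of (p, y) \<Rightarrow> K p y * (v p)\<^sup>2))"
      using K_nonneg by (auto simp: abs_mult algebra_simps)
  qed measurable
qed

lemma is_L2_adjoint_K_op: "is_L2_adjoint \<mu> \<mu> K_op (\<lambda>v y. LINT p|\<mu>. K p y * v p)"
proof -
  interpret t: schur_kernel \<mu> "\<lambda>p y. K y p" C by (rule schur_transpose)
  have eq: "(LINT y|\<mu>. K_op u y * v y) = (LINT y|\<mu>. u y * (LINT p|\<mu>. K p y * v p))"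
    if u: "u \<in> L2 \<mu>" and v: "v \<in> L2 \<mu>" for u v
  proof -
    have "(LINT y|\<mu>. u y * (LINT p|\<mu>. K p y * v p)) = (LINT y|\<mu>. (LINT p|\<mu>. K p y * u y * v p))"
      by (intro Bochner_Integration.integral_cong refl, subst integral_mult_right_zero[symmetric]) (simp add: ac_simps)
    also have "\<dots> = (LINT p|\<mu>. (LINT y|\<mu>. K p y * u y * v p))"
      using integrable_kernel_mult[OF u v] by (rule Fubini_integral)
    also have "\<dots> = (LINT p|\<mu>. K_op u p * v p)"
      by (simp add: K_op_def)
    finally show ?thesis ..
  qed
  have "t.K_op = (\<lambda>v y. LINT p|\<mu>. K p y * v p)"
    by (intro ext) (rule t.K_op_def)
  then show ?thesis
    using eq K_op_L2 t.K_op_L2 by (auto simp: is_L2_adjoint_def)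
qed

end

text \<open>Invariance of the volume moves integrals from the target to the source of
  \<open>T\<close>, where \<open>transfer\<close> cancels against composition with
  \<open>T\<close>.\<close>

lemma is_L2_adjoint_transfer:
  assumes T [measurable]: "T \<in> \<mu> \<rightarrow>\<^sub>M \<nu>" and S [measurable]: "inv_into P T \<in> \<nu> \<rightarrow>\<^sub>M \<mu>"
    and P: "space \<mu> = P" "inj_on T P" and \<nu>: "distr \<mu> \<nu> T = \<nu>"
  shows "is_L2_adjoint \<mu> \<nu> (transfer P T) (transfer_adj T)"
proof -
  have ST: "inv_into P T (T y) = y" if "y \<in> space \<mu>" for y
    using that P by (simp add: inv_into_f_f)
  have int: "integrable \<nu> g \<longleftrightarrow> integrable \<mu> (\<lambda>y. g (T y))" "(LINT y|\<nu>. g y) = (LINT y|\<mu>. g (T y))"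
    if [measurable]: "g \<in> borel_measurable \<nu>" for g :: "'b \<Rightarrow> real"
    using integrable_distr_eq[OF T, of g] integral_distr[OF T, of g] that unfolding \<nu> by auto
  show ?thesis
    unfolding is_L2_adjoint_def
  proof (intro conjI ballI)
    fix u assume u: "u \<in> L2 \<mu>"
    note [measurable] = L2D(1)[OF u]
    have "integrable \<mu> (\<lambda>y. (transfer P T u (T y))\<^sup>2) \<longleftrightarrow> integrable \<mu> (\<lambda>y. (u y)\<^sup>2)"
      by (intro Bochner_Integration.integrable_cong refl) (simp add: transfer_def ST)
    then show "transfer P T u \<in> L2 \<nu>"
      using L2D(2)[OF u] int(1)[of "\<lambda>y. (transfer P T u y)\<^sup>2"] by (simp add: L2_def transfer_def)
  next
    fix v assume v: "v \<in> L2 \<nu>"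
    note [measurable] = L2D(1)[OF v]
    show "transfer_adj T v \<in> L2 \<mu>"
      using L2D(2)[OF v] int(1)[of "\<lambda>y. (v y)\<^sup>2"] by (simp add: L2_def transfer_adj_def)
  next
    fix u v assume u: "u \<in> L2 \<mu>" and v: "v \<in> L2 \<nu>"
    note [measurable] = L2D(1)[OF u] L2D(1)[OF v]
    have "(LINT y|\<nu>. transfer P T u y * v y) = (LINT y|\<mu>. transfer P T u (T y) * v (T y))"
      by (rule int(2)) (simp add: transfer_def)
    also have "\<dots> = (LINT y|\<mu>. u y * transfer_adj T v y)"
      by (intro Bochner_Integration.integral_cong refl) (simp add: transfer_def transfer_adj_def ST)
    finally show "(LINT y|\<nu>. transfer P T u y * v y) = (LINT x|\<mu>. u x * transfer_adj T v x)" .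
  qed
qed

section \<open>Diffusion operators near an interior point\<close>

text \<open>The neighbourhood is existential because each diffusion shrinks it. Continuity of
  \<open>h\<close> is recorded since the next average evaluates \<open>h\<close> at shifted
  points.\<close>

definition expands_near ::
    "'a::topological_space set \<Rightarrow> 'a \<Rightarrow> (real \<Rightarrow> 'a \<Rightarrow> real) \<Rightarrow> ('a \<Rightarrow> real) \<Rightarrow> ('a \<Rightarrow> real) \<Rightarrow> bool" where
  "expands_near P x U u h \<longleftrightarrow>
     (\<exists>V. openin (top_of_set P) V \<and> x \<in> V \<and> continuous_on V h \<and> expands V U u h)"

locale diffusion_space = riemannian_volume_space M \<mu> + isotropic_density q \<rho> c
  for M :: "('a::t2_space, 'n::finite) riem" and \<mu> :: "'a measure"
    and q :: "real^'n \<Rightarrow> real" and \<rho> c :: real +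
  fixes \<kappa> :: "'a \<Rightarrow> ('a, 'n) chart"
  assumes rule: "difference_rule M \<kappa>"
begin

lemma finite_rule: "finite (\<kappa> ` points M)"
  using rule by (simp add: difference_rule_def)

lemma rule_flat: "p \<in> points M \<Longrightarrow> flat_coordinates M (\<kappa> p)"
  using rule by (simp add: difference_rule_def)

lemma rule_sets: "d \<in> \<kappa> ` points M \<Longrightarrow> {p \<in> points M. \<kappa> p = d} \<in> sets \<mu>"
  using rule by (auto simp: difference_rule_def sets_\<mu>)

lemma rule_closure: "d \<in> \<kappa> ` points M \<Longrightarrow> closure {p \<in> points M. \<kappa> p = d} \<subseteq> fst d"
  using rule by (auto simp: difference_rule_def)

lemma rule_chart: "p \<in> points M \<Longrightarrow> top_chart (points M) (\<kappa> p)"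
  by (rule flat_top_chart[OF rule_flat])

lemma rule_dom: "p \<in> points M \<Longrightarrow> p \<in> fst (\<kappa> p)"
  using rule_closure[of "\<kappa> p"] closure_subset[of "{p' \<in> points M. \<kappa> p' = \<kappa> p}"] by blast

section \<open>Measurability and mass of the diffusion kernel\<close>

lemma scaled_measurable [measurable]: "scaled_density q \<epsilon> \<in> borel_measurable borel"
  unfolding scaled_density_def[abs_def] by measurable

lemma scaled_nonneg: "0 < \<epsilon> \<Longrightarrow> 0 \<le> scaled_density q \<epsilon> z"
  using q_nonneg by (simp add: scaled_density_def)

lemma scaled_support:
  assumes "0 < \<epsilon>" "scaled_density q \<epsilon> z \<noteq> 0"
  shows "norm z \<le> \<epsilon> * \<rho>"
  using assms q_support[of "z /\<^sub>R \<epsilon>"] by (simp add: scaled_density_def field_simps)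

lemma kernel_nonneg: "0 < \<epsilon> \<Longrightarrow> 0 \<le> diffusion_kernel \<kappa> q \<epsilon> p y"
  by (simp add: diffusion_kernel_def scaled_nonneg)

lemma nn_integral_q: "(\<integral>\<^sup>+v. ennreal (q v) \<partial>lborel) = 1"
  using q_total q_nonneg by (subst nn_integral_eq_integral) (auto simp: has_bochner_integral_iff)

lemma nn_integral_scaled:
  assumes "0 < \<epsilon>"
  shows "(\<integral>\<^sup>+z. ennreal (scaled_density q \<epsilon> (a - z)) \<partial>lborel) = 1"
    and "(\<integral>\<^sup>+z. ennreal (scaled_density q \<epsilon> (z - a)) \<partial>lborel) = 1"
proof -
  have eq: "ennreal (\<epsilon> ^ CARD('n)) * ennreal (q v / \<epsilon> ^ CARD('n)) = ennreal (q v)" for v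
    using assms q_nonneg by (simp add: ennreal_mult[symmetric])
  have "(\<integral>\<^sup>+z. ennreal (scaled_density q \<epsilon> (a - z)) \<partial>lborel) = ennreal (\<epsilon> ^ CARD('n)) * (\<integral>\<^sup>+v. ennreal (q v / \<epsilon> ^ CARD('n)) \<partial>lborel)"
    using assms by (subst lborel_nn_integral_affine[of _ "- \<epsilon>" a]) (auto simp: scaled_density_def)
  also have "\<dots> = 1"
    by (subst nn_integral_cmult[symmetric]) (auto simp: eq nn_integral_q)
  finally show "(\<integral>\<^sup>+z. ennreal (scaled_density q \<epsilon> (a - z)) \<partial>lborel) = 1" .
  have "(\<integral>\<^sup>+z. ennreal (scaled_density q \<epsilon> (z - a)) \<partial>lborel) = ennreal (\<epsilon> ^ CARD('n)) * (\<integral>\<^sup>+v. ennreal (q v / \<epsilon> ^ CARD('n)) \<partial>lborel)"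
    using assms by (subst lborel_nn_integral_affine[of _ \<epsilon> a]) (auto simp: scaled_density_def)
  also have "\<dots> = 1"
    by (subst nn_integral_cmult[symmetric]) (auto simp: eq nn_integral_q)
  finally show "(\<integral>\<^sup>+z. ennreal (scaled_density q \<epsilon> (z - a)) \<partial>lborel) = 1" .
qed

text \<open>The coordinate system jumps with the base point, but it takes finitely many values, each
  on a measurable set, so the kernel is a finite sum of measurable terms. In each term the
  coordinates are extended by 0 outside their domain.\<close>

lemma kernel_measurable: "case_prod (diffusion_kernel \<kappa> q \<epsilon>) \<in> borel_measurable (\<mu> \<Otimes>\<^sub>M \<mu>)"
proof -
  define \<phi> where "\<phi> d p = indicator (fst d) p *\<^sub>R snd d p" for d :: "('a, 'n) chart" and p
  have dom: "fst d \<in> sets \<mu>" if "d \<in> \<kappa> ` points M" for d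
    using openin_sets top_chartD(1) rule_chart that by blast
  have \<phi>m: "\<phi> d \<in> borel_measurable \<mu>" if "d \<in> \<kappa> ` points M" for d
  proof -
    have d: "top_chart (points M) d" using that rule_chart by blast
    have "snd d \<in> borel_measurable (restrict_space \<mu> (fst d))"
      by (rule measurable_continuous_on[OF dom[OF that] top_chartD(4)[OF d]])
    then show ?thesis
      using dom[OF that] sets.sets_into_space[OF dom[OF that]] unfolding \<phi>_def[abs_def]
      by (subst (asm) borel_measurable_restrict_space_iff) (auto simp: Int_absorb2)
  qed
  let ?K = "\<lambda>x. \<Sum>d\<in>\<kappa> ` points M. indicator {p \<in> points M. \<kappa> p = d} (fst x) * indicator (fst d) (snd x)
      * scaled_density q \<epsilon> (\<phi> d (fst x) - \<phi> d (snd x))"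
  have "?K \<in> borel_measurable (\<mu> \<Otimes>\<^sub>M \<mu>)"
  proof (rule borel_measurable_sum)
    fix d assume d: "d \<in> \<kappa> ` points M"
    note [measurable] = \<phi>m[OF d] rule_sets[OF d] dom[OF d]
    show "(\<lambda>x. indicator {p \<in> points M. \<kappa> p = d} (fst x) * indicator (fst d) (snd x)
      * scaled_density q \<epsilon> (\<phi> d (fst x) - \<phi> d (snd x))) \<in> borel_measurable (\<mu> \<Otimes>\<^sub>M \<mu>)"
      by measurable
  qed
  moreover have "?K x = case_prod (diffusion_kernel \<kappa> q \<epsilon>) x" if xs: "x \<in> space (\<mu> \<Otimes>\<^sub>M \<mu>)" for x
  proof -
    obtain p y where x: "x = (p, y)" "p \<in> points M" "y \<in> points M"
      using xs by (cases x) (auto simp: space_pair_measure)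
    have "?K x = indicator (fst (\<kappa> p)) y * scaled_density q \<epsilon> (\<phi> (\<kappa> p) p - \<phi> (\<kappa> p) y)"
      unfolding x fst_conv snd_conv using finite_rule x(2)
      by (subst sum.remove[of _ "\<kappa> p"]) (auto simp: indicator_def intro!: sum.neutral)
    then show ?thesis
      using rule_dom[OF x(2)] by (simp add: x diffusion_kernel_def \<phi>_def indicator_def)
  qed
  ultimately show ?thesis
    using measurable_cong[of "\<mu> \<Otimes>\<^sub>M \<mu>" ?K "case_prod (diffusion_kernel \<kappa> q \<epsilon>)"] by blast
qed

text \<open>A row uses one coordinate system and has mass at most 1. Along a column the base point
  runs through all systems, each contributing at most 1, whence the cardinality. The additional 1
  makes the constant positive in every case.\<close>

lemma schur_kernel_diffusion:
  assumes "0 < \<epsilon>"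
  shows "schur_kernel \<mu> (diffusion_kernel \<kappa> q \<epsilon>) (real (card (\<kappa> ` points M)) + 1)"
proof (intro schur_kernel.intro schur_kernel_axioms.intro)
  show "sigma_finite_measure \<mu>" by unfold_locales
  show "case_prod (diffusion_kernel \<kappa> q \<epsilon>) \<in> borel_measurable (\<mu> \<Otimes>\<^sub>M \<mu>)"
    by (rule kernel_measurable)
  show "0 \<le> diffusion_kernel \<kappa> q \<epsilon> p y" for p y
    by (rule kernel_nonneg[OF assms])
  show "0 < real (card (\<kappa> ` points M)) + 1" by simp
next
  fix p assume p: "p \<in> space \<mu>"
  then have p: "p \<in> points M" by simp
  have "(\<integral>\<^sup>+y. ennreal (diffusion_kernel \<kappa> q \<epsilon> p y) \<partial>\<mu>)
      = (\<integral>\<^sup>+y. ennreal (scaled_density q \<epsilon> (snd (\<kappa> p) p - snd (\<kappa> p) y)) * indicator (fst (\<kappa> p)) y \<partial>\<mu>)"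
    by (intro nn_integral_cong) (simp add: diffusion_kernel_def indicator_def)
  also have "\<dots> \<le> (\<integral>\<^sup>+z. ennreal (scaled_density q \<epsilon> (snd (\<kappa> p) p - z)) \<partial>lborel)"
    by (rule nn_integral_flat_le[OF rule_flat[OF p]]) measurable
  also have "\<dots> = 1"
    by (rule nn_integral_scaled(1)[OF assms])
  also have "\<dots> \<le> ennreal (real (card (\<kappa> ` points M)) + 1)"
    by (simp add: ennreal_1[symmetric] del: ennreal_1 ennreal_plus)
  finally show "(\<integral>\<^sup>+y. ennreal (diffusion_kernel \<kappa> q \<epsilon> p y) \<partial>\<mu>) \<le> ennreal (real (card (\<kappa> ` points M)) + 1)" .
next
  fix y assume "y \<in> space \<mu>"
  then have y: "y \<in> points M" by simp
  let ?g = "\<lambda>d p. ennreal (scaled_density q \<epsilon> (snd d p - snd d y)) * indicator (fst d) p"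
  have m: "?g d \<in> borel_measurable \<mu>" if "d \<in> \<kappa> ` points M" for d
  proof -
    have d: "top_chart (points M) d" using that rule_chart by blast
    have dom: "fst d \<in> sets \<mu>" by (intro openin_sets top_chartD(1) d)
    have "snd d \<in> borel_measurable (restrict_space \<mu> (fst d))"
      by (rule measurable_continuous_on[OF dom top_chartD(4)[OF d]])
    then have "(\<lambda>p. ennreal (scaled_density q \<epsilon> (snd d p - snd d y))) \<in> borel_measurable (restrict_space \<mu> (fst d))"
      by measurable
    then show ?thesis
      using dom sets.sets_into_space[OF dom]
      by (subst (asm) borel_measurable_restrict_space_iff_ennreal) (auto simp: Int_absorb2)
  qed
  have "(\<integral>\<^sup>+p. ennreal (diffusion_kernel \<kappa> q \<epsilon> p y) \<partial>\<mu>) \<le> (\<integral>\<^sup>+p. (\<Sum>d\<in>\<kappa> ` points M. ?g d p) \<partial>\<mu>)"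
  proof (rule nn_integral_mono)
    fix p assume "p \<in> space \<mu>"
    then have p: "p \<in> points M" by simp
    have "ennreal (diffusion_kernel \<kappa> q \<epsilon> p y) \<le> ?g (\<kappa> p) p"
      using rule_dom[OF p] by (simp add: diffusion_kernel_def)
    also have "\<dots> \<le> (\<Sum>d\<in>\<kappa> ` points M. ?g d p)"
      using p finite_rule by (intro member_le_sum) auto
    finally show "ennreal (diffusion_kernel \<kappa> q \<epsilon> p y) \<le> (\<Sum>d\<in>\<kappa> ` points M. ?g d p)" .
  qed
  also have "\<dots> = (\<Sum>d\<in>\<kappa> ` points M. \<integral>\<^sup>+p. ?g d p \<partial>\<mu>)"
    by (rule nn_integral_sum[OF m])
  also have "\<dots> \<le> (\<Sum>d\<in>\<kappa> ` points M. 1)"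
  proof (rule sum_mono)
    fix d assume "d \<in> \<kappa> ` points M"
    then have "flat_coordinates M d" using rule_flat by blast
    then have "(\<integral>\<^sup>+p. ?g d p \<partial>\<mu>) \<le> (\<integral>\<^sup>+z. ennreal (scaled_density q \<epsilon> (z - snd d y)) \<partial>lborel)"
      by (rule nn_integral_flat_le) measurable
    then show "(\<integral>\<^sup>+p. ?g d p \<partial>\<mu>) \<le> 1"
      by (simp add: nn_integral_scaled(2)[OF assms])
  qed
  also have "\<dots> \<le> ennreal (real (card (\<kappa> ` points M)) + 1)"
    by (simp add: ennreal_of_nat_eq_real_of_nat)
  finally show "(\<integral>\<^sup>+p. ennreal (diffusion_kernel \<kappa> q \<epsilon> p y) \<partial>\<mu>) \<le> ennreal (real (card (\<kappa> ` points M)) + 1)" .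
qed

text \<open>The transposed kernel: differences are read in the coordinates of the integration
  variable \<open>p\<close>, not in those of \<open>y\<close>.\<close>

definition diffusion_adj :: "real \<Rightarrow> ('a \<Rightarrow> real) \<Rightarrow> 'a \<Rightarrow> real" where
  "diffusion_adj \<epsilon> w y = (LINT p|\<mu>. diffusion_kernel \<kappa> q \<epsilon> p y * w p)"

lemma is_L2_adjoint_diffusion:
  assumes "0 < \<epsilon>"
  shows "is_L2_adjoint \<mu> \<mu> (diffusion \<mu> \<kappa> q \<epsilon>) (diffusion_adj \<epsilon>)"
proof -
  interpret schur_kernel \<mu> "diffusion_kernel \<kappa> q \<epsilon>" "real (card (\<kappa> ` points M)) + 1"
    by (rule schur_kernel_diffusion[OF assms])
  have "K_op = diffusion \<mu> \<kappa> q \<epsilon>" "(\<lambda>v y. LINT p|\<mu>. diffusion_kernel \<kappa> q \<epsilon> p y * v p) = diffusion_adj \<epsilon>"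
    by (auto simp: fun_eq_iff K_op_def diffusion_def diffusion_adj_def)
  then show ?thesis
    using is_L2_adjoint_K_op by simp
qed

text \<open>Small differences must mean nearness although the coordinates change with the base
  point. For each system, the base points in \<open>A\<close> that use it lie in a compact subset of
  its domain, whose image keeps a positive distance from the complement of an open set representing
  \<open>V\<close>; the minimum over finitely many systems is uniform.\<close>

lemma uniform_locality:
  assumes A: "compact A" "A \<subseteq> points M" and V: "mopen M V" "A \<subseteq> V"
  obtains \<delta> where "0 < \<delta>"
    "\<And>p y. p \<in> A \<Longrightarrow> y \<in> fst (\<kappa> p) \<Longrightarrow> norm (snd (\<kappa> p) p - snd (\<kappa> p) y) < \<delta> \<Longrightarrow> y \<in> V"
proof -
  have "\<exists>\<delta>>0. \<forall>p\<in>A. \<kappa> p = d \<longrightarrow> (\<forall>y\<in>fst d. norm (snd d p - snd d y) < \<delta> \<longrightarrow> y \<in> V)" if d: "d \<in> \<kappa> ` points M" for d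
  proof -
    have td: "top_chart (points M) d" using d rule_chart by blast
    let ?C = "A \<inter> closure {p \<in> points M. \<kappa> p = d}"
    have C: "compact ?C"
      by (intro compact_Int_closed A) simp
    have Cd: "?C \<subseteq> fst d" using rule_closure[OF d] by auto
    obtain X where X: "open X" "snd d ` (V \<inter> fst d) = X \<inter> snd d ` fst d"
      using chart_image_openin[OF td V(1)] by (auto simp: openin_open)
    have "compact (snd d ` ?C)"
      by (intro compact_continuous_image C continuous_on_subset[OF top_chartD(4)[OF td] Cd])
    moreover have "snd d ` ?C \<subseteq> X"
      using X(2) Cd V(2) by blast
    ultimately obtain e where e: "0 < e" "(\<Union>z\<in>snd d ` ?C. ball z e) \<subseteq> X"
      using compact_subset_open_imp_ball_epsilon_subset[OF _ X(1)] by blast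
    have "y \<in> V" if p: "p \<in> A" "\<kappa> p = d" and y: "y \<in> fst d" "norm (snd d p - snd d y) < e" for p y
    proof -
      have "p \<in> ?C"
        using p A(2) closure_subset by fastforce
      moreover have "snd d y \<in> ball (snd d p) e"
        using y by (simp add: dist_norm)
      ultimately have "snd d y \<in> X"
        using e(2) by blast
      then have "snd d y \<in> snd d ` (V \<inter> fst d)"
        using X(2) y(1) by auto
      then show ?thesis
        using y(1) inj_onD[OF top_chartD(6)[OF td]] by blast
    qed
    then show ?thesis using e(1) by blast
  qed
  then obtain e where e: "\<And>d. d \<in> \<kappa> ` points M \<Longrightarrow> 0 < e d"
    "\<And>d p y. d \<in> \<kappa> ` points M \<Longrightarrow> p \<in> A \<Longrightarrow> \<kappa> p = d \<Longrightarrow> y \<in> fst d \<Longrightarrow> norm (snd d p - snd d y) < e d \<Longrightarrow> y \<in> V"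
    by metis
  \<comment> \<open>The element 1 guarantees that the minimum is taken over a nonempty set.\<close>
  define \<delta> where "\<delta> = Min (insert 1 (e ` \<kappa> ` points M))"
  have fin: "finite (insert 1 (e ` \<kappa> ` points M))"
    using finite_rule by auto
  show ?thesis
  proof (rule that)
    show "0 < \<delta>"
      using fin e(1) by (auto simp: \<delta>_def)
    fix p y assume p: "p \<in> A" and y: "y \<in> fst (\<kappa> p)" "norm (snd (\<kappa> p) p - snd (\<kappa> p) y) < \<delta>"
    have "\<delta> \<le> e (\<kappa> p)"
      unfolding \<delta>_def using fin p A(2) by (intro Min_le) auto
    then show "y \<in> V"
      using p y A(2) by (intro e(2)[of "\<kappa> p" p y]) auto
  qed
qed

end

section \<open>Reduction to Euclidean averages near the point\<close>

locale consistent_point = diffusion_space M \<mu> q \<rho> c \<kappa>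
  for M :: "('a::t2_space, 'n::finite) riem" and \<mu> :: "'a measure"
    and q :: "real^'n \<Rightarrow> real" and \<rho> c :: real and \<kappa> :: "'a \<Rightarrow> ('a, 'n) chart" +
  fixes x :: 'a and d a :: "('a, 'n) chart"
  assumes x_dom: "x \<in> fst d" and d_flat: "flat_coordinates M d"
    and consistent: "\<And>p. p \<in> fst d \<Longrightarrow> fst d \<subseteq> fst (\<kappa> p)"
      "\<And>p y. p \<in> fst d \<Longrightarrow> y \<in> fst d \<Longrightarrow> snd (\<kappa> p) p - snd (\<kappa> p) y = snd d p - snd d y"
    and a_chart: "a \<in> charts M" and x_interior: "x \<in> chart_interior a"
begin

lemma d_chart: "top_chart (points M) d"
  by (rule flat_top_chart[OF d_flat])

lemma coordinate_ball:
  assumes "mopen M X" "X \<subseteq> fst d \<inter> chart_interior a"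
    and "ball (snd d x) R \<subseteq> snd d ` X" "r \<le> R"
  defines "V \<equiv> X \<inter> snd d -` ball (snd d x) r"
  shows "mopen M V" "snd d ` V = ball (snd d x) r"
    "cinv d ` ball (snd d x) r = V"
proof -
  have Xd: "X \<subseteq> fst d" using assms(2) by blast
  have "openin (top_of_set X) V"
    unfolding V_def by (intro continuous_openin_preimage_gen continuous_on_subset[OF top_chartD(4)[OF d_chart] Xd]) simp
  then show "mopen M V"
    using assms(1) by (rule openin_trans)
  have "ball (snd d x) r \<subseteq> snd d ` X"
    using assms(3) subset_ball[OF assms(4)] by (rule order_trans[rotated])
  then show img: "snd d ` V = ball (snd d x) r"
    unfolding V_def by blast
  have "cinv d (snd d p) = p" if "p \<in> V" for p
    using that Xd d_chart by (auto simp: V_def)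
  then show "cinv d ` ball (snd d x) r = V"
    unfolding img[symmetric] by (simp add: image_image)
qed

text \<open>The quantifier over \<open>w\<close> stands inside the eventuality in \<epsilon>,
  because the functions to be averaged depend on \<epsilon> themselves. The kernel has to be
  localised in both arguments, once for the operator and once for its adjoint.\<close>

lemma local_averages:
  assumes X: "mopen M X" "X \<subseteq> fst d \<inter> chart_interior a"
    and R: "ball (snd d x) R \<subseteq> snd d ` X" "0 < r" "r < R"
  shows "\<forall>\<^sub>F \<epsilon> in at_right 0. \<forall>p\<in>X \<inter> snd d -` ball (snd d x) r. \<forall>w :: 'a \<Rightarrow> real.
     continuous_on (X \<inter> snd d -` ball (snd d x) R) w \<longrightarrow>
       diffusion \<mu> \<kappa> q \<epsilon> w p = avg q \<epsilon> (w \<circ> cinv d) (snd d p)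
     \<and> diffusion_adj \<epsilon> w p = avg (\<lambda>v. q (- v)) \<epsilon> (w \<circ> cinv d) (snd d p)"
proof -
  let ?\<psi> = "snd d" and ?B = "ball (snd d x) R"
  let ?V = "X \<inter> ?\<psi> -` ?B" and ?A = "cinv d ` cball (?\<psi> x) r"
  note VR = coordinate_ball[OF X R(1) order_refl]
  have Xd: "X \<subseteq> fst d" using X(2) by blast
  have VM: "?V \<subseteq> points M" by (rule openin_imp_subset[OF VR(1)])
  have cb: "cball (?\<psi> x) r \<subseteq> ?B"
    using R(3) by auto
  have Bd: "?B \<subseteq> snd d ` fst d"
    using R(1) Xd by blast
  have contB: "continuous_on ?B (cinv d)"
    by (rule continuous_on_subset[OF top_chartD(5)[OF d_chart] Bd])
  have A: "compact ?A"
    by (intro compact_continuous_image continuous_on_subset[OF contB cb]) simp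
  have AV: "?A \<subseteq> ?V"
    using image_mono[OF cb, of "cinv d"] VR(3) by simp
  \<comment> \<open>For the diffusion the base point lies in the compact \<open>?A\<close>, and its
    kernel must stay within \<open>?V\<close>.\<close>
  obtain \<delta>1 where \<delta>1: "0 < \<delta>1" "\<And>p y. p \<in> ?A \<Longrightarrow> y \<in> fst (\<kappa> p) \<Longrightarrow> norm (snd (\<kappa> p) p - snd (\<kappa> p) y) < \<delta>1 \<Longrightarrow> y \<in> ?V"
    using uniform_locality[OF A order_trans[OF AV VM] VR(1) AV] by blast
  have cp: "compact (points M - ?V)"
  proof -
    have "closedin (top_of_set (points M)) (points M - ?V)"
      using closedin_diff[OF closedin_topspace VR(1)] by simp
    then show ?thesis
      using closedin_compact[OF compact_points] by blast
  qed
  have oA: "mopen M (points M - ?A)"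
  proof -
    have "closedin (top_of_set (points M)) ?A"
      using compact_imp_closed[OF A] order_trans[OF AV VM] by (rule closed_subset[rotated])
    then show ?thesis
      using openin_diff[OF openin_topspace] by (metis topspace_euclidean_subtopology)
  qed
  have sub: "points M - ?V \<subseteq> points M - ?A" using AV by blast
  \<comment> \<open>For the adjoint the base point is the integration variable and may be anywhere.
    Locality for the compact complement of \<open>?V\<close> and the open complement of
    \<open>?A\<close> shows that base points outside \<open>?V\<close> do not reach
    \<open>?A\<close>.\<close>
  obtain \<delta>2 where \<delta>2: "0 < \<delta>2" "\<And>p y. p \<in> points M - ?V \<Longrightarrow> y \<in> fst (\<kappa> p) \<Longrightarrow> norm (snd (\<kappa> p) p - snd (\<kappa> p) y) < \<delta>2 \<Longrightarrow> y \<in> points M - ?A"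
    using uniform_locality[OF cp Diff_subset oA sub] by blast
  \<comment> \<open>The entry \<open>R - r\<close> keeps shifted points in the ball where
    \<open>w \<circ> cinv d\<close> is continuous.\<close>
  have pos: "0 < Min {\<delta>1, \<delta>2, R - r}"
    using \<delta>1(1) \<delta>2(1) R(3) by simp
  from eventually_at_right_small[OF radius_pos pos] show ?thesis
  proof eventually_elim
    case (elim \<epsilon>)
    then have \<epsilon>: "0 < \<epsilon>" "\<epsilon> * \<rho> < \<delta>1" "\<epsilon> * \<rho> < \<delta>2" "\<epsilon> * \<rho> < R - r" by auto
    let ?K = "diffusion_kernel \<kappa> q \<epsilon>" and ?s = "scaled_density q \<epsilon>"
    show ?case
    proof (intro ballI allI impI)
      fix p and w :: "'a \<Rightarrow> real"
      assume p: "p \<in> X \<inter> ?\<psi> -` ball (?\<psi> x) r" and w: "continuous_on ?V w"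
      have pd: "p \<in> fst d" and pM: "p \<in> points M" and pr: "?\<psi> p \<in> ball (?\<psi> x) r"
        using p Xd openin_imp_subset[OF X(1)] by auto
      have pA: "p \<in> ?A"
      proof -
        have "cinv d (?\<psi> p) = p" using d_chart pd by simp
        then show ?thesis using pr by (metis ball_subset_cball image_eqI subsetD)
      qed
      have K1: "?K p y = indicator ?V y * ?s (?\<psi> p - ?\<psi> y)" for y
      proof (cases "y \<in> ?V")
        case True
        then have "y \<in> fst d" using Xd by auto
        then show ?thesis
          using True consistent(1)[OF pd] consistent(2)[OF pd] by (auto simp: diffusion_kernel_def)
      next
        case False
        have "?K p y = 0"
        proof (rule ccontr)
          assume nz: "?K p y \<noteq> 0"
          then have y: "y \<in> fst (\<kappa> p)" "?s (snd (\<kappa> p) p - snd (\<kappa> p) y) \<noteq> 0"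
            by (auto simp: diffusion_kernel_def split: if_splits)
          have "norm (snd (\<kappa> p) p - snd (\<kappa> p) y) < \<delta>1"
            using scaled_support[OF \<epsilon>(1) y(2)] \<epsilon>(2) by linarith
          then show False
            using \<delta>1(2)[OF pA y(1)] False by blast
        qed
        then show ?thesis using False by simp
      qed
      have K2: "?K y p = indicator ?V y * ?s (?\<psi> y - ?\<psi> p)" if yM: "y \<in> points M" for y
      proof (cases "y \<in> ?V")
        case True
        then have "y \<in> fst d" using Xd by auto
        then show ?thesis
          using True consistent(1)[of y] consistent(2)[of y p] pd by (auto simp: diffusion_kernel_def)
      next
        case False
        have "?K y p = 0"
        proof (rule ccontr)
          assume nz: "?K y p \<noteq> 0"
          then have y: "p \<in> fst (\<kappa> y)" "?s (snd (\<kappa> y) y - snd (\<kappa> y) p) \<noteq> 0"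
            by (auto simp: diffusion_kernel_def split: if_splits)
          have "norm (snd (\<kappa> y) y - snd (\<kappa> y) p) < \<delta>2"
            using scaled_support[OF \<epsilon>(1) y(2)] \<epsilon>(3) by linarith
          then show False
            using \<delta>2(2)[OF _ y(1)] False yM pA by blast
        qed
        then show ?thesis using False by simp
      qed
      \<comment> \<open>Extended by zero outside the ball, \<open>w\<close> in coordinates becomes a
        Borel function on the whole space, as \<open>integral_flat\<close> demands.\<close>
      define g where "g z = indicator ?B z *\<^sub>R (w \<circ> cinv d) z" for z
      have gm: "g \<in> borel_measurable borel"
        unfolding g_def[abs_def]
        using VR(3) w by (intro borel_measurable_continuous_on_indicator continuous_on_compose contB) auto
      have gw: "g (?\<psi> y) = w y" if "y \<in> ?V" for y
        using that Xd d_chart by (auto simp: g_def)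
      have shift: "?\<psi> p - \<epsilon> *\<^sub>R v \<in> ?B" if "norm v \<le> \<rho>" for v
      proof -
        have "dist (?\<psi> x) (?\<psi> p - \<epsilon> *\<^sub>R v) \<le> dist (?\<psi> x) (?\<psi> p) + dist (?\<psi> p) (?\<psi> p - \<epsilon> *\<^sub>R v)"
          by (rule dist_triangle)
        also have "dist (?\<psi> p) (?\<psi> p - \<epsilon> *\<^sub>R v) = \<epsilon> * norm v"
          using \<epsilon>(1) by (simp add: dist_norm)
        also have "\<dots> \<le> \<epsilon> * \<rho>"
          using that \<epsilon>(1) by simp
        finally show ?thesis
          using pr \<epsilon>(4) by simp
      qed
      \<comment> \<open>One computation for both operators: \<open>s\<close> is the kernel as a
        function of the flat coordinate, and \<open>k\<close>, either \<open>q\<close> or its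
        reflection, is what the substitution makes of it.\<close>
      have main: "(LINT y|\<mu>. indicator ?V y * (s (?\<psi> y) * g (?\<psi> y))) = avg k \<epsilon> (w \<circ> cinv d) (?\<psi> p)"
        if sm [measurable]: "s \<in> borel_measurable borel"
          and sk: "\<And>v. s (?\<psi> p - \<epsilon> *\<^sub>R v) = k v / \<epsilon> ^ CARD('n)" and ksupp: "\<And>v. k v \<noteq> 0 \<Longrightarrow> norm v \<le> \<rho>" for s k
      proof -
        note [measurable] = gm
        have "(LINT y|\<mu>. indicator ?V y * (s (?\<psi> y) * g (?\<psi> y))) = (LINT z|lborel. indicator (?\<psi> ` ?V) z * (s z * g z))"
          using X(2) by (intro integral_flat[OF d_flat a_chart VR(1)]) auto
        also have "\<dots> = (LINT z|lborel. s z * g z)"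
          unfolding VR(2) by (intro Bochner_Integration.integral_cong refl) (simp add: g_def indicator_def)
        also have "\<dots> = \<epsilon> ^ CARD('n) * (LINT v|lborel. s (?\<psi> p - \<epsilon> *\<^sub>R v) * g (?\<psi> p - \<epsilon> *\<^sub>R v))"
          using \<epsilon>(1) by (subst lborel_integral_affine[of _ "- \<epsilon>" "?\<psi> p"]) auto
        also have "\<dots> = (LINT v|lborel. \<epsilon> ^ CARD('n) * (s (?\<psi> p - \<epsilon> *\<^sub>R v) * g (?\<psi> p - \<epsilon> *\<^sub>R v)))"
          by simp
        also have "\<dots> = avg k \<epsilon> (w \<circ> cinv d) (?\<psi> p)"
          unfolding avg_def
        proof (intro Bochner_Integration.integral_cong refl)
          fix v
          show "\<epsilon> ^ CARD('n) * (s (?\<psi> p - \<epsilon> *\<^sub>R v) * g (?\<psi> p - \<epsilon> *\<^sub>R v)) = k v * (w \<circ> cinv d) (?\<psi> p - \<epsilon> *\<^sub>R v)"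
            using \<epsilon>(1) shift[OF ksupp, of v] by (cases "k v = 0") (auto simp: sk g_def)
        qed
        finally show ?thesis .
      qed
      have "diffusion \<mu> \<kappa> q \<epsilon> w p = (LINT y|\<mu>. indicator ?V y * (?s (?\<psi> p - ?\<psi> y) * g (?\<psi> y)))"
        unfolding diffusion_def K1
        by (intro Bochner_Integration.integral_cong refl) (use gw in \<open>auto simp: indicator_def\<close>)
      also have "\<dots> = avg q \<epsilon> (w \<circ> cinv d) (?\<psi> p)"
        using \<epsilon>(1) by (intro main[of "\<lambda>z. ?s (?\<psi> p - z)" q] q_support) (auto simp: scaled_density_def)
      finally have 1: "diffusion \<mu> \<kappa> q \<epsilon> w p = avg q \<epsilon> (w \<circ> cinv d) (?\<psi> p)" .
      have "diffusion_adj \<epsilon> w p = (LINT y|\<mu>. indicator ?V y * (?s (?\<psi> y - ?\<psi> p) * g (?\<psi> y)))"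
        unfolding diffusion_adj_def
        by (intro Bochner_Integration.integral_cong refl) (use gw K2 in \<open>auto simp: indicator_def\<close>)
      also have "\<dots> = avg (\<lambda>v. q (- v)) \<epsilon> (w \<circ> cinv d) (?\<psi> p)"
        using \<epsilon>(1) q_support[of "- _"] by (intro main[of "\<lambda>z. ?s (z - ?\<psi> p)" "\<lambda>v. q (- v)"]) (auto simp: scaled_density_def)
      finally have 2: "diffusion_adj \<epsilon> w p = avg (\<lambda>v. q (- v)) \<epsilon> (w \<circ> cinv d) (?\<psi> p)" .
      show "diffusion \<mu> \<kappa> q \<epsilon> w p = avg q \<epsilon> (w \<circ> cinv d) (?\<psi> p)
        \<and> diffusion_adj \<epsilon> w p = avg (\<lambda>v. q (- v)) \<epsilon> (w \<circ> cinv d) (?\<psi> p)"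
        using 1 2 by simp
    qed
  qed
qed

text \<open>The expansion is the same for the diffusion and its adjoint: reflecting \<open>q\<close> changes neither its
  mean nor its covariance.\<close>

lemma diffusion_expands:
  assumes U: "expands_near (points M) x U u h" and u: "C_near 2 M u x"
  shows "expands_near (points M) x (\<lambda>\<epsilon>. diffusion \<mu> \<kappa> q \<epsilon> (U \<epsilon>)) u
      (\<lambda>y. h y + c / 2 * flat_laplacian (u \<circ> cinv d) (snd d y))"
    and "expands_near (points M) x (\<lambda>\<epsilon>. diffusion_adj \<epsilon> (U \<epsilon>)) u
      (\<lambda>y. h y + c / 2 * flat_laplacian (u \<circ> cinv d) (snd d y))"
proof -
  obtain V1 where V1: "mopen M V1" "x \<in> V1" "continuous_on V1 h" "expands V1 U u h"
    using U by (auto simp: expands_near_def)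
  have u': "C_near (Suc 1) M u x" using u by (simp add: numeral_2_eq_2)
  obtain V2 where V2: "mopen M V2" "x \<in> V2" "V2 \<subseteq> fst d \<inter> chart_interior a"
    "cont_diff (Suc 1) (u \<circ> cinv d) (snd d ` V2)"
    by (rule C_near_flat[OF manifold d_flat a_chart x_dom x_interior u'])
  let ?X = "V1 \<inter> V2"
  have X: "mopen M ?X" "?X \<subseteq> fst d \<inter> chart_interior a" "x \<in> ?X"
    using V1 V2 by auto
  have "open (snd d ` ?X)"
    by (rule flat_transition(2)[OF manifold d_flat a_chart X(1,2)])
  then obtain R where R: "0 < R" "ball (snd d x) R \<subseteq> snd d ` ?X"
    using X(3) open_contains_ball by blast
  define r where "r = R / 2"
  have r: "0 < r" "r < R" using R(1) by (auto simp: r_def)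
  let ?B = "ball (snd d x) R" and ?V = "\<lambda>r. ?X \<inter> snd d -` ball (snd d x) r"
  note VR = coordinate_ball[OF X(1,2) R(2) order_refl]
  note Vr = coordinate_ball[OF X(1,2) R(2) less_imp_le[OF r(2)]]
  have Bd: "?B \<subseteq> snd d ` fst d" using R(2) X(2) by blast
  have contB: "continuous_on ?B (cinv d)"
    by (rule continuous_on_subset[OF top_chartD(5)[OF d_chart] Bd])
  have imgB: "cinv d ` ?B \<subseteq> V1" using VR(3) by blast
  have ex: "expands ?B (\<lambda>\<epsilon>. U \<epsilon> \<circ> cinv d) (u \<circ> cinv d) (h \<circ> cinv d)"
    by (rule expands_compose[OF V1(4) contB imgB])
  have "?B \<subseteq> snd d ` V2" using R(2) by blast
  then have cd: "cont_diff 2 (u \<circ> cinv d) ?B"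
    using cont_diff_subset[OF V2(4)] by (simp add: numeral_2_eq_2)
  have ch: "continuous_on ?B (h \<circ> cinv d)"
    by (intro continuous_on_compose contB continuous_on_subset[OF V1(3) imgB])
  interpret rf: isotropic_density "\<lambda>v. q (- v)" \<rho> c by (rule reflect)
  have contr: "continuous_on (?V r) (snd d)"
    using X(2) by (intro continuous_on_subset[OF top_chartD(4)[OF d_chart]]) auto
  have inv: "cinv d (snd d y) = y" if "y \<in> ?V r" for y
    using that X(2) d_chart by auto
  let ?H = "\<lambda>y. h y + c / 2 * flat_laplacian (u \<circ> cinv d) (snd d y)"
  have cH: "continuous_on (?V r) ?H"
  proof -
    have cB: "continuous_on ?B (\<lambda>z. (h \<circ> cinv d) z + c / 2 * flat_laplacian (u \<circ> cinv d) z)"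
      by (intro continuous_intros ch continuous_on_flat_laplacian[OF cd])
    have "snd d ` ?V r \<subseteq> ?B"
      using Vr(2) r(2) by auto
    then have "continuous_on (?V r) (\<lambda>y. (h \<circ> cinv d) (snd d y) + c / 2 * flat_laplacian (u \<circ> cinv d) (snd d y))"
      by (rule continuous_on_compose2[OF cB contr])
    then show ?thesis
      using inv by (simp cong: continuous_on_cong_simp)
  qed
  have xr: "x \<in> ?V r" using X(3) r(1) by auto
  have "\<forall>\<^sub>F \<epsilon> in at_right 0. continuous_on (?V R) (U \<epsilon>)"
    using expandsD(1)[OF V1(4)] by eventually_elim (rule continuous_on_subset, auto)
  with local_averages[OF X(1,2) R(2) r]
  have eq: "\<forall>\<^sub>F \<epsilon> in at_right 0. \<forall>p\<in>?V r. diffusion \<mu> \<kappa> q \<epsilon> (U \<epsilon>) p = avg q \<epsilon> (U \<epsilon> \<circ> cinv d) (snd d p)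
     \<and> diffusion_adj \<epsilon> (U \<epsilon>) p = avg (\<lambda>v. q (- v)) \<epsilon> (U \<epsilon> \<circ> cinv d) (snd d p)"
    by eventually_elim blast
  \<comment> \<open>Carries an expansion from coordinates back to the manifold; \<open>k\<close>
    will be \<open>q\<close> for the diffusion and its reflection for the adjoint.\<close>
  have tr: "expands_near (points M) x D u ?H"
    if k: "expands (ball (snd d x) r) (\<lambda>\<epsilon>. avg k \<epsilon> (U \<epsilon> \<circ> cinv d)) (u \<circ> cinv d)
        (\<lambda>z. (h \<circ> cinv d) z + c / 2 * flat_laplacian (u \<circ> cinv d) z)"
      and D: "\<forall>\<^sub>F \<epsilon> in at_right 0. \<forall>p\<in>?V r. D \<epsilon> p = avg k \<epsilon> (U \<epsilon> \<circ> cinv d) (snd d p)" for k D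
  proof -
    have "expands (?V r) (\<lambda>\<epsilon>. avg k \<epsilon> (U \<epsilon> \<circ> cinv d) \<circ> snd d) (u \<circ> cinv d \<circ> snd d)
        ((\<lambda>z. (h \<circ> cinv d) z + c / 2 * flat_laplacian (u \<circ> cinv d) z) \<circ> snd d)"
      using Vr(2) by (intro expands_compose[OF k contr]) auto
    then have "expands (?V r) D u ?H"
    proof (rule expands_cong[rotated 3])
      show "\<forall>\<^sub>F \<epsilon> in at_right 0. \<forall>z\<in>?V r. (avg k \<epsilon> (U \<epsilon> \<circ> cinv d) \<circ> snd d) z = D \<epsilon> z"
        using D by eventually_elim auto
    qed (use inv in auto)
    then show ?thesis
      using Vr(1) xr cH unfolding expands_near_def by blast
  qed
  show "expands_near (points M) x (\<lambda>\<epsilon>. diffusion \<mu> \<kappa> q \<epsilon> (U \<epsilon>)) u ?H"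
    by (rule tr[OF avg_expands[OF cd ch ex r]]) (use eq in eventually_elim, blast)
  show "expands_near (points M) x (\<lambda>\<epsilon>. diffusion_adj \<epsilon> (U \<epsilon>)) u ?H"
    by (rule tr[OF rf.avg_expands[OF cd ch ex r]]) (use eq in eventually_elim, blast)
qed

end

section \<open>The composed operator\<close>

lemma expands_near_compose:
  assumes ex: "expands_near P x U u h" and S: "continuous_on Q S" "S ` Q \<subseteq> P" and y: "y \<in> Q" "S y = x"
  shows "expands_near Q y (\<lambda>\<epsilon>. U \<epsilon> \<circ> S) (u \<circ> S) (h \<circ> S)"
proof -
  obtain V where V: "openin (top_of_set P) V" "x \<in> V" "continuous_on V h" "expands V U u h"
    using ex by (auto simp: expands_near_def)
  let ?W = "Q \<inter> S -` V"
  have "openin (top_of_set Q) ?W"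
    using S V(1) by (intro continuous_openin_preimage) auto
  moreover have cS: "continuous_on ?W S"
    by (rule continuous_on_subset[OF S(1)]) simp
  moreover have "expands ?W (\<lambda>\<epsilon>. U \<epsilon> \<circ> S) (u \<circ> S) (h \<circ> S)"
    by (rule expands_compose[OF V(4) cS]) auto
  moreover have "continuous_on ?W (h \<circ> S)"
    by (rule continuous_on_compose[OF cS continuous_on_subset[OF V(3)]]) auto
  ultimately show ?thesis
    using y V(2) unfolding expands_near_def by blast
qed

lemma expands_near_cong:
  assumes ex: "expands_near P x U u h" and eq: "\<And>y. y \<in> P \<Longrightarrow> u y = u' y"
  shows "expands_near P x U u' h"
proof -
  obtain V where V: "openin (top_of_set P) V" "x \<in> V" "continuous_on V h" "expands V U u h"
    using ex by (auto simp: expands_near_def)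
  have VP: "V \<subseteq> P" by (rule openin_imp_subset[OF V(1)])
  have "expands V U u' h"
    by (rule expands_cong[OF _ _ _ V(4)]) (use eq VP in auto)
  then show ?thesis
    using V(1-3) unfolding expands_near_def by blast
qed

lemma expands_near_tendsto:
  assumes "expands_near P x U u h"
  shows "((\<lambda>\<epsilon>. (U \<epsilon> x - u x) / \<epsilon>\<^sup>2) \<longlongrightarrow> h x) (at_right 0)"
proof -
  obtain V where V: "x \<in> V" "expands V U u h"
    using assms by (auto simp: expands_near_def)
  show ?thesis
  proof (rule tendstoI)
    fix e :: real assume e: "0 < e"
    have "\<forall>\<^sub>F \<epsilon> in at_right (0::real). 0 < \<epsilon>"
      by (auto simp: eventually_at_right_less)
    with expandsD(2)[OF V(2) half_gt_zero[OF e]]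
    show "\<forall>\<^sub>F \<epsilon> in at_right 0. dist ((U \<epsilon> x - u x) / \<epsilon>\<^sup>2) (h x) < e"
    proof eventually_elim
      case (elim \<epsilon>)
      have "(U \<epsilon> x - u x) / \<epsilon>\<^sup>2 - h x = (U \<epsilon> x - u x - \<epsilon>\<^sup>2 * h x) / \<epsilon>\<^sup>2"
        using elim(2) by (simp add: field_simps)
      also have "\<bar>\<dots>\<bar> \<le> e / 2"
        using elim V(1) by (simp add: field_simps)
      finally show ?case
        using e by (simp add: dist_real_def)
    qed
  qed
qed

section \<open>Regularity under composition and invariance of the interior\<close>

lemma C_fun_continuous_on:
  assumes "riemannian_manifold M" "C_fun m M f"
  shows "continuous_on (points M) f"
proof -
  have loc: "continuous_on (fst c) f" if c: "c \<in> charts M" for c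
  proof -
    have t: "top_chart (points M) c" by (rule riemannian_manifoldD(1)[OF assms(1) c])
    have "continuous_on (snd c ` fst c) (f \<circ> cinv c)"
      using assms(2) c by (intro C_on_imp_continuous_on[of m]) (simp add: C_fun_def)
    then have "continuous_on (fst c) ((f \<circ> cinv c) \<circ> snd c)"
      by (rule continuous_on_compose[OF top_chartD(4)[OF t]])
    moreover have "((f \<circ> cinv c) \<circ> snd c) p = f p" if "p \<in> fst c" for p
      using that t by simp
    ultimately show ?thesis
      by (metis (no_types, lifting) continuous_on_cong)
  qed
  have "continuous (at p within points M) f" if p: "p \<in> points M" for p
  proof -
    obtain c where c: "c \<in> charts M" "p \<in> fst c"
      using riemannian_manifold_cover[OF assms(1) p] .
    have t: "top_chart (points M) c" by (rule riemannian_manifoldD(1)[OF assms(1) c(1)])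
    have "continuous (at p within fst c) f"
      using loc[OF c(1)] c(2)
      by (simp add: continuous_on_eq_continuous_within)
    moreover have "at p within fst c = at p within points M"
    proof -
      obtain X where "open X" "fst c = points M \<inter> X"
        using top_chartD(1)[OF t] unfolding openin_open by blast
      then show ?thesis
        using c(2) by (intro at_within_nhd[of p X]) auto
    qed
    ultimately show ?thesis by simp
  qed
  then show ?thesis
    by (simp add: continuous_on_eq_continuous_within)
qed

lemma C_fun_C_near:
  assumes "riemannian_manifold M" "C_fun m M f" "enat k \<le> m"
  shows "C_near k M f p"
  unfolding C_near_def
proof (intro ballI impI)
  fix c assume c: "c \<in> charts M" and p: "p \<in> chart_interior c"
  have t: "top_chart (points M) c" by (rule riemannian_manifoldD(1)[OF assms(1) c])
  have "cont_diff k (f \<circ> cinv c) (interior (snd c ` fst c))"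
    using assms(2,3) c by (intro C_on_imp_cont_diff[of m]) (simp_all add: C_fun_def)
  moreover have "snd c ` chart_interior c \<subseteq> interior (snd c ` fst c)"
    by (auto simp: chart_interior_def)
  ultimately have "cont_diff k (f \<circ> cinv c) (snd c ` chart_interior c)"
    by (rule cont_diff_subset)
  then show "\<exists>V. mopen M V \<and> p \<in> V \<and> V \<subseteq> chart_interior c \<and> cont_diff k (f \<circ> cinv c) (snd c ` V)"
    using p openin_chart_interior[OF t] by blast
qed

lemma C_near_compose:
  fixes M :: "('a::t2_space, 'n::finite) riem" and N :: "('b::t2_space, 'n) riem" and u :: "'a \<Rightarrow> real"
  assumes M: "riemannian_manifold M" and N: "riemannian_manifold N"
    and S: "C_map m N M S" "enat k \<le> m" and u: "C_near k M u (S y)"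
    and a: "a \<in> charts M" "S y \<in> chart_interior a"
  shows "C_near k N (u \<circ> S) y"
  unfolding C_near_def
proof (intro ballI impI)
  fix c assume c: "c \<in> charts N" and y: "y \<in> chart_interior c"
  have tc: "top_chart (points N) c" by (rule riemannian_manifoldD(1)[OF N c])
  have ta: "top_chart (points M) a" by (rule riemannian_manifoldD(1)[OF M a(1)])
  obtain V where V: "mopen M V" "S y \<in> V" "V \<subseteq> chart_interior a" "cont_diff k (u \<circ> cinv a) (snd a ` V)"
    using u a unfolding C_near_def by blast
  have Va: "V \<subseteq> fst a"
    using V(3) chart_interior_subset[of a] by (rule order_trans)
  let ?W = "chart_interior c \<inter> (points N \<inter> S -` V)"
  have W: "mopen N ?W"
    using S(1) V(1) by (intro openin_Int openin_chart_interior[OF tc] continuous_openin_preimage) (auto simp: C_map_def)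
  have Wc: "?W \<subseteq> fst c" using chart_interior_subset[of c] by blast
  have ops: "open (snd c ` ?W)" "open (snd a ` V)"
    using open_chart_image[OF tc W] open_chart_image[OF ta V(1,3)] by auto
  have inv: "cinv c (snd c p) = p" if "p \<in> ?W" for p
    using subsetD[OF Wc that] tc by simp
  let ?\<Psi> = "snd a \<circ> S \<circ> cinv c"
  have "C_on m ?\<Psi> (snd c ` {p \<in> fst c. S p \<in> fst a})"
    using S(1) a(1) c by (simp add: C_map_def)
  from C_on_imp_cont_diff[OF this S(2)]
  have "cont_diff k ?\<Psi> (interior (snd c ` {p \<in> fst c. S p \<in> fst a}))" .
  moreover have "snd c ` ?W \<subseteq> interior (snd c ` {p \<in> fst c. S p \<in> fst a})"
    using Va Wc by (intro interior_maximal ops(1)) blast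
  ultimately have "cont_diff k ?\<Psi> (snd c ` ?W)"
    by (rule cont_diff_subset)
  then have "cont_diff k (\<lambda>z. ?\<Psi> z $ i) (snd c ` ?W)" for i
    by (rule cont_diff_nth[OF ops(1)])
  then have "cont_diff k ((u \<circ> cinv a) \<circ> ?\<Psi>) (snd c ` ?W)"
    by (intro cont_diff_compose[OF ops _ V(4)]) (auto simp: inv)
  moreover have "((u \<circ> cinv a) \<circ> ?\<Psi>) z = ((u \<circ> S) \<circ> cinv c) z" if "z \<in> snd c ` ?W" for z
  proof -
    obtain p where p: "p \<in> ?W" "z = snd c p" using \<open>z \<in> snd c ` ?W\<close> by blast
    have "cinv a (snd a (S p)) = S p"
      using p(1) Va ta by auto
    then show ?thesis
      using inv[OF p(1)] p(2) by simp
  qed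
  ultimately have "cont_diff k ((u \<circ> S) \<circ> cinv c) (snd c ` ?W)"
    using cont_diff_cong[OF ops(1)] by blast
  moreover have "y \<in> ?W"
    using y V(2) top_chartD(3)[OF tc] chart_interior_subset[of c] by auto
  ultimately show "\<exists>V. mopen N V \<and> y \<in> V \<and> V \<subseteq> chart_interior c \<and> cont_diff k ((u \<circ> S) \<circ> cinv c) (snd c ` V)"
    using W by (intro exI[of _ ?W]) auto
qed

text \<open>A continuous injection between manifolds of equal dimension cannot send an interior
  point to the boundary: by invariance of domain, a neighbourhood of \<open>x\<close> has an open
  image in the coordinates of \<open>b\<close>.\<close>

lemma image_chart_interior:
  fixes M :: "('a::t2_space, 'n::finite) riem" and N :: "('b::t2_space, 'n) riem"
  assumes M: "riemannian_manifold M" and N: "riemannian_manifold N"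
    and T: "continuous_on (points M) T" "inj_on T (points M)" "T ` points M \<subseteq> points N"
    and a: "a \<in> charts M" "x \<in> chart_interior a" and b: "b \<in> charts N" "T x \<in> fst b"
  shows "T x \<in> chart_interior b"
proof -
  have ta: "top_chart (points M) a" by (rule riemannian_manifoldD(1)[OF M a(1)])
  have tb: "top_chart (points N) b" by (rule riemannian_manifoldD(1)[OF N b(1)])
  let ?V = "chart_interior a \<inter> (points M \<inter> T -` fst b)"
  have V: "mopen M ?V"
    using T top_chartD(1)[OF tb] by (intro openin_Int openin_chart_interior[OF ta] continuous_openin_preimage) auto
  have "open ((snd b \<circ> T) ` ?V)"
  proof (rule open_image_chart_interior[OF ta V])
    show "continuous_on ?V (snd b \<circ> T)"
      by (intro continuous_on_compose continuous_on_subset[OF T(1)] continuous_on_subset[OF top_chartD(4)[OF tb]]) auto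
    show "inj_on (snd b \<circ> T) ?V"
      by (intro comp_inj_on inj_on_subset[OF T(2)] inj_on_subset[OF top_chartD(6)[OF tb]]) auto
  qed simp
  then have "(snd b \<circ> T) ` ?V \<subseteq> interior (snd b ` fst b)"
    by (intro interior_maximal) auto
  moreover have "x \<in> ?V"
    using a b(2) top_chartD(3)[OF ta] chart_interior_subset[of a] by auto
  ultimately show ?thesis
    using b(2) by (auto simp: chart_interior_def)
qed

lemma isotropic_densityI:
  fixes q :: "real^'n \<Rightarrow> real"
  assumes "q \<in> borel_measurable borel" "\<And>z. 0 \<le> q z" "has_bochner_integral lborel q 1"
    and "compact (closure {z. q z \<noteq> 0})" and mean: "(LINT z|lborel. q z *\<^sub>R z) = 0"
    and cov: "(\<chi> i j. LINT z|lborel. z $ i * z $ j * q z) = c *\<^sub>R (mat 1 :: real^'n^'n)"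
  obtains \<rho> where "isotropic_density q \<rho> c"
proof -
  note [measurable] = assms(1)
  have "bounded {z. q z \<noteq> 0}"
    using bounded_subset[OF compact_imp_bounded[OF assms(4)] closure_subset] .
  then obtain B where "\<forall>z\<in>{z. q z \<noteq> 0}. norm z \<le> B"
    by (auto simp: bounded_iff)
  \<comment> \<open>The maximum with 1 makes the radius positive.\<close>
  then have B: "norm z \<le> max B 1" if "q z \<noteq> 0" for z
    using that by force
  \<comment> \<open>The Bochner integral of a nonintegrable function is 0 by default, so
    integrability is established before the vanishing mean is read off in components.\<close>
  have int: "integrable lborel (\<lambda>z. q z *\<^sub>R z)"
  proof (rule Bochner_Integration.integrable_bound)
    show "integrable lborel (\<lambda>z. q z * max B 1)"
      using assms(3) by (auto simp: has_bochner_integral_iff)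
    show "AE z in lborel. norm (q z *\<^sub>R z) \<le> norm (q z * max B 1)"
    proof (rule AE_I2)
      fix z show "norm (q z *\<^sub>R z) \<le> norm (q z * max B 1)"
        using B[of z] assms(2)[of z] by (cases "q z = 0") (auto simp: abs_mult intro!: mult_left_mono)
    qed
  qed measurable
  have "isotropic_density q (max B 1) c"
  proof
    show "(LINT v|lborel. q v * v $ i) = 0" for i
      using integral_bounded_linear[OF bounded_linear_vec_nth[of i] int] mean by simp
    have "(LINT v|lborel. v $ i * v $ j * q v) = (if i = j then c else 0)" for i j
    proof -
      have "(\<chi> i j. LINT z|lborel. z $ i * z $ j * q z) $ i $ j = (c *\<^sub>R (mat 1 :: real^'n^'n)) $ i $ j"
        by (simp only: cov)
      then show ?thesis by (simp add: mat_def)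
    qed
    then show "(LINT v|lborel. q v * (v $ i * v $ j)) = (if i = j then c else 0)" for i j
      by (simp add: mult.commute mult.left_commute)
  qed (use assms(1-3) B in auto)
  then show ?thesis by (rule that)
qed

section \<open>Point values of classes modulo null sets\<close>

context riemannian_volume_space
begin

lemma continuous_on_L2:
  assumes "continuous_on (points M) f"
  shows "f \<in> L2 \<mu>"
proof -
  have "f \<in> borel_measurable (restrict_space borel (points M))"
    by (rule borel_measurable_continuous_on_restrict[OF assms])
  then have m [measurable]: "f \<in> borel_measurable \<mu>"
    using measurable_cong_sets[OF sets_\<mu> refl] by blast
  obtain B where B: "\<And>y. y \<in> points M \<Longrightarrow> norm (f y) \<le> B"
    using compact_imp_bounded[OF compact_continuous_image[OF assms compact_points]]
    unfolding bounded_iff by blast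
  have "integrable \<mu> (\<lambda>y. (f y)\<^sup>2)"
  proof (rule integrable_const_bound[where B="B\<^sup>2"])
    have "(f y)\<^sup>2 \<le> B\<^sup>2" if "y \<in> points M" for y
      using power_mono[OF B[OF that], of 2] by simp
    then show "AE y in \<mu>. norm ((f y)\<^sup>2) \<le> B\<^sup>2"
      by (intro AE_I2) simp
  qed measurable
  then show ?thesis
    by (simp add: L2_def)
qed

text \<open>Two continuous versions with different values at \<open>x\<close> would differ on a
  nonempty open set, which has positive volume. Intersecting with the flat domain and the chart
  interior makes \<open>emeasure_open_pos\<close> applicable.\<close>

lemma has_point_value_unique:
  assumes d: "flat_coordinates M d" "x \<in> fst d" and a: "a \<in> charts M" "x \<in> chart_interior a"
    and v: "has_point_value \<mu> g x v" "has_point_value \<mu> g x v'"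
  shows "v = v'"
proof (rule ccontr)
  assume ne: "v \<noteq> v'"
  obtain U h where U: "mopen M U" "x \<in> U" "continuous_on U h" "AE y in \<mu>. y \<in> U \<longrightarrow> g y = h y" "h x = v"
    using v(1) by (auto simp: has_point_value_def)
  obtain U' h' where U': "mopen M U'" "x \<in> U'" "continuous_on U' h'" "AE y in \<mu>. y \<in> U' \<longrightarrow> g y = h' y" "h' x = v'"
    using v(2) by (auto simp: has_point_value_def)
  have td: "top_chart (points M) d"
    by (rule flat_top_chart[OF d(1)])
  let ?W = "U \<inter> U' \<inter> (fst d \<inter> chart_interior a)"
  let ?E = "?W \<inter> (\<lambda>y. h y - h' y) -` (- {0})"
  have W: "mopen M ?W"
    by (intro openin_Int U(1) U'(1) top_chartD(1)[OF td] openin_chart_interior charts_top_chart a(1))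
  have "continuous_on ?W (\<lambda>y. h y - h' y)"
    by (intro continuous_on_diff continuous_on_subset[OF U(3)] continuous_on_subset[OF U'(3)]) auto
  then have "openin (top_of_set ?W) ?E"
    by (rule continuous_openin_preimage_gen) auto
  then have E: "mopen M ?E"
    using W by (rule openin_trans)
  have "AE y in \<mu>. y \<notin> ?E"
    using U(4) U'(4) by eventually_elim auto
  then have "emeasure \<mu> ?E = 0"
    using AE_iff_null_sets[OF openin_sets[OF E]] by auto
  moreover have "x \<in> ?E"
    using U U' d a ne by auto
  then have "0 < emeasure \<mu> ?E"
    by (intro emeasure_open_pos[OF d(1) a(1) E]) auto
  ultimately show False by simp
qed

lemma point_value_eq:
  assumes d: "flat_coordinates M d" "x \<in> fst d" and a: "a \<in> charts M" "x \<in> chart_interior a"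
    and V: "mopen M V" "x \<in> V" "continuous_on V h" "AE y in \<mu>. g y = h y"
  shows "point_value \<mu> g x = h x"
proof -
  have "AE y in \<mu>. y \<in> V \<longrightarrow> g y = h y"
    using V(4) by eventually_elim simp
  then have "has_point_value \<mu> g x (h x)"
    using V unfolding has_point_value_def space_\<mu> by blast
  then show ?thesis
    unfolding point_value_def using has_point_value_unique[OF d a] by (intro the_equality) blast+
qed

end

lemma measurable_continuous_map:
  assumes "riemannian_volume_space M \<mu>" "riemannian_volume_space N \<nu>"
    and T: "continuous_on (points M) T" "T ` points M \<subseteq> points N"
  shows "T \<in> \<mu> \<rightarrow>\<^sub>M \<nu>"
proof -
  interpret M: riemannian_volume_space M \<mu> by fact
  interpret N: riemannian_volume_space N \<nu> by fact
  have "T \<in> measurable (restrict_space borel (points M)) (restrict_space borel (points N))"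
    using T by (intro measurable_restrict_space2 borel_measurable_continuous_on_restrict) (auto simp: space_restrict_space)
  then show "T \<in> \<mu> \<rightarrow>\<^sub>M \<nu>"
    using measurable_cong_sets[OF M.sets_\<mu> N.sets_\<mu>] by blast
qed

text \<open>\<open>volume_preserving\<close> speaks of images and \<open>distr\<close> of preimages;
  surjectivity makes the image of the preimage of \<open>B\<close> equal to
  \<open>B\<close>.\<close>

lemma volume_preserving_distr:
  assumes "riemannian_volume_space M \<mu>" "riemannian_volume_space N \<nu>"
    and T: "continuous_on (points M) T" "T ` points M = points N"
    and vp: "volume_preserving \<mu> \<nu> T"
  shows "T \<in> \<mu> \<rightarrow>\<^sub>M \<nu>" "distr \<mu> \<nu> T = \<nu>"
proof -
  interpret M: riemannian_volume_space M \<mu> by fact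
  interpret N: riemannian_volume_space N \<nu> by fact
  show m: "T \<in> \<mu> \<rightarrow>\<^sub>M \<nu>"
    using T by (intro measurable_continuous_map[OF assms(1,2)]) auto
  show "distr \<mu> \<nu> T = \<nu>"
  proof (rule measure_eqI)
    fix B assume "B \<in> sets (distr \<mu> \<nu> T)"
    then have B: "B \<in> sets \<nu>" by simp
    let ?A = "T -` B \<inter> space \<mu>"
    have "?A \<in> sets \<mu>"
      by (rule measurable_sets[OF m B])
    then have "emeasure \<nu> (T ` ?A) = emeasure \<mu> ?A"
      using vp by (simp add: volume_preserving_def)
    moreover have "T ` ?A = B"
    proof (intro equalityI subsetI)
      fix y assume "y \<in> B"
      then have "y \<in> T ` points M"
        using sets.sets_into_space[OF B] T(2) by auto
      with \<open>y \<in> B\<close> show "y \<in> T ` ?A"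
        by auto
    qed auto
    ultimately show "emeasure (distr \<mu> \<nu> T) B = emeasure \<nu> B"
      using m B by (simp add: emeasure_distr)
  qed simp
qed

theorem theorem5p1:
  fixes M :: "('a::t2_space, 'n::finite) riem" and N :: "('b::t2_space, 'n) riem"
    and \<mu> :: "'a measure" and \<nu> :: "'b measure"
    and T :: "'a \<Rightarrow> 'b" and f :: "'a \<Rightarrow> real" and x :: 'a and q :: "real^'n \<Rightarrow> real" and c :: real
    and \<kappa>M :: "'a \<Rightarrow> ('a, 'n) chart" and \<kappa>N :: "'b \<Rightarrow> ('b, 'n) chart"
  assumes "flat_compact_manifold M" and "riemannian_volume M \<mu>"
    and "flat_compact_manifold N" and "riemannian_volume N \<nu>"
    and "C_diffeo 3 M N T" and "volume_preserving \<mu> \<nu> T"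
    and "C_fun 3 M f"
    and "q \<in> borel_measurable borel" and "\<And>z. 0 \<le> q z" and "has_bochner_integral lborel q 1"
    and "compact (closure {z. q z \<noteq> 0})"
    and "(LINT z|lborel. q z *\<^sub>R z) = 0"
    and "(\<chi> i j. LINT z|lborel. z $ i * z $ j * q z) = c *\<^sub>R (mat 1 :: real^'n^'n)"
    and "difference_rule M \<kappa>M" and "difference_rule N \<kappa>N"
    and "x \<in> manifold_interior M"
    and "consistent_near M \<kappa>M x" and "consistent_near N \<kappa>N (T x)"
  shows "((\<lambda>\<epsilon>. let L = smoothed_transfer (points M) T \<mu> \<nu> \<kappa>M \<kappa>N q \<epsilon>
                 in (point_value \<mu> (L2_adjoint \<mu> \<nu> L (L f)) x - f x) / \<epsilon>\<^sup>2)
           \<longlongrightarrow> c * (laplacian M f x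
                  + transfer_adj T (laplacian N (transfer (points M) T f)) x)) (at_right 0)"
proof -
  have M: "riemannian_manifold M" "compact (points M)" and N: "riemannian_manifold N" "compact (points N)"
    using assms(1,3) by (auto simp: flat_compact_manifold_def)
  obtain \<rho> where \<rho>: "isotropic_density q \<rho> c"
    using isotropic_densityI[OF assms(8-13)] by blast
  have vM: "riemannian_volume_space M \<mu>" and vN: "riemannian_volume_space N \<nu>"
    using M N assms(2,4) by (auto intro: riemannian_volume_space.intro)
  let ?S = "inv_into (points M) T"
  have bij: "bij_betw T (points M) (points N)" and CT: "C_map 3 M N T" and CS: "C_map 3 N M ?S"
    using assms(5) by (auto simp: C_diffeo_def)
  have inj: "inj_on T (points M)" and img: "T ` points M = points N"
    using bij by (auto simp: bij_betw_def)
  have cT: "continuous_on (points M) T" and cS: "continuous_on (points N) ?S"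
    using CT CS by (auto simp: C_map_def)
  have ST: "?S (T p) = p" if "p \<in> points M" for p
    using inj that by simp
  have imgS: "?S ` points N \<subseteq> points M"
    using CS by (simp add: C_map_def)
  obtain a where a: "a \<in> charts M" "x \<in> chart_interior a"
    using assms(16) by (auto simp: manifold_interior_eq)
  have xM: "x \<in> points M"
    using a(2) chart_interior_subset[of a] top_chartD(3)[OF riemannian_manifoldD(1)[OF M(1) a(1)]] by blast
  have TxN: "T x \<in> points N" using xM img by auto
  obtain b where b: "b \<in> charts N" "T x \<in> fst b"
    using riemannian_manifold_cover[OF N(1) TxN] .
  \<comment> \<open>Interiority of \<open>T x\<close> comes from that of \<open>x\<close> by
    invariance of domain.\<close>
  have bi: "T x \<in> chart_interior b"
    by (rule image_chart_interior[OF M(1) N(1) cT inj _ a b]) (simp add: img)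
  obtain d where d: "x \<in> fst d" "flat_coordinates M d" "\<And>p. p \<in> fst d \<Longrightarrow> fst d \<subseteq> fst (\<kappa>M p)"
      "\<And>p y. p \<in> fst d \<Longrightarrow> y \<in> fst d \<Longrightarrow> snd (\<kappa>M p) p - snd (\<kappa>M p) y = snd d p - snd d y"
    using assms(17) unfolding consistent_near_def by (metis fst_conv snd_conv)
  obtain e where e: "T x \<in> fst e" "flat_coordinates N e" "\<And>p. p \<in> fst e \<Longrightarrow> fst e \<subseteq> fst (\<kappa>N p)"
      "\<And>p y. p \<in> fst e \<Longrightarrow> y \<in> fst e \<Longrightarrow> snd (\<kappa>N p) p - snd (\<kappa>N p) y = snd e p - snd e y"
    using assms(18) unfolding consistent_near_def by (metis fst_conv snd_conv)
  interpret M: consistent_point M \<mu> q \<rho> c \<kappa>M x d a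
    by (intro consistent_point.intro diffusion_space.intro diffusion_space_axioms.intro
        consistent_point_axioms.intro vM \<rho> assms(14) d a)
  interpret N: consistent_point N \<nu> q \<rho> c \<kappa>N "T x" e b
    by (intro consistent_point.intro diffusion_space.intro diffusion_space_axioms.intro
        consistent_point_axioms.intro vN \<rho> assms(15) e b(1) bi)
  let ?g = "f \<circ> ?S"
  have two: "enat 2 \<le> 3"
    by (simp add: numeral_eq_enat)
  have Cf: "C_near 2 M f x"
    by (rule C_fun_C_near[OF M(1) assms(7) two])
  have Cg: "C_near 2 N ?g (T x)"
    using Cf a by (intro C_near_compose[OF M(1) N(1) CS two _ a(1)]) (simp_all add: ST[OF xM])
  have cf: "continuous_on (points M) f"
    by (rule C_fun_continuous_on[OF M(1) assms(7)])
  let ?lM = "\<lambda>y. flat_laplacian (f \<circ> cinv d) (snd d y)" and ?lN = "\<lambda>y. flat_laplacian (?g \<circ> cinv e) (snd e y)"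
  define L where "L \<epsilon> = smoothed_transfer (points M) T \<mu> \<nu> \<kappa>M \<kappa>N q \<epsilon>" for \<epsilon>
  define B where "B \<epsilon> v = M.diffusion_adj \<epsilon> (transfer_adj T (N.diffusion_adj \<epsilon> v))" for \<epsilon> v
  have "expands_near (points M) x (\<lambda>\<epsilon>. f) f (\<lambda>_. 0)"
    unfolding expands_near_def
    using xM expands_const[OF cf] by (intro exI[of _ "points M"]) auto
  \<comment> \<open>Each diffusion adds \<open>c / 2\<close> times the Laplacian of its own leading
    term: that of \<open>f\<close> on \<open>M\<close>, then twice that of \<open>?g\<close> on
    \<open>N\<close>, then again that of \<open>f\<close>. Earlier corrections are only transported
    along \<open>T\<close>.\<close>
  from M.diffusion_expands(1)[OF this Cf]
  have "expands_near (points N) (T x) (\<lambda>\<epsilon>. transfer (points M) T (diffusion \<mu> \<kappa>M q \<epsilon> f)) ?g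
      ((\<lambda>y. 0 + c / 2 * ?lM y) \<circ> ?S)"
    unfolding transfer_def by (rule expands_near_compose[OF _ cS imgS TxN ST[OF xM]])
  from N.diffusion_expands(2)[OF N.diffusion_expands(1)[OF this Cg] Cg]
  have "expands_near (points N) (T x) (\<lambda>\<epsilon>. N.diffusion_adj \<epsilon> (L \<epsilon> f)) ?g
      (\<lambda>y. ((\<lambda>y. 0 + c / 2 * ?lM y) \<circ> ?S) y + c / 2 * ?lN y + c / 2 * ?lN y)"
    by (simp add: L_def smoothed_transfer_def)
  from expands_near_compose[OF this cT _ xM refl]
  have "expands_near (points M) x (\<lambda>\<epsilon>. transfer_adj T (N.diffusion_adj \<epsilon> (L \<epsilon> f))) (?g \<circ> T)
      ((\<lambda>y. ((\<lambda>y. 0 + c / 2 * ?lM y) \<circ> ?S) y + c / 2 * ?lN y + c / 2 * ?lN y) \<circ> T)"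
    unfolding transfer_adj_def by (simp add: img)
  then have "expands_near (points M) x (\<lambda>\<epsilon>. transfer_adj T (N.diffusion_adj \<epsilon> (L \<epsilon> f))) f
      ((\<lambda>y. ((\<lambda>y. 0 + c / 2 * ?lM y) \<circ> ?S) y + c / 2 * ?lN y + c / 2 * ?lN y) \<circ> T)"
    by (rule expands_near_cong) (simp add: ST)
  note last = M.diffusion_expands(2)[OF this Cf]
  define h where "h y = ((\<lambda>y. ((\<lambda>y. 0 + c / 2 * ?lM y) \<circ> ?S) y + c / 2 * ?lN y + c / 2 * ?lN y) \<circ> T) y + c / 2 * ?lM y" for y
  have ex: "expands_near (points M) x (\<lambda>\<epsilon>. B \<epsilon> (L \<epsilon> f)) f h"
    unfolding B_def h_def[abs_def] by (rule last)
  have h: "h x = c * (?lM x + ?lN (T x))"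
    by (simp add: h_def ST[OF xM] field_simps)
  have lap: "?lM x = laplacian M f x" "?lN (T x) = transfer_adj T (laplacian N (transfer (points M) T f)) x"
  proof -
    have "x \<in> manifold_interior M" "T x \<in> manifold_interior N"
      using assms(16) b(1) bi by (auto simp: manifold_interior_eq)
    then show "?lM x = laplacian M f x" "?lN (T x) = transfer_adj T (laplacian N (transfer (points M) T f)) x"
      using laplacian_eq_flat_laplacian[OF M(1) d(2,1) _ Cf] laplacian_eq_flat_laplacian[OF N(1) e(2,1) _ Cg]
      by (simp_all add: transfer_adj_def transfer_def)
  qed
  note mT = volume_preserving_distr[OF vM vN cT img assms(6)]
  have adjT: "is_L2_adjoint \<mu> \<nu> (transfer (points M) T) (transfer_adj T)"
    by (rule is_L2_adjoint_transfer[OF mT(1) measurable_continuous_map[OF vN vM cS imgS] M.space_\<mu> inj mT(2)])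
  have adj: "is_L2_adjoint \<mu> \<nu> (L \<epsilon>) (B \<epsilon>)" if \<epsilon>: "0 < \<epsilon>" for \<epsilon>
    using is_L2_adjoint_compose[OF is_L2_adjoint_compose[OF M.is_L2_adjoint_diffusion[OF \<epsilon>] adjT] N.is_L2_adjoint_diffusion[OF \<epsilon>]]
    unfolding L_def smoothed_transfer_def[abs_def] B_def[abs_def] .
  have ae: "AE y in \<mu>. L2_adjoint \<mu> \<nu> (L \<epsilon>) (L \<epsilon> f) y = B \<epsilon> (L \<epsilon> f) y" if \<epsilon>: "0 < \<epsilon>" for \<epsilon>
  proof (rule is_L2_adjoint_AE_unique[where A="L \<epsilon>" and B'="B \<epsilon>" and \<nu>=\<nu>])
    \<comment> \<open>The choice in \<open>L2_adjoint\<close> is meaningful because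
      \<open>B \<epsilon>\<close> is a witness.\<close>
    show "is_L2_adjoint \<mu> \<nu> (L \<epsilon>) (L2_adjoint \<mu> \<nu> (L \<epsilon>))"
      unfolding L2_adjoint_def by (rule someI[of _ "B \<epsilon>"]) (rule adj[OF \<epsilon>])
    show "is_L2_adjoint \<mu> \<nu> (L \<epsilon>) (B \<epsilon>)"
      by (rule adj[OF \<epsilon>])
    then show "L \<epsilon> f \<in> L2 \<nu>"
      using M.continuous_on_L2[OF cf] by (auto simp: is_L2_adjoint_def)
  qed
  obtain V where V: "mopen M V" "x \<in> V" "expands V (\<lambda>\<epsilon>. B \<epsilon> (L \<epsilon> f)) f h"
    using ex by (auto simp: expands_near_def)
  have "\<forall>\<^sub>F \<epsilon> in at_right (0::real). 0 < \<epsilon>"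
    by (auto simp: eventually_at_right_less)
  \<comment> \<open>The neighbourhood \<open>V\<close> does not depend on \<epsilon>, and for small
    \<epsilon> the function \<open>B \<epsilon> (L \<epsilon> f)\<close> is continuous on it; this
    is the version whose value \<open>point_value\<close> reads.\<close>
  with expandsD(1)[OF V(3)]
  have "\<forall>\<^sub>F \<epsilon> in at_right 0. (B \<epsilon> (L \<epsilon> f) x - f x) / \<epsilon>\<^sup>2
      = (let L = smoothed_transfer (points M) T \<mu> \<nu> \<kappa>M \<kappa>N q \<epsilon>
         in (point_value \<mu> (L2_adjoint \<mu> \<nu> L (L f)) x - f x) / \<epsilon>\<^sup>2)"
  proof eventually_elim
    case (elim \<epsilon>)
    have "point_value \<mu> (L2_adjoint \<mu> \<nu> (L \<epsilon>) (L \<epsilon> f)) x = B \<epsilon> (L \<epsilon> f) x"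
      by (rule M.point_value_eq[OF d(2,1) a V(1,2) elim(1) ae[OF elim(2)]])
    then show ?case
      by (simp add: L_def Let_def)
  qed
  from Lim_transform_eventually[OF expands_near_tendsto[OF ex] this]
  show ?thesis
    unfolding h lap .
qed

end
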